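(* Let $R$ be a commutative ring with unity containing $\mathbb{Q}$, let $a \in R$ be an arbitrary element (possibly a zerodivisor), and let $A = R[X_1,\dots,X_n]$ be the polynomial ring in $n$ variables over $R$. If $n-1$ polynomials $f_1,\dots,f_{n-1} \in A$ form an $a$-strongly partial residual coordinate system of colength $1$ in $A$ (that is, the images of $f_1,\dots,f_{n-1}$ form a partial coordinate system of colength $1$ in $A/aA = (R/aR)[X_1,\dots,X_n]$ over $R/aR$, and also in $A_a = R_a[X_1,\dots,X_n]$ over $R_a$), then $f_1,\dots,f_{n-1}$ form a partial coordinate system in $A$ over $R$, i.e. $A = R[f_1,\dots,f_{n-1}]^{[1]}$.
   Context: All rings are commutative with unity. For a ring $R$, $R^{[n]}$ denotes a polynomial algebra in $n$ variables over $R$. For $a \in R$, $R_a$ denotes the localization $R[1/a]$ of $R$ at the multiplicative set $\{1,a,a^2,\dots\}$, and $A_a$ is the corresponding localization of an $R$-algebra $A$. Let $A = R[X_1,\dots,X_n]$ and $m \le n$. Polynomials $f_1,\dots,f_m \in A$ are said to form a partial coordinate system (of colength $n-m$) in $A$ if $A = R[f_1,\dots,f_m]^{[n-m]}$, i.e. $A$ is a polynomial algebra in $n-m$ variables over its subring $R[f_1,\dots,f_m]$. The same definition is used with $R$ replaced by $R/aR$ (and $A$ by $A/aA$) or by $R_a$ (and $A$ by $A_a$). For $a \in R$, polynomials $f_1,\dots,f_m \in A$ are said to form an $a$-strongly partial residual coordinate system (of colength $n-m$) in $A$ if the images of $f_1,\dots,f_m$ form a partial coordinate system (of colength $n-m$)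 in $A/aA$ (over $R/aR$) and also in $A_a$ (over $R_a$). *)

theory Defs
  imports "HOL-Algebra.Algebra" "HOL-Algebra.Algebraic_Closure_Type"
begin

text \<open>
  The polynomial ring \<open>R[X\<^sub>0,\<dots>,X\<^bsub>n-1\<^esub>]\<close>: the indexed polynomials of the library (functions from
  monomials, i.e. multisets of variable indices, to coefficients) with the convolution product.
\<close>

definition mpoly_ring :: "('a, 'b) ring_scheme \<Rightarrow> nat \<Rightarrow> (nat multiset \<Rightarrow> 'a) ring"
  where "mpoly_ring R n =
    \<lparr> carrier = ring.indexed_pset R {..<n} (carrier R),
      monoid.mult = (\<lambda>p q m. \<Oplus>\<^bsub>R\<^esub>k\<in>{k. k \<subseteq># m}. p k \<otimes>\<^bsub>R\<^esub> q (m - k)),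
      one = ring.indexed_const R \<one>\<^bsub>R\<^esub>,
      ring.zero = ring.indexed_const R \<zero>\<^bsub>R\<^esub>,
      add = ring.indexed_padd R \<rparr>"

text \<open>\<open>B = S\<^bsup>[k]\<^esup>\<close> for a subring \<open>S\<close> of \<open>B\<close>: an isomorphism of \<open>S\<close>-algebras, hence the
  condition that \<open>h\<close> restricts to the inclusion of \<open>S\<close> on constant polynomials.\<close>

definition polynomial_algebra_over :: "('a, 'b) ring_scheme \<Rightarrow> 'a set \<Rightarrow> nat \<Rightarrow> bool"
  where "polynomial_algebra_over B S k \<longleftrightarrow>
    subring S B \<and>
    (\<exists>h \<in> ring_iso (mpoly_ring (B\<lparr>carrier := S\<rparr>) k) B.
      \<forall>s\<in>S. h (ring.indexed_const (B\<lparr>carrier := S\<rparr>) s) = s)"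

definition subalgebra_generated ::
    "('a, 'b) ring_scheme \<Rightarrow> nat \<Rightarrow> (nat multiset \<Rightarrow> 'a) set \<Rightarrow> (nat multiset \<Rightarrow> 'a) set"
  where "subalgebra_generated R n F =
    generate_ring (mpoly_ring R n) (ring.indexed_const R ` carrier R \<union> F)"

text \<open>The polynomials under consideration are \<open>f 0, \<dots>, f (m - 1)\<close>; other values of \<open>f\<close> are
  irrelevant.\<close>

definition partial_coordinate_system ::
    "('a, 'b) ring_scheme \<Rightarrow> nat \<Rightarrow> nat \<Rightarrow> (nat \<Rightarrow> nat multiset \<Rightarrow> 'a) \<Rightarrow> bool"
  where "partial_coordinate_system R n m f \<longleftrightarrow>
    m \<le> n \<and> f ` {..<m} \<subseteq> carrier (mpoly_ring R n) \<and>
    polynomial_algebra_over (mpoly_ring R n) (subalgebra_generated R n (f ` {..<m})) (n - m)"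

text \<open>
  Localization at a multiplicative set \<open>S\<close>, as classes of pairs (numerator, denominator). The
  factor \<open>t\<close> is needed because \<open>S\<close> may contain zero divisors (or zero).
\<close>

definition fraction_rel :: "('a, 'b) ring_scheme \<Rightarrow> 'a set \<Rightarrow> (('a \<times> 'a) \<times> ('a \<times> 'a)) set"
  where "fraction_rel R S =
    {((r, s), (r', s')). r \<in> carrier R \<and> s \<in> S \<and> r' \<in> carrier R \<and> s' \<in> S \<and>
       (\<exists>t\<in>S. t \<otimes>\<^bsub>R\<^esub> (r \<otimes>\<^bsub>R\<^esub> s' \<ominus>\<^bsub>R\<^esub> r' \<otimes>\<^bsub>R\<^esub> s) = \<zero>\<^bsub>R\<^esub>)}"

definition fraction :: "('a, 'b) ring_scheme \<Rightarrow> 'a set \<Rightarrow> 'a \<Rightarrow> 'a \<Rightarrow> ('a \<times> 'a) set"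
  where "fraction R S r s = fraction_rel R S `` {(r, s)}"

definition localization :: "('a, 'b) ring_scheme \<Rightarrow> 'a set \<Rightarrow> (('a \<times> 'a) set) ring"
  where "localization R S =
    \<lparr> carrier = (carrier R \<times> S) // fraction_rel R S,
      monoid.mult = (\<lambda>x y. \<Union>(r, s)\<in>x. \<Union>(r', s')\<in>y.
        fraction R S (r \<otimes>\<^bsub>R\<^esub> r') (s \<otimes>\<^bsub>R\<^esub> s')),
      one = fraction R S \<one>\<^bsub>R\<^esub> \<one>\<^bsub>R\<^esub>,
      ring.zero = fraction R S \<zero>\<^bsub>R\<^esub> \<one>\<^bsub>R\<^esub>,
      add = (\<lambda>x y. \<Union>(r, s)\<in>x. \<Union>(r', s')\<in>y.
        fraction R S (r \<otimes>\<^bsub>R\<^esub> s' \<oplus>\<^bsub>R\<^esub> r' \<otimes>\<^bsub>R\<^esub> s) (s \<otimes>\<^bsub>R\<^esub> s')) \<rparr>"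

definition powers :: "('a, 'b) ring_scheme \<Rightarrow> 'a \<Rightarrow> 'a set"
  where "powers R a = range (\<lambda>k::nat. a [^]\<^bsub>R\<^esub> k)"

text \<open>
  \<open>A/aA\<close> and \<open>A\<^sub>a\<close> are taken as \<open>(R/aR)[X\<^sub>0,\<dots>,X\<^bsub>n-1\<^esub>]\<close> and \<open>R\<^sub>a[X\<^sub>0,\<dots>,X\<^bsub>n-1\<^esub>]\<close>, so that the
  image of \<open>f i\<close> is obtained by mapping each coefficient \<open>r\<close> to its coset \<open>r + aR\<close>, respectively
  to the fraction \<open>r/1\<close>.
\<close>

definition strongly_partial_residual_coordinate_system ::
    "('a, 'b) ring_scheme \<Rightarrow> nat \<Rightarrow> nat \<Rightarrow> 'a \<Rightarrow> (nat \<Rightarrow> nat multiset \<Rightarrow> 'a) \<Rightarrow> bool"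
  where "strongly_partial_residual_coordinate_system R n m a f \<longleftrightarrow>
    m \<le> n \<and> f ` {..<m} \<subseteq> carrier (mpoly_ring R n) \<and>
    partial_coordinate_system (R Quot (PIdl\<^bsub>R\<^esub> a)) n m
      (\<lambda>i. (\<lambda>r. PIdl\<^bsub>R\<^esub> a +>\<^bsub>R\<^esub> r) \<circ> f i) \<and>
    partial_coordinate_system (localization R (powers R a)) n m
      (\<lambda>i. (\<lambda>r. fraction R (powers R a) r \<one>\<^bsub>R\<^esub>) \<circ> f i)"

definition contains_rationals :: "('a, 'b) ring_scheme \<Rightarrow> bool"
  where "contains_rationals R \<longleftrightarrow>
    (\<exists>h \<in> ring_hom (ring_of_type_algebra :: rat ring) R. inj h)"

end

theory Submission
  imports Defs "HOL-Computational_Algebra.Polynomial" "HOL-Library.Poly_Mapping"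
    "Jordan_Normal_Form.Determinant"
begin

text \<open>
  Let \<open>A = R[X\<^sub>0,\<dots>,X\<^bsub>n-1\<^esub>]\<close> and \<open>S = R[f\<^sub>0,\<dots>,f\<^bsub>n-2\<^esub>]\<close>. The Jacobian determinant
  \<open>D x = det (\<partial>(f\<^sub>0,\<dots>,f\<^bsub>n-2\<^esub>,x) / \<partial>(X\<^sub>0,\<dots>,X\<^bsub>n-1\<^esub>))\<close> is a derivation of \<open>A\<close> that vanishes on \<open>S\<close>, and it
  is compatible with passing to \<open>A/aA\<close> and to \<open>A\<^sub>a\<close>. In both of these rings \<open>A\<close> becomes \<open>S[g]\<close> for
  a single element \<open>g\<close>, and the chain rule, read as a matrix identity, makes \<open>D g\<close> a unit there
  (\<open>jacobian_unit\<close>). So \<open>D\<close> is a unit times \<open>d/dg\<close>. As positive integers are invertible, it follows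
  that in both rings \<open>g\<close> is transcendental over \<open>S\<close>, \<open>D\<close> is surjective and has kernel \<open>S\<close>; and because
  a unit of \<open>S[g]\<close> is a constant up to nilpotent coefficients, \<open>D\<close> is locally nilpotent. Hence any \<open>h\<close>
  with \<open>D h = 1\<close> also generates both rings over \<open>S\<close> (\<open>slice_generates\<close>).

  The global statement is obtained by applying one descent principle twice
  (\<open>submodule_contains_all\<close>). Let \<open>W\<close> be an \<open>S\<close>-submodule of \<open>A\<close> with \<open>W + aA = A\<close>, such that every
  element of \<open>A\<close> is taken into \<open>W\<close> by a power of \<open>a\<close>, and such that \<open>W \<inter> aA = aW\<close>. Then \<open>W = A\<close>. If \<open>a\<close>
  is not a zero divisor this is plain. In general, \<open>a x \<in> W\<close> gives \<open>a (x - w) = 0\<close> for some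
  \<open>w \<in> W\<close>; the elements of \<open>A\<close> killed by \<open>a\<close> are combinations of constants killed by \<open>a\<close>, and
  \<open>W + aA = A\<close> shows that such a constant multiplies all of \<open>A\<close> into \<open>W\<close>.

  With \<open>W = D A\<close> this yields \<open>h\<close> with \<open>D h = 1\<close>: if \<open>a y = D x\<close> then \<open>x\<close> lies in the kernel of \<open>D\<close>
  modulo \<open>a\<close>, so \<open>x = s + a x'\<close> with \<open>s \<in> S\<close>, and \<open>a y = a D x'\<close>. With \<open>W = S[h]\<close> it yields
  \<open>A = S[h]\<close>; here \<open>W \<inter> aA = aW\<close> because \<open>h\<close> is transcendental over \<open>S\<close> modulo \<open>a\<close> and because
  \<open>S \<inter> aA = aS\<close>, that is, \<open>f\<^sub>0,\<dots>,f\<^bsub>n-2\<^esub>\<close> are algebraically independent modulo \<open>a\<close>. The latter is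
  proved with the derivations dual to the \<open>f\<^sub>i\<close> that the adjugate of the Jacobian matrix supplies
  (\<open>algebraic_independence_mod\<close>). Finally \<open>D h = 1\<close> makes \<open>h\<close> transcendental over \<open>S\<close>, so \<open>A\<close> is a
  polynomial algebra in \<open>h\<close>.

  The computations take place in a polynomial ring over a ring that is a type. Every commutative
  ring \<open>R\<close> given as a record is the image of such a ring, namely of the product of all commutative
  rings with elements in the same type (\<open>ring_family\<close>). Statements about \<open>R\<close>, \<open>R/aR\<close> and \<open>R\<^sub>a\<close> then become
  congruences modulo the kernels of the induced maps of polynomial rings, where denominators of
  \<open>R\<^sub>a\<close> are cleared by powers of \<open>a\<close>.
\<close>

section \<open>Derivations modulo an ideal\<close>

locale ring_ideal =
  fixes J :: "'r::comm_ring_1 set"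
  assumes zero: "0 \<in> J"
    and add: "x \<in> J \<Longrightarrow> y \<in> J \<Longrightarrow> x + y \<in> J"
    and mult: "x \<in> J \<Longrightarrow> r * x \<in> J"
begin

lemma mult': "x \<in> J \<Longrightarrow> x * r \<in> J"
  using mult[of x r] by (simp add: mult.commute)

lemma uminus: "x \<in> J \<Longrightarrow> - x \<in> J"
  using mult[of x "-1"] by simp

lemma diff: "x \<in> J \<Longrightarrow> y \<in> J \<Longrightarrow> x - y \<in> J"
  using add[of x "- y"] uminus by simp

lemma sum: "(\<And>i. i \<in> A \<Longrightarrow> f i \<in> J) \<Longrightarrow> sum f A \<in> J"
  by (induction A rule: infinite_finite_induct) (auto intro: zero add)

lemma trans: "x - y \<in> J \<Longrightarrow> y - z \<in> J \<Longrightarrow> x - z \<in> J"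
  using add[of "x - y" "y - z"] by simp

lemma sym: "x - y \<in> J \<Longrightarrow> y - x \<in> J"
  using uminus[of "x - y"] by simp

lemma mem_cong: "x - y \<in> J \<Longrightarrow> y \<in> J \<Longrightarrow> x \<in> J"
  using add[of "x - y" y] by simp

lemma cong_mult: "x - y \<in> J \<Longrightarrow> r * x - r * y \<in> J"
  using mult[of "x - y" r] by (simp add: right_diff_distrib)

lemma cong_add: "x - y \<in> J \<Longrightarrow> x' - y' \<in> J \<Longrightarrow> (x + x') - (y + y') \<in> J"
  using add[of "x - y" "x' - y'"] by (simp add: algebra_simps)

lemma poly_mem: "(\<And>i. coeff p i \<in> J) \<Longrightarrow> poly p x \<in> J"
  unfolding poly_altdef by (intro sum mult') auto

end

definition polys_over :: "'r::comm_ring_1 set \<Rightarrow> 'r poly set"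
  where "polys_over S = {p. \<forall>i. coeff p i \<in> S}"

definition formal_derivative :: "'r::comm_ring_1 poly \<Rightarrow> 'r poly"
  where "formal_derivative p = (\<Sum>i<degree p. monom (of_nat (Suc i) * coeff p (Suc i)) i)"

lemma coeff_formal_derivative:
  "coeff (formal_derivative p) i = of_nat (Suc i) * coeff p (Suc i)"
  by (auto simp: formal_derivative_def coeff_sum if_distrib coeff_eq_0 cong: if_cong)

lemma formal_derivative_pCons:
  "formal_derivative (pCons c p) = p + pCons 0 (formal_derivative p)"
proof (rule poly_eqI)
  fix i
  show "coeff (formal_derivative (pCons c p)) i = coeff (p + pCons 0 (formal_derivative p)) i"
    by (cases i) (auto simp: coeff_formal_derivative algebra_simps)
qed

lemma degree_formal_derivative: "degree p \<le> Suc d \<Longrightarrow> degree (formal_derivative p) \<le> d"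
  by (rule degree_le) (auto simp: coeff_formal_derivative coeff_eq_0)

locale subring_set =
  fixes S :: "'r::comm_ring_1 set"
  assumes one_S: "1 \<in> S"
    and S_add: "s \<in> S \<Longrightarrow> t \<in> S \<Longrightarrow> s + t \<in> S"
    and S_mult: "s \<in> S \<Longrightarrow> t \<in> S \<Longrightarrow> s * t \<in> S"
    and S_uminus: "s \<in> S \<Longrightarrow> - s \<in> S"
begin

lemma zero_S: "0 \<in> S"
  using S_add[OF one_S S_uminus[OF one_S]] by simp

lemma S_diff: "s \<in> S \<Longrightarrow> t \<in> S \<Longrightarrow> s - t \<in> S"
  using S_add[of s "- t"] S_uminus by simp

lemma S_sum: "(\<And>i. i \<in> A \<Longrightarrow> f i \<in> S) \<Longrightarrow> sum f A \<in> S"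
  by (induction A rule: infinite_finite_induct) (auto intro: zero_S S_add)

lemma S_power: "s \<in> S \<Longrightarrow> s ^ k \<in> S"
  by (induction k) (auto intro: one_S S_mult)

lemma S_of_nat: "of_nat k \<in> S"
  by (induction k) (auto intro: zero_S one_S S_add)

lemma polys_overI: "(\<And>i. coeff p i \<in> S) \<Longrightarrow> p \<in> polys_over S"
  by (simp add: polys_over_def)

lemma polys_overD: "p \<in> polys_over S \<Longrightarrow> coeff p i \<in> S"
  by (simp add: polys_over_def)

lemma polys_over_const: "s \<in> S \<Longrightarrow> [:s:] \<in> polys_over S"
  by (auto intro!: polys_overI zero_S simp: coeff_pCons split: nat.split)

lemma polys_over_var: "[:0, 1:] \<in> polys_over S"
  by (auto intro!: polys_overI zero_S one_S simp: coeff_pCons split: nat.split)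

lemma polys_over_add: "p \<in> polys_over S \<Longrightarrow> q \<in> polys_over S \<Longrightarrow> p + q \<in> polys_over S"
  by (auto intro!: polys_overI S_add dest: polys_overD)

lemma polys_over_diff: "p \<in> polys_over S \<Longrightarrow> q \<in> polys_over S \<Longrightarrow> p - q \<in> polys_over S"
  by (auto intro!: polys_overI S_diff dest: polys_overD)

lemma polys_over_uminus: "p \<in> polys_over S \<Longrightarrow> - p \<in> polys_over S"
  by (auto intro!: polys_overI S_uminus dest: polys_overD)

lemma polys_over_mult: "p \<in> polys_over S \<Longrightarrow> q \<in> polys_over S \<Longrightarrow> p * q \<in> polys_over S"
  by (auto intro!: polys_overI S_sum S_mult dest: polys_overD simp: coeff_mult)

lemma polys_over_smult: "s \<in> S \<Longrightarrow> p \<in> polys_over S \<Longrightarrow> smult s p \<in> polys_over S"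
  by (auto intro!: polys_overI S_mult dest: polys_overD)

lemma polys_over_monom: "s \<in> S \<Longrightarrow> monom s i \<in> polys_over S"
  by (auto intro!: polys_overI zero_S)

lemma polys_over_formal_derivative: "p \<in> polys_over S \<Longrightarrow> formal_derivative p \<in> polys_over S"
  by (auto intro!: polys_overI S_mult[OF S_of_nat] dest: polys_overD
      simp: coeff_formal_derivative simp del: of_nat_Suc)

end

locale derivation_with_constants = subring_set S
  for D :: "'r::comm_ring_1 \<Rightarrow> 'r" and S :: "'r set" +
  assumes D_add: "D (x + y) = D x + D y"
    and D_mult: "D (x * y) = D x * y + x * D y"
    and D_S: "s \<in> S \<Longrightarrow> D s = 0"
begin

lemma D_zero: "D 0 = 0"
  using D_S[OF zero_S] .

lemma D_uminus: "D (- x) = - D x"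
  using D_add[of x "- x"] D_zero by (simp add: eq_neg_iff_add_eq_0 add.commute)

lemma D_diff: "D (x - y) = D x - D y"
  using D_add[of x "- y"] D_uminus by simp

lemma D_scale: "s \<in> S \<Longrightarrow> D (s * x) = s * D x"
  by (simp add: D_mult D_S)

lemma D_iter_add: "(D ^^ m) (x + y) = (D ^^ m) x + (D ^^ m) y"
  by (induction m) (auto simp: D_add)

lemma D_iter_diff: "(D ^^ m) (x - y) = (D ^^ m) x - (D ^^ m) y"
  by (induction m) (auto simp: D_diff)

lemma D_iter_scale: "s \<in> S \<Longrightarrow> (D ^^ m) (s * x) = s * (D ^^ m) x"
  by (induction m) (auto simp: D_scale)

lemma D_poly:
  assumes "p \<in> polys_over S"
  shows "D (poly p x) = poly (formal_derivative p) x * D x"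
  using assms
proof (induction p)
  case 0
  then show ?case by (simp add: D_zero formal_derivative_def)
next
  case (pCons c p)
  have c: "c \<in> S" using polys_overD[OF pCons.prems, of 0] by simp
  have "p \<in> polys_over S"
    using polys_overD[OF pCons.prems, of "Suc _"] by (auto intro!: polys_overI)
  then have "D (poly p x) = poly (formal_derivative p) x * D x" by (rule pCons.IH)
  then show ?case
    by (simp add: formal_derivative_pCons D_add D_mult D_S[OF c] algebra_simps)
qed

end

locale differential_ideal = derivation_with_constants D S + ring_ideal J
  for D :: "'r::comm_ring_1 \<Rightarrow> 'r" and S J +
  assumes D_J: "x \<in> J \<Longrightarrow> D x \<in> J"
    and inverse_nat: "n > 0 \<Longrightarrow> \<exists>c\<in>S. of_nat n * c - 1 \<in> J"
begin

lemma D_iter_J: "x \<in> J \<Longrightarrow> (D ^^ m) x \<in> J"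
  by (induction m) (auto simp: D_J)

lemma cancel_nat:
  assumes "of_nat n * x \<in> J" "n > 0"
  shows "x \<in> J"
proof -
  obtain c where c: "of_nat n * c - 1 \<in> J" using inverse_nat[OF assms(2)] by blast
  have "x = c * (of_nat n * x) - x * (of_nat n * c - 1)" by (simp add: algebra_simps)
  also have "\<dots> \<in> J" by (intro diff mult assms c)
  finally show ?thesis .
qed

text \<open>Integration term by term, with inverses of the positive integers modulo \<open>J\<close>.\<close>

lemma exists_primitive:
  assumes "p \<in> polys_over S"
  shows "\<exists>q\<in>polys_over S. \<forall>x. D (poly q x) - poly p x * D x \<in> J"
proof -
  obtain c where c: "\<And>i. c i \<in> S" "\<And>i. of_nat (Suc i) * c i - 1 \<in> J"
  proof -
    have "\<forall>i. \<exists>c\<in>S. of_nat (Suc i) * c - 1 \<in> J" using inverse_nat[of "Suc _"] by blast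
    then show thesis using that by metis
  qed
  define q where "q = pCons 0 (\<Sum>i\<le>degree p. monom (c i * coeff p i) i)"
  have q: "coeff q (Suc i) = c i * coeff p i" for i
    by (auto simp: q_def coeff_sum if_distrib coeff_eq_0 cong: if_cong)
  have q0: "coeff q 0 = 0" by (simp add: q_def)
  have qS: "q \<in> polys_over S"
  proof (rule polys_overI)
    show "coeff q i \<in> S" for i
      using polys_overD[OF assms] c by (cases i) (auto simp: q q0 intro: zero_S S_mult)
  qed
  have "coeff (formal_derivative q - p) i \<in> J" for i
  proof -
    have "coeff (formal_derivative q - p) i = (of_nat (Suc i) * c i - 1) * coeff p i"
      by (simp add: coeff_formal_derivative q algebra_simps)
    then show ?thesis using c(2) mult' by simp
  qed
  then have "poly (formal_derivative q - p) x * D x \<in> J" for x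
    by (intro mult' poly_mem)
  then have "D (poly q x) - poly p x * D x \<in> J" for x
    using D_poly[OF qS, of x] by (simp add: algebra_simps)
  then show ?thesis using qS by blast
qed

text \<open>By the Leibniz rule, the elements killed by a power of \<open>D\<close> form a ring.\<close>

lemma nilpotent_mult:
  "(D ^^ i) x \<in> J \<Longrightarrow> (D ^^ j) y \<in> J \<Longrightarrow> (D ^^ (i + j)) (x * y) \<in> J"
proof (induction "i + j" arbitrary: i j x y)
  case 0
  then show ?case by (auto intro: mult')
next
  case (Suc n)
  show ?case
  proof (cases "i = 0 \<or> j = 0")
    case True
    then have "x * y \<in> J" using Suc.prems by (auto intro: mult mult')
    then show ?thesis by (rule D_iter_J)
  next
    case False
    then obtain i' j' where ij: "i = Suc i'" "j = Suc j'" by (meson not0_implies_Suc)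
    have "(D ^^ (i' + j)) (D x * y) \<in> J"
      using Suc.prems Suc.hyps(2) ij by (intro Suc.hyps(1)) (auto simp: funpow_swap1)
    moreover have "(D ^^ (i + j')) (x * D y) \<in> J"
      using Suc.prems Suc.hyps(2) ij by (intro Suc.hyps(1)) (auto simp: funpow_swap1)
    moreover have "i + j' = i' + j" using ij by simp
    ultimately have "(D ^^ (i' + j)) (D (x * y)) \<in> J"
      by (simp only: D_mult D_iter_add add)
    then show ?thesis using ij by (simp add: funpow_swap1)
  qed
qed

lemma nilpotent_mono: "(D ^^ i) x \<in> J \<Longrightarrow> i \<le> j \<Longrightarrow> (D ^^ j) x \<in> J"
  using D_iter_J[of "(D ^^ i) x" "j - i"] by (simp flip: funpow_add comp_apply[of "D ^^ _" "D ^^ _"])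

lemma nilpotent_add:
  assumes "(D ^^ i) x \<in> J" "(D ^^ j) y \<in> J"
  shows "(D ^^ (i + j)) (x + y) \<in> J"
  using nilpotent_mono[OF assms(1), of "i + j"] nilpotent_mono[OF assms(2), of "i + j"]
  by (simp add: D_iter_add add)

lemma nilpotent_poly:
  assumes "(D ^^ i) g \<in> J" "p \<in> polys_over S"
  shows "\<exists>m. (D ^^ m) (poly p g) \<in> J"
  using assms(2)
proof (induction p)
  case 0
  then show ?case by (auto intro!: exI[of _ 0] zero)
next
  case (pCons c p)
  have c: "c \<in> S" using polys_overD[OF pCons.prems, of 0] by simp
  have "p \<in> polys_over S"
    using polys_overD[OF pCons.prems, of "Suc _"] by (auto intro!: polys_overI)
  then obtain m where "(D ^^ m) (poly p g) \<in> J" using pCons.IH by blast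
  then have "(D ^^ (i + m)) (g * poly p g) \<in> J" using assms(1) by (intro nilpotent_mult)
  moreover have "(D ^^ 1) c \<in> J" using D_S[OF c] zero by simp
  ultimately show ?case using nilpotent_add by (metis poly_pCons)
qed

end

text \<open>
  A \<open>b\<close>-saturated ideal \<open>J\<close> is the contraction of an ideal of the localization at \<open>b\<close>: a
  congruence modulo \<open>J\<close> that holds after multiplication by a power of \<open>b\<close> is a congruence in that
  localization. The choice \<open>b = 1\<close> covers plain residue rings.
\<close>

locale local_ideal = differential_ideal D S J
  for D :: "'r::comm_ring_1 \<Rightarrow> 'r" and S J and b +
  assumes b_S: "b \<in> S" and saturated: "b * x \<in> J \<Longrightarrow> x \<in> J"
begin

lemma saturated_power: "b ^ k * x \<in> J \<Longrightarrow> x \<in> J"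
proof (induction k)
  case (Suc k)
  then show ?case using saturated[of "b ^ k * x"] by (simp add: mult.assoc)
qed simp

lemma cancel_unit:
  assumes "u * y - b ^ k \<in> J" "x * y \<in> J"
  shows "x \<in> J"
proof (rule saturated_power)
  have "b ^ k * x = u * (x * y) - x * (u * y - b ^ k)" by (simp add: algebra_simps)
  also have "\<dots> \<in> J" by (intro diff mult assms)
  finally show "b ^ k * x \<in> J" .
qed

text \<open>
  If \<open>D g\<close> is a unit, then applying \<open>D\<close> to a polynomial relation for \<open>g\<close> over \<open>S\<close> gives a relation of
  smaller degree whose coefficients are positive integer multiples of the original ones.
\<close>

lemma transcendental:
  assumes u: "u * D g - b ^ k \<in> J"
  shows "p \<in> polys_over S \<Longrightarrow> poly p g \<in> J \<Longrightarrow> coeff p i \<in> J"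
proof (induction "degree p" arbitrary: p i rule: less_induct)
  case less
  have pos: "coeff p (Suc i) \<in> J" for i
  proof (cases "degree p = 0")
    case True
    then show ?thesis using zero by (simp add: coeff_eq_0)
  next
    case False
    then have deg: "degree (formal_derivative p) < degree p"
      using degree_formal_derivative[of p "degree p - 1"] by simp
    have "poly (formal_derivative p) g * D g \<in> J"
      using D_J[OF less.prems(2)] D_poly[OF less.prems(1)] by simp
    then have "poly (formal_derivative p) g \<in> J"
      by (rule cancel_unit[OF u])
    then have "coeff (formal_derivative p) i \<in> J"
      using less.hyps[OF deg polys_over_formal_derivative[OF less.prems(1)]] by simp
    then show ?thesis
      using cancel_nat[of "Suc i"] by (simp add: coeff_formal_derivative)
  qed
  have eq: "poly p g = coeff p 0 + g * poly (poly_shift 1 p) g"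
  proof -
    have "p = pCons (coeff p 0) (poly_shift 1 p)"
      by (rule poly_eqI) (simp add: coeff_poly_shift coeff_pCons split: nat.split)
    then show ?thesis by (metis poly_pCons)
  qed
  have "g * poly (poly_shift 1 p) g \<in> J"
    using pos by (intro mult poly_mem) (simp add: coeff_poly_shift)
  then have "coeff p 0 \<in> J"
    using diff[OF less.prems(2)] eq by fastforce
  then show ?case using pos by (cases i) auto
qed

text \<open>
  A polynomial in \<open>g\<close> that \<open>D\<close> kills has derivative zero by transcendence of \<open>g\<close>; in characteristic
  zero only its constant term survives.
\<close>

lemma constant_mod:
  assumes u: "u * D g - b ^ k \<in> J" and p: "p \<in> polys_over S" and D: "D (poly p g) \<in> J"
  shows "poly p g - coeff p 0 \<in> J"
proof -
  have "poly (formal_derivative p) g \<in> J"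
    using D cancel_unit[OF u] D_poly[OF p] by simp
  then have "coeff (formal_derivative p) i \<in> J" for i
    using transcendental[OF u polys_over_formal_derivative[OF p]] by simp
  then have "coeff p (Suc i) \<in> J" for i
    using cancel_nat[of "Suc i"] by (simp add: coeff_formal_derivative)
  then have "poly (p - [:coeff p 0:]) g \<in> J"
    using zero by (intro poly_mem) (simp add: coeff_pCons split: nat.split)
  then show ?thesis by simp
qed

end

text \<open>After inverting \<open>b\<close> and modulo \<open>J\<close>, the ring is \<open>S[g]\<close> and \<open>D g\<close> is a unit.\<close>

locale local_generator = local_ideal D S J b
  for D :: "'r::comm_ring_1 \<Rightarrow> 'r" and S J b and g +
  fixes u k0
  assumes generates: "\<exists>k. \<exists>p\<in>polys_over S. b ^ k * x - poly p g \<in> J"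
    and unit: "u * D g - b ^ k0 \<in> J"
begin

text \<open>Since \<open>D\<close> is \<open>D g\<close> times \<open>d/dg\<close>, the equation \<open>D x = y\<close> is solved by integrating \<open>y / D g\<close>.\<close>

lemma D_surjective: "\<exists>k x. D x - b ^ k * y \<in> J"
proof -
  obtain k p where p: "p \<in> polys_over S" "b ^ k * (u * y) - poly p g \<in> J"
    using generates by blast
  obtain q where q: "D (poly q g) - poly p g * D g \<in> J"
    using exists_primitive[OF p(1)] by blast
  have "D (poly q g) - b ^ (k0 + k) * y =
    (D (poly q g) - poly p g * D g) - (b ^ k * (u * y) - poly p g) * D g
      + b ^ k * y * (u * D g - b ^ k0)"
    by (simp add: algebra_simps power_add)
  also have "\<dots> \<in> J" by (intro add diff q mult unit mult' p)
  finally show ?thesis by blast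
qed

lemma kernel_D:
  assumes "D x \<in> J"
  shows "\<exists>k. \<exists>s\<in>S. b ^ k * x - s \<in> J"
proof -
  obtain k p where p: "p \<in> polys_over S" "b ^ k * x - poly p g \<in> J"
    using generates by blast
  have "D (poly p g) = b ^ k * D x - D (b ^ k * x - poly p g)"
    using b_S by (simp add: D_diff D_scale S_power)
  then have "D (poly p g) \<in> J" using assms p D_J diff mult by simp
  then have "poly p g - coeff p 0 \<in> J" using constant_mod[OF unit p(1)] by simp
  then have "b ^ k * x - coeff p 0 \<in> J" using p trans by blast
  then show ?thesis using polys_overD[OF p(1)] by blast
qed

end

text \<open>
  The coefficients of positive degree of a unit of a polynomial ring are nilpotent. For the leading
  coefficient \<open>s\<close> of \<open>p\<close>, comparison of the coefficients of \<open>p q\<close> from the top shows that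
  \<open>s\<^bsup>j+1\<^esup>\<close> kills the \<open>j\<close>-th coefficient of \<open>q\<close> from the top; for \<open>j\<close> the degree of \<open>q\<close> this is the
  constant term of \<open>q\<close>, which is a unit if \<open>p q\<close> has a unit as constant term.
\<close>

lemma leading_coeff_power_mem:
  fixes p q :: "'r::comm_ring_1 poly"
  assumes "ring_ideal J" and deg: "degree p \<le> Suc d" and dq: "degree q \<le> m"
    and J: "\<And>i. i > 0 \<Longrightarrow> coeff (p * q) i \<in> J"
  shows "j \<le> m \<Longrightarrow> coeff p (Suc d) ^ Suc j * coeff q (m - j) \<in> J"
proof (induction j rule: less_induct)
  case (less j)
  interpret ring_ideal J by fact
  let ?s = "coeff p (Suc d)"
  let ?n = "Suc d + (m - j)"
  have "coeff (p * q) ?n = (\<Sum>i\<le>?n. coeff p i * coeff q (?n - i))"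
    by (simp add: coeff_mult)
  also have "\<dots> = ?s * coeff q (m - j) + (\<Sum>i\<in>{..?n} - {Suc d}. coeff p i * coeff q (?n - i))"
    by (subst sum.remove[of _ "Suc d"]) auto
  finally have eq: "?s ^ Suc j * coeff q (m - j) = ?s ^ j * coeff (p * q) ?n
      - (\<Sum>i\<in>{..?n} - {Suc d}. coeff p i * (?s ^ j * coeff q (?n - i)))"
    by (simp add: algebra_simps sum_distrib_left)
  have "coeff p i * (?s ^ j * coeff q (?n - i)) \<in> J" if "i \<in> {..?n} - {Suc d}" for i
  proof (cases "i > Suc d \<or> ?n - i > m")
    case True
    then have "coeff p i = 0 \<or> coeff q (?n - i) = 0"
      using deg dq by (auto intro!: coeff_eq_0)
    then show ?thesis using zero by auto
  next
    case False
    define l where "l = m - (?n - i)"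
    have l: "l < j" "?n - i = m - l" using False that less.prems by (auto simp: l_def)
    then have "?s ^ Suc l * coeff q (m - l) \<in> J" using less by simp
    then have "?s ^ (j - Suc l) * (?s ^ Suc l * coeff q (m - l)) \<in> J" by (rule mult)
    then have "?s ^ j * coeff q (m - l) \<in> J"
      using l by (simp add: mult.assoc[symmetric] power_add[symmetric] del: power_Suc)
    then show ?thesis using l by (auto intro: mult)
  qed
  then have "(\<Sum>i\<in>{..?n} - {Suc d}. coeff p i * (?s ^ j * coeff q (?n - i))) \<in> J"
    by (rule sum)
  moreover have "?s ^ j * coeff (p * q) ?n \<in> J" by (intro mult J) simp
  ultimately show ?case using eq diff by presburger
qed

text \<open>
  Local nilpotence lifts along the nilpotent ideal generated by \<open>s\<close>: since \<open>D\<close> commutes with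
  multiplication by \<open>s\<close>, each round of applications of \<open>D\<close> gains one more factor \<open>s\<close>.
\<close>

lemma (in local_ideal) locally_nilpotent_lift:
  assumes s: "s \<in> S" "s ^ N \<in> J" and nil: "\<And>x. \<exists>m k y. b ^ k * (D ^^ m) x - s * y \<in> J"
  shows "\<exists>m. (D ^^ m) x \<in> J"
proof -
  have "\<exists>m k y. b ^ k * (D ^^ m) x - s ^ i * y \<in> J" for i
  proof (induction i)
    case 0
    show ?case by (rule exI[of _ 0], rule exI[of _ 0], rule exI[of _ x]) (simp add: zero)
  next
    case (Suc i)
    then obtain m k y where 1: "b ^ k * (D ^^ m) x - s ^ i * y \<in> J" by blast
    obtain m' k' y' where 2: "b ^ k' * (D ^^ m') y - s * y' \<in> J" using nil by blast
    have "(D ^^ m') (b ^ k * (D ^^ m) x - s ^ i * y) \<in> J" using 1 by (rule D_iter_J)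
    then have 3: "b ^ k * (D ^^ (m' + m)) x - s ^ i * (D ^^ m') y \<in> J"
      using b_S s by (simp add: D_iter_diff D_iter_scale S_power funpow_add)
    have "b ^ (k' + k) * (D ^^ (m' + m)) x - s ^ Suc i * y' =
      b ^ k' * (b ^ k * (D ^^ (m' + m)) x - s ^ i * (D ^^ m') y)
      + s ^ i * (b ^ k' * (D ^^ m') y - s * y')"
      by (simp add: algebra_simps power_add)
    also have "\<dots> \<in> J" by (intro add mult 2 3)
    finally show ?case by blast
  qed
  then obtain m k y where 1: "b ^ k * (D ^^ m) x - s ^ N * y \<in> J" by blast
  have "s ^ N * y \<in> J" using s by (intro mult')
  then have "b ^ k * (D ^^ m) x \<in> J" using 1 mem_cong by blast
  then show ?thesis using saturated_power by blast
qed

text \<open>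
  If \<open>D g = p(g)\<close> is a unit with inverse \<open>q(g)\<close>, then \<open>D\<close> is locally nilpotent. For constant \<open>p\<close> already
  \<open>D (D g) = 0\<close>. Otherwise the leading coefficient \<open>s\<close> of \<open>p\<close> is nilpotent, and the degree of \<open>p\<close> drops
  modulo \<open>s\<close>; so the claim holds for the saturation \<open>J'\<close> of \<open>J + (s)\<close> and lifts to \<open>J\<close>. The element
  \<open>b\<^sup>m\<close> in place of \<open>1\<close> accounts for denominators.
\<close>

lemma locally_nilpotent_of_unit_derivative:
  assumes "local_ideal D S J b" "p \<in> polys_over S" "q \<in> polys_over S" "degree p \<le> d"
    "\<And>i. i > 0 \<Longrightarrow> coeff (p * q) i \<in> J" "coeff (p * q) 0 - b ^ m \<in> J"
    "D g - poly p g \<in> J"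
    "\<And>x. \<exists>k. \<exists>r\<in>polys_over S. b ^ k * x - poly r g \<in> J"
  shows "\<exists>m. (D ^^ m) x \<in> J"
  using assms
proof (induction d arbitrary: J p x)
  case 0
  interpret local_ideal D S J b by fact
  obtain c where c: "p = [:c:]" using 0(4) by (metis degree_eq_zeroE le_0_eq)
  have cS: "c \<in> S" using polys_overD[OF 0(2), of 0] c by simp
  have "D (D g - c) \<in> J" using 0 c D_J by simp
  then have D2: "(D ^^ 2) g \<in> J" using cS by (simp add: D_diff D_S numeral_2_eq_2)
  obtain k r where r: "r \<in> polys_over S" "b ^ k * x - poly r g \<in> J"
    using 0(8) by blast
  obtain n where n: "(D ^^ n) (poly r g) \<in> J" using nilpotent_poly[OF D2 r(1)] by blast
  have "(D ^^ n) (b ^ k * x - poly r g) \<in> J" using r(2) by (rule D_iter_J)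
  then have "b ^ k * (D ^^ n) x - (D ^^ n) (poly r g) \<in> J"
    using b_S by (simp add: D_iter_diff D_iter_scale S_power)
  then have "b ^ k * (D ^^ n) x \<in> J" using n mem_cong by blast
  then show ?case using saturated_power by blast
next
  case (Suc d)
  interpret local_ideal D S J b by fact
  define s where "s = coeff p (Suc d)"
  have sS: "s \<in> S" using polys_overD[OF Suc.prems(2)] s_def by simp
  have ideal: "ring_ideal J" by unfold_locales
  define e where "e = degree q"
  have sN: "s ^ Suc e \<in> J"
  proof (rule saturated_power)
    have "s ^ Suc e * coeff q 0 \<in> J"
      using leading_coeff_power_mem[OF ideal Suc.prems(4), of q e e] Suc.prems(5)
      by (simp add: s_def e_def)
    then have 1: "coeff p 0 * (s ^ Suc e * coeff q 0) \<in> J" by (rule mult)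
    have "b ^ m * s ^ Suc e = coeff p 0 * (s ^ Suc e * coeff q 0)
      - s ^ Suc e * (coeff (p * q) 0 - b ^ m)"
      by (simp add: algebra_simps coeff_mult)
    also have "\<dots> \<in> J" by (intro diff 1 mult Suc.prems)
    finally show "b ^ m * s ^ Suc e \<in> J" .
  qed
  define J' where "J' = {x. \<exists>k y. b ^ k * x - s * y \<in> J}"
  have JJ': "x \<in> J'" if "x \<in> J" for x
    unfolding J'_def using that by (auto intro!: exI[of _ 0])
  have sJ': "s * x \<in> J'" for x
    unfolding J'_def using zero by (auto intro!: exI[of _ 0] exI[of _ x])
  have J': "local_ideal D S J' b"
  proof unfold_locales
    show "0 \<in> J'" using JJ' zero by blast
    show "x + y \<in> J'" if xy: "x \<in> J'" "y \<in> J'" for x y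
    proof -
      from xy obtain k v l w where 1: "b ^ k * x - s * v \<in> J" "b ^ l * y - s * w \<in> J"
        unfolding J'_def by blast
      have "b ^ (k + l) * (x + y) - s * (b ^ l * v + b ^ k * w) =
        b ^ l * (b ^ k * x - s * v) + b ^ k * (b ^ l * y - s * w)"
        by (simp add: algebra_simps power_add)
      also have "\<dots> \<in> J" by (intro add mult 1)
      finally show ?thesis unfolding J'_def by blast
    qed
    show "r * x \<in> J'" if x: "x \<in> J'" for x r
    proof -
      from x obtain k v where 1: "b ^ k * x - s * v \<in> J" unfolding J'_def by blast
      have "b ^ k * (r * x) - s * (r * v) = r * (b ^ k * x - s * v)" by (simp add: algebra_simps)
      also have "\<dots> \<in> J" by (intro mult 1)
      finally show ?thesis unfolding J'_def by blast
    qed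
    show "D x \<in> J'" if x: "x \<in> J'" for x
    proof -
      from x obtain k v where 1: "b ^ k * x - s * v \<in> J" unfolding J'_def by blast
      have "D (b ^ k * x - s * v) \<in> J" using 1 by (rule D_J)
      then have "b ^ k * D x - s * D v \<in> J"
        using b_S sS by (simp add: D_diff D_scale S_power)
      then show ?thesis unfolding J'_def by blast
    qed
    show "\<exists>c\<in>S. of_nat n * c - 1 \<in> J'" if "0 < n" for n
      using inverse_nat[OF that] JJ' by blast
    show "b \<in> S" by (rule b_S)
    show "x \<in> J'" if x: "b * x \<in> J'" for x
    proof -
      from x obtain k v where 1: "b ^ k * (b * x) - s * v \<in> J" unfolding J'_def by blast
      then have "b ^ Suc k * x - s * v \<in> J" by (simp add: algebra_simps)
      then show ?thesis unfolding J'_def by blast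
    qed
  qed
  then interpret J': local_ideal D S J' b .
  define p' where "p' = p - monom s (Suc d)"
  have p'q: "coeff (p * q) i - coeff (p' * q) i \<in> J'" for i
  proof -
    have "monom s (Suc d) = smult s (monom 1 (Suc d))" by (simp add: smult_monom)
    then have "p * q - p' * q = smult s (monom 1 (Suc d) * q)"
      by (simp add: p'_def left_diff_distrib)
    then have "coeff (p * q) i - coeff (p' * q) i = s * coeff (monom 1 (Suc d) * q) i"
      by (metis coeff_diff coeff_smult)
    then show ?thesis using sJ' by simp
  qed
  have p'S: "p' \<in> polys_over S"
    unfolding p'_def by (intro polys_over_diff Suc.prems polys_over_monom sS)
  have degp': "degree p' \<le> d"
  proof (rule degree_le, intro allI impI)
    fix i assume "d < i"
    then show "coeff p' i = 0"
      using Suc.prems(4) by (cases "i = Suc d") (auto simp: p'_def s_def coeff_eq_0)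
  qed
  have c1: "coeff (p' * q) i \<in> J'" if "i > 0" for i
    using J'.diff[OF JJ'[OF Suc.prems(5)[OF that]] p'q[of i]] by simp
  have c2: "coeff (p' * q) 0 - b ^ m \<in> J'"
    using J'.diff[OF JJ'[OF Suc.prems(6)] p'q[of 0]] by (simp add: algebra_simps)
  have "s * g ^ Suc d + (D g - poly p g) \<in> J'"
    using J'.add[OF sJ' JJ'[OF Suc.prems(7)]] .
  then have c3: "D g - poly p' g \<in> J'"
    by (simp add: p'_def poly_monom algebra_simps)
  have c4: "\<exists>k. \<exists>r\<in>polys_over S. b ^ k * x - poly r g \<in> J'" for x
    using Suc.prems(8)[of x] JJ' by blast
  have "\<exists>n. (D ^^ n) x \<in> J'" for x
    by (rule Suc.IH[OF J' p'S Suc.prems(3) degp' c1 c2 c3 c4])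
  then have "\<exists>n k y. b ^ k * (D ^^ n) x - s * y \<in> J" for x
    unfolding J'_def by blast
  then show ?case by (rule locally_nilpotent_lift[OF sS sN])
qed

context local_generator
begin

lemma locally_nilpotent: "\<exists>m. (D ^^ m) x \<in> J"
proof -
  obtain k p where p: "p \<in> polys_over S" "b ^ k * D g - poly p g \<in> J"
    using generates by blast
  obtain l q where q: "q \<in> polys_over S" "b ^ l * u - poly q g \<in> J"
    using generates by blast
  have loc: "local_ideal D S J b" by unfold_locales
  define E where "E x = b ^ k * D x" for x
  have bk: "b ^ k \<in> S" using b_S by (rule S_power)
  \<comment> \<open>Scaling the derivation by a power of \<open>b\<close> clears the denominator of \<open>D g\<close>.\<close>
  have E: "local_ideal E S J b"
  proof unfold_locales
    show "E (x + y) = E x + E y" "E (x * y) = E x * y + x * E y" for x y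
      by (simp_all add: E_def D_add D_mult algebra_simps)
  qed (auto simp: E_def D_S intro: one_S S_add S_mult S_uminus mult D_J inverse_nat b_S saturated)
  have pq: "poly (p * q - [:b ^ (k + l + k0):]) g \<in> J"
  proof -
    have "poly (p * q - [:b ^ (k + l + k0):]) g =
      b ^ k * b ^ l * (u * D g - b ^ k0) - (b ^ k * D g - poly p g) * (b ^ l * u)
      - poly p g * (b ^ l * u - poly q g)"
      by (simp add: algebra_simps power_add)
    also have "\<dots> \<in> J" by (intro diff mult mult' unit p q)
    finally show ?thesis .
  qed
  have "p * q - [:b ^ (k + l + k0):] \<in> polys_over S"
    by (intro polys_over_diff polys_over_mult p q polys_over_const S_power b_S)
  note c = transcendental[OF unit this pq]
  have c1: "coeff (p * q) i \<in> J" if "i > 0" for i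
    using c[of i] that by (cases i) auto
  have c2: "coeff (p * q) 0 - b ^ (k + l + k0) \<in> J"
    using c[of 0] by simp
  have "E g - poly p g \<in> J" using p by (simp add: E_def)
  then obtain m where "(E ^^ m) x \<in> J"
    using locally_nilpotent_of_unit_derivative[OF E p(1) q(1) order.refl c1 c2] generates by blast
  moreover have "(E ^^ m) x = b ^ (k * m) * (D ^^ m) x"
    by (induction m) (auto simp: E_def D_scale S_power b_S power_add mult.assoc)
  ultimately show ?thesis using saturated_power by auto
qed

text \<open>
  The slice theorem for locally nilpotent derivations: by induction on the power of \<open>D\<close> that kills
  \<open>x\<close>, the element \<open>D x\<close> is a polynomial in \<open>h\<close>; a primitive of it differs from \<open>x\<close> by an
  element of the kernel, hence of \<open>S\<close>.
\<close>

lemma slice_generates: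
  assumes h: "D h - 1 \<in> J"
  shows "\<exists>k. \<exists>p\<in>polys_over S. b ^ k * x - poly p h \<in> J"
proof -
  have "(D ^^ m) x \<in> J \<Longrightarrow> \<exists>k. \<exists>p\<in>polys_over S. b ^ k * x - poly p h \<in> J" for m
  proof (induction m arbitrary: x)
    case 0
    then show ?case
      by (intro exI[of _ 0] bexI[of _ 0]) (auto simp: polys_over_def zero_S)
  next
    case (Suc m)
    then have "(D ^^ m) (D x) \<in> J" by (simp add: funpow_swap1)
    then obtain k p where p: "p \<in> polys_over S" "b ^ k * D x - poly p h \<in> J"
      using Suc.IH by blast
    obtain q where q: "q \<in> polys_over S" "D (poly q h) - poly p h * D h \<in> J"
      using exists_primitive[OF p(1)] by blast
    have "D (b ^ k * x - poly q h) = b ^ k * D x - D (poly q h)"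
      using b_S by (simp add: D_diff D_scale S_power)
    also have "\<dots> = (b ^ k * D x - poly p h)
        - (D (poly q h) - poly p h * D h) - poly p h * (D h - 1)"
      by (simp add: algebra_simps)
    also have "\<dots> \<in> J" by (intro diff mult h p q)
    finally obtain l s where s: "s \<in> S" "b ^ l * (b ^ k * x - poly q h) - s \<in> J"
      using kernel_D by blast
    have "b ^ (l + k) * x - poly (smult (b ^ l) q + [:s:]) h = b ^ l * (b ^ k * x - poly q h) - s"
      by (simp add: algebra_simps power_add)
    moreover have "smult (b ^ l) q + [:s:] \<in> polys_over S"
      by (intro polys_over_add polys_over_smult polys_over_const q s S_power b_S)
    ultimately show ?case using s by metis
  qed
  then show ?thesis using locally_nilpotent by blast
qed

end

section \<open>Descent from the residue ring and the localization\<close>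

text \<open>
  The hypotheses of the descent for \<open>A/I\<close>, where \<open>A\<close> is the ambient type. The assumptions \<open>residue\<close>
  and \<open>localized\<close> concern the residue ring of \<open>A/I\<close> modulo \<open>a\<close> and its localization at \<open>a\<close>. The last
  two say that the annihilator of \<open>a\<close> is generated by constants, as in a polynomial ring, and that
  \<open>S \<inter> aA = aS\<close>, both modulo \<open>I\<close>.
\<close>

locale residual_generators = derivation_with_constants D S
  for D :: "'r::comm_ring_1 \<Rightarrow> 'r" and S I a and g0 u0 k0 g1 u1 k1 +
  assumes I: "differential_ideal D S I" and a_S: "a \<in> S"
    and residue: "local_generator D S {x. \<exists>y. x - a * y \<in> I} 1 g0 u0 k0"
    and localized: "local_generator D S {x. \<exists>k. a ^ k * x \<in> I} a g1 u1 k1"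
    and torsion: "a * y \<in> I \<Longrightarrow>
      \<exists>N z w. (\<forall>i<N::nat. z i \<in> S \<and> a * z i \<in> I) \<and> y - (\<Sum>i<N. z i * w i) \<in> I"
    and constants_mod: "s \<in> S \<Longrightarrow> s - a * y \<in> I \<Longrightarrow> \<exists>t\<in>S. s - a * t \<in> I"
begin

sublocale I: differential_ideal D S I by (rule I)

text \<open>
  The descent principle. The assumption on division replaces the cancellation of \<open>a\<close>: it only
  determines \<open>x\<close> up to the annihilator of \<open>a\<close>, but constants \<open>z\<close> with \<open>a z = 0\<close> satisfy
  \<open>z A = z (W + a A) = z W\<close>.
\<close>

lemma submodule_contains_all:
  assumes W_I: "\<And>x. x \<in> I \<Longrightarrow> x \<in> W" and W_add: "\<And>x y. x \<in> W \<Longrightarrow> y \<in> W \<Longrightarrow> x + y \<in> W"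
    and W_scale: "\<And>s x. s \<in> S \<Longrightarrow> x \<in> W \<Longrightarrow> s * x \<in> W"
    and residue: "\<And>x. \<exists>w\<in>W. \<exists>y. x - (w + a * y) \<in> I"
    and localized: "\<And>x. \<exists>k. a ^ k * x \<in> W"
    and divide: "\<And>x. a * x \<in> W \<Longrightarrow> \<exists>w\<in>W. a * (x - w) \<in> I"
  shows "x \<in> W"
proof -
  have kill: "y \<in> W" if ay: "a * y \<in> I" for y
  proof -
    obtain N :: nat and z w where zw: "\<And>i. i < N \<Longrightarrow> z i \<in> S" "\<And>i. i < N \<Longrightarrow> a * z i \<in> I"
      "y - (\<Sum>i<N. z i * w i) \<in> I"
      using torsion[OF ay] by blast
    have "z i * w i \<in> W" if i: "i < N" for i
    proof -
      obtain v t where v: "v \<in> W" "w i - (v + a * t) \<in> I" using residue by blast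
      have "z i * w i = z i * v + (z i * (w i - (v + a * t)) + t * (a * z i))"
        by (simp add: algebra_simps)
      moreover have "z i * (w i - (v + a * t)) + t * (a * z i) \<in> I"
        by (rule I.add[OF I.mult[OF v(2)] I.mult[OF zw(2)[OF i]]])
      ultimately show ?thesis using zw i v W_I W_add W_scale by metis
    qed
    moreover have "0 \<in> W" using W_I I.zero by blast
    ultimately have "(\<Sum>i<m. z i * w i) \<in> W" if "m \<le> N" for m
      using that by (induction m) (auto intro: W_add)
    then have "(y - (\<Sum>i<N. z i * w i)) + (\<Sum>i<N. z i * w i) \<in> W"
      using W_I[OF zw(3)] W_add by blast
    then show ?thesis by simp
  qed
  have step: "x \<in> W" if ax: "a * x \<in> W" for x
  proof -
    obtain w where "w \<in> W" "a * (x - w) \<in> I" using divide[OF ax] by blast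
    then have "(x - w) + w \<in> W" using kill W_add by blast
    then show ?thesis by simp
  qed
  have "a ^ k * x \<in> W \<Longrightarrow> x \<in> W" for k
  proof (induction k)
    case (Suc k)
    then show ?case using step[of "a ^ k * x"] by (simp add: mult.assoc)
  qed simp
  then show ?thesis using localized by blast
qed

interpretation res: local_generator D S "{x. \<exists>y. x - a * y \<in> I}" 1 g0 u0 k0 by (rule residue)
interpretation loc: local_generator D S "{x. \<exists>k. a ^ k * x \<in> I}" a g1 u1 k1 by (rule localized)

text \<open>
  Descent for the image of \<open>D\<close>. If \<open>a x = D v\<close>, then \<open>v\<close> is a constant plus a multiple \<open>a y\<close>,
  because the kernel of \<open>D\<close> modulo \<open>a\<close> consists of constants; so \<open>a x = a D y\<close>.
\<close>

lemma D_surjective_mod: "\<exists>x. D x - y \<in> I"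
proof -
  define W where "W = {y. \<exists>x. D x - y \<in> I}"
  have "y \<in> W"
  proof (rule submodule_contains_all)
    show "x \<in> W" if "x \<in> I" for x
      unfolding W_def using that by (auto intro!: exI[of _ 0] I.uminus simp: D_zero)
    show "x + y \<in> W" if xy: "x \<in> W" "y \<in> W" for x y
    proof -
      from xy obtain v w where "D v - x \<in> I" "D w - y \<in> I" unfolding W_def by blast
      then have "D (v + w) - (x + y) \<in> I" by (simp add: D_add I.cong_add)
      then show ?thesis unfolding W_def by blast
    qed
    show "s * x \<in> W" if sx: "s \<in> S" "x \<in> W" for s x
    proof -
      from sx obtain v where "D v - x \<in> I" unfolding W_def by blast
      then have "D (s * v) - s * x \<in> I" using sx by (simp add: D_scale I.cong_mult)
      then show ?thesis unfolding W_def by blast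
    qed
    show "\<exists>w\<in>W. \<exists>y. x - (w + a * y) \<in> I" for x
    proof -
      obtain v y where "D v - x - a * y \<in> I" using res.D_surjective[of x] by auto
      then have "- (D v - x - a * y) \<in> I" by (rule I.uminus)
      then have "x - (D v + a * (- y)) \<in> I" by (simp add: algebra_simps)
      moreover have "D v \<in> W" unfolding W_def using I.zero by (auto intro!: exI[of _ v])
      ultimately show ?thesis by blast
    qed
    show "\<exists>k. a ^ k * x \<in> W" for x
    proof -
      obtain k l v where "a ^ l * (D v - a ^ k * x) \<in> I" using loc.D_surjective[of x] by auto
      then have "a ^ l * D v - a ^ (l + k) * x \<in> I"
        by (simp add: algebra_simps power_add)
      then have "D (a ^ l * v) - a ^ (l + k) * x \<in> I"
        using a_S by (simp add: D_scale S_power)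
      then show ?thesis unfolding W_def by blast
    qed
    show "\<exists>w\<in>W. a * (x - w) \<in> I" if ax: "a * x \<in> W" for x
    proof -
      from ax obtain v where v: "D v - a * x \<in> I" unfolding W_def by blast
      then obtain s y where sy: "s \<in> S" "v - s - a * y \<in> I" using res.kernel_D[of v] by auto
      have "D (v - s - a * y) \<in> I" using sy I.D_J by blast
      then have "D v - a * D y \<in> I" using sy a_S by (simp add: D_diff D_S D_scale)
      then have "a * (x - D y) \<in> I" using v I.diff by (fastforce simp: algebra_simps)
      moreover have "D y \<in> W" unfolding W_def using I.zero by (auto intro!: exI[of _ y])
      ultimately show ?thesis by blast
    qed
  qed
  then show ?thesis unfolding W_def by blast
qed

text \<open>
  Descent for \<open>S[h]\<close>, where \<open>D h = 1\<close>. If \<open>a x = p(h)\<close>, then all coefficients of \<open>p\<close> vanish modulo \<open>a\<close>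
  by transcendence of \<open>h\<close>, so they are \<open>a\<close> times elements of \<open>S\<close>.
\<close>

theorem exists_generating_slice:
  "\<exists>h. D h - 1 \<in> I \<and> (\<forall>x. \<exists>p\<in>polys_over S. x - poly p h \<in> I)"
proof -
  obtain h where h: "D h - 1 \<in> I" using D_surjective_mod by blast
  define W where "W = {x. \<exists>p\<in>polys_over S. x - poly p h \<in> I}"
  have "x \<in> W" for x
  proof (rule submodule_contains_all)
    show "x \<in> W" if "x \<in> I" for x
      unfolding W_def mem_Collect_eq
      using that by (intro bexI[of _ 0]) (simp_all add: polys_over_def zero_S)
    show "x + y \<in> W" if xy: "x \<in> W" "y \<in> W" for x y
    proof -
      from xy obtain p q where "p \<in> polys_over S" "q \<in> polys_over S"
        "x - poly p h \<in> I" "y - poly q h \<in> I" unfolding W_def by blast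
      then have "p + q \<in> polys_over S" "(x + y) - poly (p + q) h \<in> I"
        by (simp_all add: polys_over_add I.cong_add)
      then show ?thesis unfolding W_def by blast
    qed
    show "s * x \<in> W" if sx: "s \<in> S" "x \<in> W" for s x
    proof -
      from sx obtain p where "p \<in> polys_over S" "x - poly p h \<in> I" unfolding W_def by blast
      then have "smult s p \<in> polys_over S" "s * x - poly (smult s p) h \<in> I"
        using sx by (simp_all add: polys_over_smult I.cong_mult)
      then show ?thesis unfolding W_def by blast
    qed
    have polyW: "poly p h \<in> W" if "p \<in> polys_over S" for p
      unfolding W_def using that I.zero by (auto intro!: bexI[of _ p])
    have h0: "\<exists>y. D h - 1 - a * y \<in> I" using h by (intro exI[of _ 0]) simp
    show "\<exists>w\<in>W. \<exists>y. x - (w + a * y) \<in> I" for x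
      using res.slice_generates[of h x] h0 polyW by (auto simp: diff_diff_eq)
    show "\<exists>k. a ^ k * x \<in> W" for x
    proof -
      have "\<exists>k. a ^ k * (D h - 1) \<in> I" using h by (intro exI[of _ 0]) simp
      then obtain k l p where p: "p \<in> polys_over S" "a ^ l * (a ^ k * x - poly p h) \<in> I"
        using loc.slice_generates[of h x] by auto
      then have "a ^ (l + k) * x - poly (smult (a ^ l) p) h \<in> I"
        by (simp add: algebra_simps power_add)
      moreover have "smult (a ^ l) p \<in> polys_over S"
        using p a_S by (simp add: polys_over_smult S_power)
      ultimately show ?thesis unfolding W_def by blast
    qed
    show "\<exists>w\<in>W. a * (x - w) \<in> I" if ax: "a * x \<in> W" for x
    proof -
      from ax obtain p where p: "p \<in> polys_over S" "a * x - poly p h \<in> I"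
        unfolding W_def by blast
      have "poly p h - a * x \<in> I" using p I.sym by blast
      then have "\<exists>y. poly p h - a * y \<in> I" by blast
      moreover have "1 * D h - 1 ^ 0 \<in> {x. \<exists>y. x - a * y \<in> I}" using h0 by simp
      ultimately have "\<exists>y. coeff p i - a * y \<in> I" for i
        using res.transcendental[of 1 h 0 p i] p by simp
      then have "\<exists>t\<in>S. coeff p i - a * t \<in> I" for i
        using constants_mod polys_overD[OF p(1)] by blast
      then obtain t where t: "\<And>i. t i \<in> S" "\<And>i. coeff p i - a * t i \<in> I" by metis
      define q where "q = (\<Sum>i\<le>degree p. monom (t i) i)"
      have cq: "coeff q i = (if i \<le> degree p then t i else 0)" for i
        by (simp add: q_def coeff_sum if_distrib cong: if_cong)
      have q: "q \<in> polys_over S" using t zero_S by (intro polys_overI) (simp add: cq)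
      have "poly (p - smult a q) h \<in> I"
        using t I.zero by (intro I.poly_mem) (simp add: cq coeff_eq_0)
      then have "a * (x - poly q h) \<in> I"
        using I.add[OF p(2)] by (fastforce simp: algebra_simps)
      then show ?thesis using polyW[OF q] by blast
    qed
  qed
  then show ?thesis using h unfolding W_def by blast
qed

end

section \<open>Polynomials in several variables\<close>

type_synonym 'f multipoly = "nat multiset \<Rightarrow>\<^sub>0 'f"

abbreviation monomial :: "nat multiset \<Rightarrow> 'f \<Rightarrow> 'f::comm_ring_1 multipoly"
  where "monomial \<equiv> Poly_Mapping.single"

abbreviation mcoeff :: "'f::comm_ring_1 multipoly \<Rightarrow> nat multiset \<Rightarrow> 'f"
  where "mcoeff \<equiv> Poly_Mapping.lookup"

abbreviation support :: "'f::comm_ring_1 multipoly \<Rightarrow> nat multiset set"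
  where "support \<equiv> Poly_Mapping.keys"

abbreviation const :: "'f \<Rightarrow> 'f::comm_ring_1 multipoly"
  where "const \<equiv> monomial {#}"

abbreviation var :: "nat \<Rightarrow> 'f::comm_ring_1 multipoly"
  where "var i \<equiv> monomial {#i#} 1"

lemma multipoly_expand:
  fixes p :: "'f::comm_ring_1 multipoly"
  assumes "finite A" "support p \<subseteq> A"
  shows "p = (\<Sum>m\<in>A. monomial m (mcoeff p m))"
proof (rule poly_mapping_eqI)
  fix k
  show "mcoeff p k = mcoeff (\<Sum>m\<in>A. monomial m (mcoeff p m)) k"
    using assms by (auto simp: lookup_sum lookup_single when_def in_keys_iff)
qed

lemma multipoly_induct [case_names monomial add]:
  fixes p :: "'f::comm_ring_1 multipoly"
  assumes single: "\<And>m c. P (monomial m c)" and add: "\<And>p q. P p \<Longrightarrow> P q \<Longrightarrow> P (p + q)"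
  shows "P p"
proof -
  have "P (\<Sum>m\<in>A. monomial m (mcoeff p m))" if "finite A" for A
    using that
  proof (induction A rule: finite_induct)
    case empty
    then show ?case using single[of 0 0] by simp
  qed (auto intro: single add)
  from this[OF finite_keys, of p] show ?thesis
    by (simp only: multipoly_expand[OF finite_keys order.refl, symmetric])
qed

lemma monomial_mult: "monomial m c * monomial k d = monomial (m + k) (c * d)"
  by (rule mult_single)

lemma const_mult: "const c * const d = const (c * d)"
  by (simp add: monomial_mult)

lemma const_mult_monomial: "const c * monomial k d = monomial k (c * d)"
  by (simp add: monomial_mult)

lemma lookup_const_mult: "mcoeff (const c * p) m = c * mcoeff p m"
  by (induction p rule: multipoly_induct)
    (auto simp: const_mult_monomial lookup_single when_def lookup_add distrib_left)

lemma of_nat_eq_const: "of_nat k = const (of_nat k)"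
  by (induction k) (simp_all add: single_add)

lemma const_of_nat_mult: "const (of_nat k * c) * p = const c * (of_nat k * p)"
  unfolding of_nat_eq_const const_mult[symmetric] by (simp only: mult_ac)

lemma const_of_nat_mult': "const (of_nat k * c) = of_nat k * const c"
  unfolding of_nat_eq_const const_mult[symmetric] ..

text \<open>
  The coefficient of \<open>m\<close> in the derivative comes from the monomial \<open>m + {j}\<close> alone. In this form
  the derivative visibly preserves coefficientwise conditions.
\<close>

lift_definition partial_derivative :: "nat \<Rightarrow> 'f::comm_ring_1 multipoly \<Rightarrow> 'f multipoly"
  is "\<lambda>j p m. of_nat (Suc (count m j)) * p (add_mset j m)"
proof -
  fix j :: nat and p :: "nat multiset \<Rightarrow> 'f"
  assume "finite {m. p m \<noteq> 0}"
  then have "finite (add_mset j -` {m. p m \<noteq> 0})"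
    by (rule finite_vimageI) (auto intro: injI)
  then show "finite {m. of_nat (Suc (count m j)) * p (add_mset j m) \<noteq> 0}"
    by (rule rev_finite_subset) auto
qed

lemma lookup_partial_derivative:
  "mcoeff (partial_derivative j p) m = of_nat (Suc (count m j)) * mcoeff p (add_mset j m)"
  by (simp add: partial_derivative.rep_eq)

lemma partial_derivative_add:
  "partial_derivative j (p + q) = partial_derivative j p + partial_derivative j q"
  by (rule poly_mapping_eqI) (simp add: lookup_partial_derivative lookup_add algebra_simps)

lemma partial_derivative_monomial:
  "partial_derivative j (monomial m c) = monomial (m - {#j#}) (of_nat (count m j) * c)"
proof (rule poly_mapping_eqI)
  fix k
  show "mcoeff (partial_derivative j (monomial m c)) k
      = mcoeff (monomial (m - {#j#}) (of_nat (count m j) * c)) k"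
  proof (cases "j \<in># m")
    case True
    then obtain m' where "m = add_mset j m'" by (meson multi_member_split)
    then show ?thesis
      by (auto simp: lookup_partial_derivative lookup_single when_def simp del: of_nat_Suc)
  next
    case False
    then have "m \<noteq> add_mset j k" by auto
    then show ?thesis using False
      by (auto simp: lookup_partial_derivative lookup_single when_def count_eq_zero_iff[THEN iffD2])
  qed
qed

lemma partial_derivative_mult:
  "partial_derivative j (p * q) = partial_derivative j p * q + p * partial_derivative j q"
proof (induction p rule: multipoly_induct)
  case (monomial m c)
  show ?case
  proof (induction q rule: multipoly_induct)
    case (monomial k d)
    have 1: "monomial (m + k - {#j#}) (of_nat (count m j) * (c * d))
        = monomial (m - {#j#} + k) (of_nat (count m j) * c * d)"
      by (cases "j \<in># m") (simp_all add: mult.assoc count_eq_zero_iff[THEN iffD2])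
    have 2: "monomial (m + k - {#j#}) (of_nat (count k j) * (c * d))
        = monomial (m + (k - {#j#})) (c * (of_nat (count k j) * d))"
      by (cases "j \<in># k") (simp_all add: mult.left_commute count_eq_zero_iff[THEN iffD2])
    have "partial_derivative j (monomial m c * monomial k d) =
        monomial (m + k - {#j#}) (of_nat (count m j) * (c * d))
        + monomial (m + k - {#j#}) (of_nat (count k j) * (c * d))"
      by (simp add: monomial_mult partial_derivative_monomial distrib_right single_add)
    then show ?case unfolding 1 2 by (simp add: monomial_mult partial_derivative_monomial)
  next
    case (add p q)
    then show ?case by (simp add: partial_derivative_add algebra_simps)
  qed
next
  case (add p q)
  then show ?case by (simp add: partial_derivative_add algebra_simps)
qed

lemma partial_derivative_const: "partial_derivative j (const c) = 0"
  by (simp add: partial_derivative_monomial)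

lemma partial_derivative_one: "partial_derivative j 1 = 0"
  using partial_derivative_const[of j 1] by simp

lemma partial_derivative_var: "partial_derivative j (var i) = (if i = j then 1 else 0)"
  by (simp add: partial_derivative_monomial)

lemma partial_derivative_zero: "partial_derivative j 0 = 0"
  using partial_derivative_const[of j 0] by simp

lemma partial_derivative_uminus: "partial_derivative j (- p) = - partial_derivative j p"
  using partial_derivative_add[of j p "- p"]
  by (simp add: partial_derivative_zero eq_neg_iff_add_eq_0 add.commute)

lemma partial_derivative_diff:
  "partial_derivative j (p - q) = partial_derivative j p - partial_derivative j q"
  using partial_derivative_add[of j p "- q"] by (simp add: partial_derivative_uminus)

definition substitute :: "(nat \<Rightarrow> 'f::comm_ring_1 multipoly) \<Rightarrow> 'f multipoly \<Rightarrow> 'f multipoly"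
  where "substitute f p = (\<Sum>m\<in>support p. const (mcoeff p m) * (\<Prod>i\<in>#m. f i))"

lemma substitute_expand:
  assumes "finite A" "support p \<subseteq> A"
  shows "substitute f p = (\<Sum>m\<in>A. const (mcoeff p m) * (\<Prod>i\<in>#m. f i))"
  unfolding substitute_def using assms
  by (intro sum.mono_neutral_left) (auto simp: in_keys_iff)

lemma substitute_add: "substitute f (p + q) = substitute f p + substitute f q"
proof -
  let ?A = "support p \<union> support q"
  have "substitute f (p + q) = (\<Sum>m\<in>?A. const (mcoeff (p + q) m) * (\<Prod>i\<in>#m. f i))"
    by (rule substitute_expand) (simp_all add: Poly_Mapping.keys_add)
  also have "\<dots> = (\<Sum>m\<in>?A. const (mcoeff p m) * (\<Prod>i\<in>#m. f i))
      + (\<Sum>m\<in>?A. const (mcoeff q m) * (\<Prod>i\<in>#m. f i))"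
    by (simp add: lookup_add single_add algebra_simps sum.distrib)
  also have "\<dots> = substitute f p + substitute f q"
    by (subst (1 2) substitute_expand[of ?A]) auto
  finally show ?thesis .
qed

lemma substitute_monomial: "substitute f (monomial m c) = const c * (\<Prod>i\<in>#m. f i)"
  by (subst substitute_expand[of "{m}"]) auto

lemma substitute_mult: "substitute f (p * q) = substitute f p * substitute f q"
proof (induction p rule: multipoly_induct)
  case (monomial m c)
  show ?case
  proof (induction q rule: multipoly_induct)
    case (monomial k d)
    have "substitute f (monomial m c * monomial k d) = substitute f (monomial (m + k) (c * d))"
      by (simp only: monomial_mult)
    also have "\<dots> = (const c * const d) * ((\<Prod>i\<in>#m. f i) * (\<Prod>i\<in>#k. f i))"
      by (simp only: substitute_monomial const_mult image_mset_union prod_mset_Un)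
    also have "\<dots> = substitute f (monomial m c) * substitute f (monomial k d)"
      by (simp only: substitute_monomial mult_ac)
    finally show ?case .
  qed (simp add: substitute_add algebra_simps)
qed (simp add: substitute_add algebra_simps)

lemma substitute_uminus: "substitute f (- p) = - substitute f p"
  using substitute_add[of f p "- p"] substitute_monomial[of f 0 0]
  by (simp add: eq_neg_iff_add_eq_0 add.commute)

definition vars_below :: "nat \<Rightarrow> 'f::comm_ring_1 multipoly set"
  where "vars_below N = {p. \<forall>m\<in>support p. set_mset m \<subseteq> {..<N}}"

definition subalgebra :: "nat \<Rightarrow> (nat \<Rightarrow> 'f::comm_ring_1 multipoly) \<Rightarrow> 'f multipoly set"
  where "subalgebra N f = substitute f ` vars_below N"

lemma vars_below_monomial: "set_mset m \<subseteq> {..<N} \<Longrightarrow> monomial m c \<in> vars_below N"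
  by (auto simp: vars_below_def)

lemma vars_below_add: "p \<in> vars_below N \<Longrightarrow> q \<in> vars_below N \<Longrightarrow> p + q \<in> vars_below N"
  unfolding vars_below_def using Poly_Mapping.keys_add[of p q] by blast

lemma vars_below_uminus: "p \<in> vars_below N \<Longrightarrow> - p \<in> vars_below N"
  by (simp add: vars_below_def)

lemma vars_below_mult: "p \<in> vars_below N \<Longrightarrow> q \<in> vars_below N \<Longrightarrow> p * q \<in> vars_below N"
  unfolding vars_below_def mem_Collect_eq
proof
  fix m
  assume pq: "\<forall>m\<in>support p. set_mset m \<subseteq> {..<N}" "\<forall>m\<in>support q. set_mset m \<subseteq> {..<N}"
  assume "m \<in> support (p * q)"
  then obtain k l where "k \<in> support p" "l \<in> support q" "m = k + l"
    using Poly_Mapping.keys_mult[of p q] by blast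
  then show "set_mset m \<subseteq> {..<N}" using pq by simp
qed

lemma const_subalgebra: "const c \<in> subalgebra N f"
  unfolding subalgebra_def
  by (rule image_eqI[of _ _ "const c"]) (simp_all add: substitute_monomial vars_below_monomial)

lemma generator_subalgebra: "i < N \<Longrightarrow> f i \<in> subalgebra N f"
  unfolding subalgebra_def
  by (rule image_eqI[of _ _ "var i"]) (simp_all add: substitute_monomial vars_below_monomial)

lemma subalgebra_add: "x \<in> subalgebra N f \<Longrightarrow> y \<in> subalgebra N f \<Longrightarrow> x + y \<in> subalgebra N f"
  by (auto simp: subalgebra_def simp flip: substitute_add intro!: imageI vars_below_add)

lemma subalgebra_mult: "x \<in> subalgebra N f \<Longrightarrow> y \<in> subalgebra N f \<Longrightarrow> x * y \<in> subalgebra N f"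
  by (auto simp: subalgebra_def simp flip: substitute_mult intro!: imageI vars_below_mult)

lemma subalgebra_uminus: "x \<in> subalgebra N f \<Longrightarrow> - x \<in> subalgebra N f"
  by (auto simp: subalgebra_def simp flip: substitute_uminus intro!: imageI vars_below_uminus)

lemma subalgebra_induct [consumes 1, case_names const generator add mult]:
  assumes "x \<in> subalgebra N f"
    and const: "\<And>c. P (const c)" and gen: "\<And>i. i < N \<Longrightarrow> P (f i)"
    and add: "\<And>x y. P x \<Longrightarrow> P y \<Longrightarrow> P (x + y)" and mult: "\<And>x y. P x \<Longrightarrow> P y \<Longrightarrow> P (x * y)"
  shows "P x"
proof -
  obtain p where p: "p \<in> vars_below N" "x = substitute f p"
    using assms(1) by (auto simp: subalgebra_def)
  have prod: "set_mset m \<subseteq> {..<N} \<Longrightarrow> P (\<Prod>i\<in>#m. f i)" for m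
    using const[of 1] by (induction m) (auto intro: gen mult)
  have "P (\<Sum>m\<in>A. const (mcoeff p m) * (\<Prod>i\<in>#m. f i))" if "A \<subseteq> support p" for A
    using finite_subset[OF that finite_keys] that
  proof (induction A rule: finite_induct)
    case empty
    then show ?case using const[of 0] by simp
  next
    case (insert m A)
    then have "set_mset m \<subseteq> {..<N}" using p by (auto simp: vars_below_def)
    then show ?case using insert by (auto intro!: add mult const prod)
  qed
  then show ?thesis using p by (simp add: substitute_def)
qed

section \<open>The Jacobian derivation\<close>

text \<open>The determinant is a polynomial in the entries.\<close>

lemma det_cong_mod:
  assumes "ring_ideal J" and A: "A \<in> carrier_mat n n" and B: "B \<in> carrier_mat n n"
    and J: "\<And>i j. i < n \<Longrightarrow> j < n \<Longrightarrow> A $$ (i, j) - B $$ (i, j) \<in> J"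
  shows "det A - det B \<in> J"
proof -
  interpret ring_ideal J by fact
  have prod: "(\<And>i. i \<in> Y \<Longrightarrow> g i - h i \<in> J) \<Longrightarrow> prod g Y - prod h Y \<in> J"
    for Y :: "nat set" and g h
  proof (induction Y rule: infinite_finite_induct)
    case (insert i Y)
    then have "g i * (prod g Y - prod h Y) + prod h Y * (g i - h i) \<in> J"
      by (intro add mult) auto
    then show ?case using insert by (simp add: algebra_simps)
  qed (simp_all add: zero)
  have "det A - det B = (\<Sum>p | p permutes {0..<n}.
      signof p * ((\<Prod>i = 0..<n. A $$ (i, p i)) - (\<Prod>i = 0..<n. B $$ (i, p i))))"
    by (simp add: det_def'[OF A] det_def'[OF B] sum_subtractf[symmetric] right_diff_distrib)
  also have "\<dots> \<in> J"
  proof (intro sum mult prod J)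
    fix p i assume "p \<in> {p. p permutes {0..<n}}" "i \<in> {0..<n}"
    then show "i < n" "p i < n" using permutes_in_image by fastforce+
  qed
  finally show ?thesis .
qed

text \<open>The rows are the gradients of \<open>f 0, \<dots>, f (n - 2)\<close> and, last, that of \<open>x\<close>.\<close>

definition jacobian_matrix ::
    "nat \<Rightarrow> (nat \<Rightarrow> 'f::comm_ring_1 multipoly) \<Rightarrow> 'f multipoly \<Rightarrow> 'f multipoly mat"
  where "jacobian_matrix n f x =
    mat n n (\<lambda>(i, j). partial_derivative j (if i < n - 1 then f i else x))"

definition jacobian ::
    "nat \<Rightarrow> (nat \<Rightarrow> 'f::comm_ring_1 multipoly) \<Rightarrow> 'f multipoly \<Rightarrow> 'f multipoly"
  where "jacobian n f x = det (jacobian_matrix n f x)"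

lemma jacobian_matrix_carrier: "jacobian_matrix n f x \<in> carrier_mat n n"
  by (simp add: jacobian_matrix_def)

context
  fixes n :: nat and f :: "nat \<Rightarrow> 'f::comm_ring_1 multipoly"
  assumes n: "1 \<le> n"
begin

text \<open>
  The cofactors along the last row do not involve \<open>x\<close>, so the determinant is a linear combination
  of partial derivatives of \<open>x\<close> and therefore a derivation.
\<close>

lemma jacobian_expand:
  "jacobian n f x =
    (\<Sum>j<n. partial_derivative j x * cofactor (jacobian_matrix n f 0) (n - 1) j)"
proof -
  have "mat_delete (jacobian_matrix n f x) (n - 1) j = mat_delete (jacobian_matrix n f 0) (n - 1) j" for j
    by (rule eq_matI) (auto simp: mat_delete_def jacobian_matrix_def)
  then show ?thesis
    unfolding jacobian_def
    using n by (subst laplace_expansion_row[OF jacobian_matrix_carrier, of "n - 1"])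
      (auto simp: cofactor_def jacobian_matrix_def intro!: sum.cong)
qed

lemma jacobian_add: "jacobian n f (x + y) = jacobian n f x + jacobian n f y"
  by (simp add: jacobian_expand partial_derivative_add algebra_simps sum.distrib)

lemma jacobian_mult: "jacobian n f (x * y) = jacobian n f x * y + x * jacobian n f y"
  by (simp add: jacobian_expand partial_derivative_mult sum_distrib_left sum_distrib_right
      algebra_simps sum.distrib)

lemma jacobian_const: "jacobian n f (const c) = 0"
  by (simp add: jacobian_expand partial_derivative_const)

lemma jacobian_generator: "i < n - 1 \<Longrightarrow> jacobian n f (f i) = 0"
  unfolding jacobian_def
  by (rule det_identical_rows[OF jacobian_matrix_carrier, of i "n - 1"])
    (auto simp: jacobian_matrix_def)

lemma jacobian_mem:
  assumes "ring_ideal J" "\<And>j. j < n \<Longrightarrow> partial_derivative j x \<in> J"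
  shows "jacobian n f x \<in> J"
proof -
  interpret ring_ideal J by fact
  show ?thesis unfolding jacobian_expand by (intro sum mult' assms) auto
qed

lemma derivation_jacobian: "derivation_with_constants (jacobian n f) (subalgebra (n - 1) f)"
proof unfold_locales
  show "1 \<in> subalgebra (n - 1) f" using const_subalgebra[of 1] by simp
  show "jacobian n f s = 0" if "s \<in> subalgebra (n - 1) f" for s
    using that
    by (induction rule: subalgebra_induct)
      (simp_all add: jacobian_const jacobian_generator jacobian_add jacobian_mult)
qed (auto intro: jacobian_add jacobian_mult subalgebra_add subalgebra_mult subalgebra_uminus)

text \<open>
  The chain rule in the form in which it is used: the gradient of an element of \<open>S[g]\<close> is a
  combination of the gradients of the \<open>f i\<close> and of \<open>g\<close>.
\<close>

lemma gradient_in_span: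
  assumes p: "p \<in> polys_over (subalgebra (n - 1) f)"
  shows "\<exists>c. \<forall>l. partial_derivative l (poly p g) =
    (\<Sum>i<n. c i * partial_derivative l (if i < n - 1 then f i else g))"
proof -
  define G where "G i = (if i < n - 1 then f i else g)" for i
  define Z where "Z = {y. \<exists>c. \<forall>l. partial_derivative l y =
    (\<Sum>i<n. c i * partial_derivative l (G i))}"
  have Z_add: "x + y \<in> Z" if xy: "x \<in> Z" "y \<in> Z" for x y
  proof -
    from xy obtain c d where "\<And>l. partial_derivative l x = (\<Sum>i<n. c i * partial_derivative l (G i))"
      "\<And>l. partial_derivative l y = (\<Sum>i<n. d i * partial_derivative l (G i))"
      unfolding Z_def by blast
    then have "\<forall>l. partial_derivative l (x + y) = (\<Sum>i<n. (c i + d i) * partial_derivative l (G i))"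
      by (simp add: partial_derivative_add distrib_right sum.distrib)
    then show ?thesis unfolding Z_def mem_Collect_eq by (rule exI[of _ "\<lambda>i. c i + d i"])
  qed
  have Z_mult: "x * y \<in> Z" if xy: "x \<in> Z" "y \<in> Z" for x y
  proof -
    from xy obtain c d where "\<And>l. partial_derivative l x = (\<Sum>i<n. c i * partial_derivative l (G i))"
      "\<And>l. partial_derivative l y = (\<Sum>i<n. d i * partial_derivative l (G i))"
      unfolding Z_def by blast
    then have "\<forall>l. partial_derivative l (x * y) =
        (\<Sum>i<n. (y * c i + x * d i) * partial_derivative l (G i))"
      by (simp add: partial_derivative_mult sum.distrib sum_distrib_left algebra_simps)
    then show ?thesis unfolding Z_def mem_Collect_eq
      by (rule exI[of _ "\<lambda>i. y * c i + x * d i"])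
  qed
  have Z_const: "const c \<in> Z" for c
    unfolding Z_def by (auto simp: partial_derivative_const intro!: exI[of _ "\<lambda>_. 0"])
  have Z_G: "G i \<in> Z" if "i < n" for i
  proof -
    have "\<forall>l. partial_derivative l (G i) =
        (\<Sum>k<n. (if k = i then 1 else 0) * partial_derivative l (G k))"
      using that by (simp add: if_distrib[of "\<lambda>x. x * _"] cong: if_cong)
    then show ?thesis unfolding Z_def mem_Collect_eq
      by (rule exI[of _ "\<lambda>k. if k = i then 1 else 0"])
  qed
  have "s \<in> Z" if "s \<in> subalgebra (n - 1) f" for s
    using that
  proof (induction rule: subalgebra_induct)
    case (generator i)
    then show ?case using Z_G[of i] by (simp add: G_def)
  qed (auto intro: Z_const Z_add Z_mult)
  moreover have "g \<in> Z" using Z_G[of "n - 1"] n by (simp add: G_def)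
  ultimately have "poly p g \<in> Z" using p
  proof (induction p)
    case 0
    then show ?case using Z_const[of 0] by simp
  next
    case (pCons s p)
    have c: "coeff (pCons s p) i \<in> subalgebra (n - 1) f" for i
      using pCons.prems(3) by (simp add: polys_over_def)
    have "s \<in> Z" using pCons.prems(1) c[of 0] by simp
    moreover have "p \<in> polys_over (subalgebra (n - 1) f)"
      using c[of "Suc _"] by (simp add: polys_over_def)
    then have "poly p g \<in> Z" using pCons.prems(1,2) by (rule pCons.IH[rotated 2])
    ultimately show ?case using pCons.prems(2) by (simp add: Z_add Z_mult)
  qed
  then show ?thesis unfolding Z_def G_def by blast
qed

text \<open>
  If the variables are polynomials in the \<open>f i\<close> and \<open>g\<close>, then their gradients, the rows of the
  identity matrix, are combinations of the rows of the Jacobian matrix. So this matrix has a left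
  inverse \<open>C\<close> and its determinant is a unit.
\<close>

lemma jacobian_unit:
  assumes J: "ring_ideal J" "\<And>l x. l < n \<Longrightarrow> x \<in> J \<Longrightarrow> partial_derivative l x \<in> J"
    and b: "\<And>l. l < n \<Longrightarrow> partial_derivative l b = 0"
    and gen: "\<And>x. \<exists>k. \<exists>p\<in>polys_over (subalgebra (n - 1) f). b ^ k * x - poly p g \<in> J"
  shows "\<exists>u m. u * jacobian n f g - b ^ m \<in> J"
proof -
  interpret ring_ideal J by fact
  let ?G = "\<lambda>i. if i < n - 1 then f i else g"
  define P where "P j k c \<longleftrightarrow> (\<forall>l<n. (\<Sum>i<n. c i * partial_derivative l (?G i))
      - b ^ k * (if j = l then 1 else 0) \<in> J)" for j k c
  have "\<exists>k c. P j k c" for j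
  proof -
    obtain k p where p: "p \<in> polys_over (subalgebra (n - 1) f)" "b ^ k * var j - poly p g \<in> J"
      using gen by blast
    obtain c where c: "\<And>l. partial_derivative l (poly p g) = (\<Sum>i<n. c i * partial_derivative l (?G i))"
      using gradient_in_span[OF p(1)] by blast
    have "(\<Sum>i<n. c i * partial_derivative l (?G i)) - b ^ k * (if j = l then 1 else 0) \<in> J"
      if l: "l < n" for l
    proof -
      have bk: "partial_derivative l (b ^ k) = 0"
        by (induction k) (simp_all add: partial_derivative_mult b[OF l] partial_derivative_one)
      have "partial_derivative l (b ^ k * var j - poly p g) \<in> J" using p J l by blast
      then have "b ^ k * (if j = l then 1 else 0) - (\<Sum>i<n. c i * partial_derivative l (?G i)) \<in> J"
        by (simp only: partial_derivative_diff partial_derivative_mult bk c partial_derivative_var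
            mult_zero_left add_0)
      then show ?thesis by (rule sym)
    qed
    then have "P j k c" unfolding P_def by blast
    then show ?thesis by blast
  qed
  then obtain k c where "\<And>j. P j (k j) (c j)" by metis
  then have kc: "\<And>j l. l < n \<Longrightarrow> (\<Sum>i<n. c j i * partial_derivative l (?G i))
      - b ^ k j * (if j = l then 1 else 0) \<in> J"
    unfolding P_def by blast
  \<comment> \<open>A common power of \<open>b\<close> clears the denominators of all rows.\<close>
  define K where "K = sum k {..<n}"
  define C where "C = mat n n (\<lambda>(j, i). b ^ (K - k j) * c j i)"
  have C: "C \<in> carrier_mat n n" by (simp add: C_def)
  note M = jacobian_matrix_carrier[of n f g]
  have "det (C * jacobian_matrix n f g) - det (b ^ K \<cdot>\<^sub>m 1\<^sub>m n) \<in> J"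
  proof (rule det_cong_mod[OF J(1)])
    show "C * jacobian_matrix n f g \<in> carrier_mat n n" using C M by simp
    show "b ^ K \<cdot>\<^sub>m 1\<^sub>m n \<in> carrier_mat n n" by simp
    fix j l assume jl: "j < n" "l < n"
    have kK: "k j \<le> K" unfolding K_def using jl by (intro member_le_sum) auto
    have "(C * jacobian_matrix n f g) $$ (j, l) =
        (\<Sum>i<n. b ^ (K - k j) * c j i * partial_derivative l (?G i))"
      using jl C M by (simp add: scalar_prod_def C_def jacobian_matrix_def atLeast0LessThan)
    then have "(C * jacobian_matrix n f g) $$ (j, l) - (b ^ K \<cdot>\<^sub>m 1\<^sub>m n) $$ (j, l) =
        b ^ (K - k j) * ((\<Sum>i<n. c j i * partial_derivative l (?G i))
          - b ^ k j * (if j = l then 1 else 0))"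
      using jl kK by (auto simp: sum_distrib_left algebra_simps simp flip: power_add)
    then show "(C * jacobian_matrix n f g) $$ (j, l) - (b ^ K \<cdot>\<^sub>m 1\<^sub>m n) $$ (j, l) \<in> J"
      using mult kc jl by simp
  qed
  then have "det C * jacobian n f g - b ^ (K * n) \<in> J"
    by (simp add: det_mult[OF C M] jacobian_def power_mult)
  then show ?thesis by blast
qed

text \<open>
  The column \<open>i\<close> of the inverse of the Jacobian matrix, the adjugate times the inverse \<open>u\<close> of the
  determinant, holds the coefficients of a derivation \<open>E\<close> with \<open>E (f k) = \<delta>\<^bsub>ik\<^esub>\<close>.
\<close>

lemma dual_derivations:
  assumes J: "ring_ideal J" "\<And>l x. l < n \<Longrightarrow> x \<in> J \<Longrightarrow> partial_derivative l x \<in> J"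
    and u: "u * jacobian n f g - 1 \<in> J" and i: "i < n - 1"
  shows "\<exists>E. (\<forall>x y. E (x + y) = E x + E y) \<and> (\<forall>x y. E (x * y) = E x * y + x * E y) \<and>
    (\<forall>c. E (const c) = 0) \<and> (\<forall>x\<in>J. E x \<in> J) \<and>
    (\<forall>k<n - 1. E (f k) - (if k = i then 1 else 0) \<in> J)"
proof -
  interpret ring_ideal J by fact
  let ?M = "jacobian_matrix n f g"
  note M = jacobian_matrix_carrier[of n f g]
  define E where "E x = u * (\<Sum>j<n. partial_derivative j x * adj_mat ?M $$ (j, i))" for x
  have "E (f k) - (if k = i then 1 else 0) \<in> J" if k: "k < n - 1" for k
  proof -
    have "(\<Sum>j<n. partial_derivative j (f k) * adj_mat ?M $$ (j, i)) = (?M * adj_mat ?M) $$ (k, i)"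
      using k i adj_mat(1)[OF M] M
      by (simp add: scalar_prod_def jacobian_matrix_def atLeast0LessThan)
    also have "\<dots> = jacobian n f g * (if k = i then 1 else 0)"
      using k i by (simp add: adj_mat(2)[OF M] jacobian_def)
    finally have "E (f k) - (if k = i then 1 else 0) =
        (u * jacobian n f g - 1) * (if k = i then 1 else 0)"
      by (simp add: E_def)
    then show ?thesis using mult'[OF u] by simp
  qed
  moreover have "E x \<in> J" if "x \<in> J" for x
    unfolding E_def using J(2)[OF _ that] by (intro mult sum mult') auto
  moreover have "E (x + y) = E x + E y" for x y
    by (simp add: E_def partial_derivative_add distrib_right distrib_left sum.distrib)
  moreover have "E (x * y) = E x * y + x * E y" for x y
    by (simp add: E_def partial_derivative_mult sum.distrib sum_distrib_left algebra_simps)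
  moreover have "E (const c) = 0" for c
    by (simp add: E_def partial_derivative_const)
  ultimately show ?thesis by (intro exI[of _ E]) blast
qed

end

text \<open>
  A derivation dual to \<open>f i\<close> turns a relation \<open>p(f) = 0\<close> into \<open>(\<partial>\<^sub>i p)(f) = 0\<close>. By induction on the
  degree all partial derivatives of \<open>p\<close> vanish, hence so do all coefficients but the constant one,
  and then that one vanishes too.
\<close>

lemma algebraic_independence_mod:
  fixes f :: "nat \<Rightarrow> 'f::comm_ring_1 multipoly" and E :: "nat \<Rightarrow> 'f multipoly \<Rightarrow> 'f multipoly"
  assumes J: "ring_ideal J"
    and inv: "\<And>k x. k > 0 \<Longrightarrow> of_nat k * x \<in> J \<Longrightarrow> x \<in> J"
    and E_add: "\<And>i x y. i < N \<Longrightarrow> E i (x + y) = E i x + E i y"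
    and E_mult: "\<And>i x y. i < N \<Longrightarrow> E i (x * y) = E i x * y + x * E i y"
    and E_const: "\<And>i c. i < N \<Longrightarrow> E i (const c) = 0"
    and E_J: "\<And>i x. i < N \<Longrightarrow> x \<in> J \<Longrightarrow> E i x \<in> J"
    and E_f: "\<And>i k. i < N \<Longrightarrow> k < N \<Longrightarrow> E i (f k) - (if k = i then 1 else 0) \<in> J"
  shows "p \<in> vars_below N \<Longrightarrow> substitute f p \<in> J \<Longrightarrow> const (mcoeff p m) \<in> J"
proof -
  interpret ring_ideal J by fact
  have E_prod: "E i (\<Prod>k\<in>#m. f k) - of_nat (count m i) * (\<Prod>k\<in>#m - {#i#}. f k) \<in> J"
    if i: "i < N" and m: "set_mset m \<subseteq> {..<N}" for i m
    using m
  proof (induction m)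
    case empty
    then show ?case using E_const[OF i, of 1] zero by simp
  next
    case (add k m)
    let ?d = "if k = i then 1 else 0 :: 'f multipoly"
    have eq: "of_nat (count (add_mset k m) i) * (\<Prod>j\<in>#add_mset k m - {#i#}. f j) =
        ?d * (\<Prod>j\<in>#m. f j) + f k * (of_nat (count m i) * (\<Prod>j\<in>#m - {#i#}. f j))"
    proof (cases "i \<in># m")
      case True
      then obtain m' where m': "m = add_mset i m'" by (meson multi_member_split)
      then show ?thesis by (simp add: algebra_simps)
    next
      case False
      then show ?thesis by (auto simp: count_eq_zero_iff[THEN iffD2])
    qed
    have "(E i (f k) * (\<Prod>j\<in>#m. f j) - ?d * (\<Prod>j\<in>#m. f j)) \<in> J"
      using mult'[OF E_f[OF i, of k], of "\<Prod>j\<in>#m. f j"] add.prems by (simp add: left_diff_distrib)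
    moreover have "f k * E i (\<Prod>j\<in>#m. f j)
        - f k * (of_nat (count m i) * (\<Prod>j\<in>#m - {#i#}. f j)) \<in> J"
      using add by (intro cong_mult) simp
    ultimately show ?case
      unfolding eq using cong_add by (simp add: E_mult[OF i])
  qed
  have E_subst: "E i (substitute f p) - substitute f (partial_derivative i p) \<in> J"
    if i: "i < N" and p: "p \<in> vars_below N" for i p
  proof -
    have "E i (substitute f (\<Sum>m\<in>A. monomial m (mcoeff p m)))
        - substitute f (partial_derivative i (\<Sum>m\<in>A. monomial m (mcoeff p m))) \<in> J"
      if "A \<subseteq> support p" for A
      using finite_subset[OF that finite_keys] that
    proof (induction A rule: finite_induct)
      case empty
      then show ?case
        using E_const[OF i, of 0] zero by (simp add: partial_derivative_zero substitute_def)
    next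
      case (insert m A)
      have m: "set_mset m \<subseteq> {..<N}" using p insert.prems by (auto simp: vars_below_def)
      have "E i (substitute f (monomial m (mcoeff p m)))
        - substitute f (partial_derivative i (monomial m (mcoeff p m))) \<in> J"
        using cong_mult[OF E_prod[OF i m], of "const (mcoeff p m)"]
        by (simp add: substitute_monomial partial_derivative_monomial E_mult[OF i] E_const[OF i]
            const_of_nat_mult)
      then show ?case
        using insert
        by (simp add: substitute_add partial_derivative_add E_add[OF i] cong_add)
    qed
    from this[OF order.refl] show ?thesis
      by (simp only: multipoly_expand[OF finite_keys order.refl, symmetric])
  qed
  have main: "\<forall>m\<in>support p. size m \<le> d \<Longrightarrow> p \<in> vars_below N \<Longrightarrow> substitute f p \<in> J
      \<Longrightarrow> const (mcoeff p m) \<in> J" for d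
  proof (induction d arbitrary: p m)
    case 0
    then have "support p \<subseteq> {{#}}" by auto
    then have "p = const (mcoeff p {#})"
      by (intro poly_mapping_eqI) (auto simp: lookup_single when_def in_keys_iff)
    then obtain c where c: "p = const c" by blast
    then have "const c \<in> J" using 0 by (simp add: substitute_monomial)
    then show ?case using c zero by (cases "m = {#}") (simp_all add: lookup_single)
  next
    case (Suc d)
    have pos: "const (mcoeff p (add_mset i m)) \<in> J" for i m
    proof (cases "i < N")
      case False
      have "add_mset i m \<notin> support p"
      proof
        assume "add_mset i m \<in> support p"
        then have "set_mset (add_mset i m) \<subseteq> {..<N}"
          using Suc.prems(2) unfolding vars_below_def by blast
        then show False using False by simp
      qed
      then show ?thesis using zero by (simp add: in_keys_iff)
    next
      case i: True
      let ?q = "partial_derivative i p"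
      have k: "k \<in> support ?q \<Longrightarrow> add_mset i k \<in> support p" for k
        by (auto simp: in_keys_iff lookup_partial_derivative)
      have "E i (substitute f p) \<in> J" using Suc.prems i E_J by blast
      then have "substitute f ?q \<in> J"
        using mem_cong[OF sym[OF E_subst[OF i Suc.prems(2)]]] by blast
      moreover have "\<forall>k\<in>support ?q. size k \<le> d"
      proof
        fix l assume "l \<in> support ?q"
        then have "size (add_mset i l) \<le> Suc d" using k Suc.prems(1) by blast
        then show "size l \<le> d" by simp
      qed
      moreover have "?q \<in> vars_below N"
        unfolding vars_below_def mem_Collect_eq
      proof
        fix l assume "l \<in> support ?q"
        then have "set_mset (add_mset i l) \<subseteq> {..<N}"
          using k Suc.prems(2) unfolding vars_below_def by blast
        then show "set_mset l \<subseteq> {..<N}" by simp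
      qed
      ultimately have "const (mcoeff ?q m) \<in> J" by (intro Suc.IH)
      then have "of_nat (Suc (count m i)) * const (mcoeff p (add_mset i m)) \<in> J"
        by (simp add: lookup_partial_derivative flip: const_of_nat_mult' del: of_nat_Suc)
      then show ?thesis using inv by blast
    qed
    have keys: "const (mcoeff p m) \<in> J" if "m \<noteq> {#}" for m
      using that pos by (cases m) auto
    let ?K = "insert {#} (support p)"
    have "substitute f p = (\<Sum>m\<in>?K. const (mcoeff p m) * (\<Prod>i\<in>#m. f i))"
      by (rule substitute_expand) auto
    also have "\<dots> = const (mcoeff p {#}) +
        (\<Sum>m\<in>support p - {{#}}. const (mcoeff p m) * (\<Prod>i\<in>#m. f i))"
      by (subst sum.insert_remove) auto
    finally have "const (mcoeff p {#}) = substitute f p -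
        (\<Sum>m\<in>support p - {{#}}. const (mcoeff p m) * (\<Prod>i\<in>#m. f i))"
      by (simp add: algebra_simps)
    also have "\<dots> \<in> J" using keys by (intro diff sum mult' Suc.prems) auto
    finally show ?case using keys by (cases "m = {#}") auto
  qed
  have "\<forall>m\<in>support p. size m \<le> Max (size ` support p)" by simp
  then show "p \<in> vars_below N \<Longrightarrow> substitute f p \<in> J \<Longrightarrow> const (mcoeff p m) \<in> J"
    by (rule main)
qed

section \<open>Commutative rings as images of a type-class ring\<close>

text \<open>
  The product of all commutative rings with elements in \<open>'a\<close>. Its projections show that each of
  these rings is the image of a ring in the sense of the type class. The extra factor of integers
  makes \<open>0 \<noteq> 1\<close> hold even if \<open>'a\<close> carries only the zero ring.
\<close>

typedef ('a, 'b) ring_family =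
  "{x :: (('a, 'b) ring_scheme \<Rightarrow> 'a) \<times> int. \<forall>R. if cring R then fst x R \<in> carrier R else fst x R = undefined}"
proof
  show "(\<lambda>R. if cring R then \<zero>\<^bsub>R\<^esub> else undefined, 0) \<in>
    {x. \<forall>R. if cring R then fst x R \<in> carrier R else fst x R = undefined}"
    by (auto simp: cring.cring_simprules)
qed

setup_lifting type_definition_ring_family

instantiation ring_family :: (type, type) comm_ring_1
begin

lift_definition zero_ring_family :: "('a, 'b) ring_family"
  is "(\<lambda>R. if cring R then \<zero>\<^bsub>R\<^esub> else undefined, 0)"
  by (auto simp: cring.cring_simprules)

lift_definition one_ring_family :: "('a, 'b) ring_family"
  is "(\<lambda>R. if cring R then \<one>\<^bsub>R\<^esub> else undefined, 1)"
  by (auto simp: cring.cring_simprules)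

lift_definition plus_ring_family ::
    "('a, 'b) ring_family \<Rightarrow> ('a, 'b) ring_family \<Rightarrow> ('a, 'b) ring_family"
  is "\<lambda>x y. (\<lambda>R. if cring R then fst x R \<oplus>\<^bsub>R\<^esub> fst y R else undefined, snd x + snd y)"
  by (auto simp: cring.cring_simprules)

lift_definition times_ring_family ::
    "('a, 'b) ring_family \<Rightarrow> ('a, 'b) ring_family \<Rightarrow> ('a, 'b) ring_family"
  is "\<lambda>x y. (\<lambda>R. if cring R then fst x R \<otimes>\<^bsub>R\<^esub> fst y R else undefined, snd x * snd y)"
  by (auto simp: cring.cring_simprules)

lift_definition uminus_ring_family :: "('a, 'b) ring_family \<Rightarrow> ('a, 'b) ring_family"
  is "\<lambda>x. (\<lambda>R. if cring R then \<ominus>\<^bsub>R\<^esub> fst x R else undefined, - snd x)"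
  by (auto simp: cring.cring_simprules)

definition minus_ring_family ::
    "('a, 'b) ring_family \<Rightarrow> ('a, 'b) ring_family \<Rightarrow> ('a, 'b) ring_family"
  where "minus_ring_family x y = x + (- y)"

instance
proof
  fix x y z :: "('a, 'b) ring_family"
  show "x + y + z = x + (y + z)" "x + y = y + x" "0 + x = x"
    "x * y * z = x * (y * z)" "x * y = y * x" "1 * x = x" "(x + y) * z = x * z + y * z"
    by (transfer, auto simp: prod_eq_iff fun_eq_iff algebra_simps cring.cring_simprules split: if_splits)+
  show "- x + x = 0"
    by (transfer, auto simp: prod_eq_iff fun_eq_iff cring.cring_simprules)
  show "x - y = x + - y" by (simp add: minus_ring_family_def)
  show "(0 :: ('a, 'b) ring_family) \<noteq> 1" by transfer simp
qed

end

lift_definition ring_component :: "('a, 'b) ring_scheme \<Rightarrow> ('a, 'b) ring_family \<Rightarrow> 'a"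
  is "\<lambda>R x. fst x R" .

text \<open>A ring homomorphism from a type-class ring to a record ring.\<close>

locale ring_map = cring R for R :: "('c, 'd) ring_scheme" (structure) +
  fixes \<psi> :: "'f::comm_ring_1 \<Rightarrow> 'c"
  assumes map_closed [simp, intro]: "\<psi> x \<in> carrier R"
    and map_add: "\<psi> (x + y) = \<psi> x \<oplus> \<psi> y"
    and map_mult: "\<psi> (x * y) = \<psi> x \<otimes> \<psi> y"
    and map_one: "\<psi> 1 = \<one>"
begin

lemma map_zero: "\<psi> 0 = \<zero>"
  using map_add[of 0 0] by (metis add.r_cancel_one' add_0 map_closed)

lemma map_uminus: "\<psi> (- x) = \<ominus> \<psi> x"
  using map_add[of "- x" x] map_zero by (simp add: minus_equality)

lemma map_diff: "\<psi> (x - y) = \<psi> x \<ominus> \<psi> y"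
  using map_add[of x "- y"] by (simp add: map_uminus minus_eq)

lemma map_diff_zero_iff: "\<psi> (x - y) = \<zero> \<longleftrightarrow> \<psi> x = \<psi> y"
  by (simp add: map_diff)

lemma ideal_kernel: "ring_ideal {x. \<psi> x = \<zero>}"
  by unfold_locales (auto simp: map_zero map_add map_mult)

end

lemma ring_map_component:
  assumes R: "cring R"
  shows "ring_map R (ring_component R)"
proof (intro ring_map.intro ring_map_axioms.intro R)
  fix x y :: "('a, 'b) ring_family"
  show "ring_component R x \<in> carrier R"
    using Rep_ring_family[of x] R by (auto simp: ring_component.rep_eq)
qed (simp_all add: R ring_component.rep_eq plus_ring_family.rep_eq times_ring_family.rep_eq
    one_ring_family.rep_eq)

lemma ring_component_surj:
  assumes "cring R" "r \<in> carrier R"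
  shows "\<exists>x. ring_component R x = r"
proof -
  let ?w = "(\<lambda>T. if T = R then r else if cring T then \<zero>\<^bsub>T\<^esub> else undefined, 0 :: int)"
  have "?w \<in> {x. \<forall>R. if cring R then fst x R \<in> carrier R else fst x R = undefined}"
    using assms by (auto simp: cring.cring_simprules)
  then have "ring_component R (Abs_ring_family ?w) = r"
    by (simp add: ring_component.rep_eq Abs_ring_family_inverse)
  then show ?thesis by blast
qed

lemma cring_of_surjective_map:
  fixes \<psi> :: "'f::comm_ring_1 \<Rightarrow> 'c" and M (structure)
  assumes closed: "\<And>x. \<psi> x \<in> carrier M" and surj: "\<And>y. y \<in> carrier M \<Longrightarrow> \<exists>x. y = \<psi> x"
    and add: "\<And>x y. \<psi> (x + y) = \<psi> x \<oplus> \<psi> y" and mult: "\<And>x y. \<psi> (x * y) = \<psi> x \<otimes> \<psi> y"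
    and one: "\<psi> 1 = \<one>" and zero: "\<psi> 0 = \<zero>"
  shows "cring M"
proof (intro cringI abelian_groupI comm_monoidI)
  fix x assume "x \<in> carrier M"
  then obtain u where u: "x = \<psi> u" using surj by blast
  show "\<zero> \<oplus> x = x" unfolding u zero[symmetric] by (simp flip: add)
  show "\<one> \<otimes> x = x" unfolding u one[symmetric] by (simp flip: mult)
  have "\<psi> (- u) \<oplus> x = \<zero>" unfolding u zero[symmetric] by (simp flip: add)
  then show "\<exists>y\<in>carrier M. y \<oplus> x = \<zero>" using closed by blast
  fix y assume "y \<in> carrier M"
  then obtain v where v: "y = \<psi> v" using surj by blast
  show "x \<oplus> y \<in> carrier M" "x \<otimes> y \<in> carrier M"
    unfolding u v by (simp_all add: closed flip: add mult)
  show "x \<oplus> y = y \<oplus> x" "x \<otimes> y = y \<otimes> x"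
    unfolding u v by (simp_all add: add.commute mult.commute flip: add mult)
  fix z assume "z \<in> carrier M"
  then obtain w where w: "z = \<psi> w" using surj by blast
  show "x \<oplus> y \<oplus> z = x \<oplus> (y \<oplus> z)" "x \<otimes> y \<otimes> z = x \<otimes> (y \<otimes> z)" "(x \<oplus> y) \<otimes> z = x \<otimes> z \<oplus> y \<otimes> z"
    unfolding u v w by (simp_all add: add.assoc mult.assoc distrib_right flip: add mult)
qed (use closed one zero in metis)+

lemma (in ring_map) map_sum:
  assumes "finite A"
  shows "\<psi> (sum f A) = (\<Oplus>i\<in>A. \<psi> (f i))"
  using assms
  by (induction A rule: finite_induct) (auto simp: map_zero map_add finsum_insert)

section \<open>Polynomial rings over a record ring\<close>

lemma finite_submultisets: "finite {k. k \<subseteq># m}"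
proof (rule finite_subset)
  show "{k. k \<subseteq># m} \<subseteq> mset ` {xs. set xs \<subseteq> set_mset m \<and> length xs \<le> size m}"
  proof
    fix k assume k: "k \<in> {k. k \<subseteq># m}"
    obtain xs where xs: "mset xs = k" using ex_mset by blast
    then have "set xs \<subseteq> set_mset m" "length xs \<le> size m"
      using k set_mset_mono[of k m] size_mset_mono[of k m] by (auto simp flip: xs)
    then show "k \<in> mset ` {xs. set xs \<subseteq> set_mset m \<and> length xs \<le> size m}"
      using xs by blast
  qed
qed (simp add: finite_lists_length_le)

text \<open>The product of the type agrees with the convolution product that defines \<open>mpoly_ring\<close>.\<close>

lemma lookup_mult_multiset:
  fixes p q :: "'f::comm_ring_1 multipoly"
  shows "mcoeff (p * q) m = (\<Sum>k | k \<subseteq># m. mcoeff p k * mcoeff q (m - k))"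
proof (induction p rule: multipoly_induct)
  case (monomial k c)
  show ?case
  proof (induction q rule: multipoly_induct)
    case (monomial l d)
    have "(\<Sum>j | j \<subseteq># m. mcoeff (monomial k c) j * mcoeff (monomial l d) (m - j)) =
        (\<Sum>j | j \<subseteq># m. if j = k then c * mcoeff (monomial l d) (m - k) else 0)"
      by (rule sum.cong) (auto simp: lookup_single when_def)
    also have "\<dots> = (if k \<subseteq># m then c * mcoeff (monomial l d) (m - k) else 0)"
      by (simp add: finite_submultisets)
    also have "\<dots> = mcoeff (monomial k c * monomial l d) m"
    proof -
      have "k + l = m \<longleftrightarrow> k \<subseteq># m \<and> l = m - k" by auto
      then show ?thesis by (simp add: monomial_mult lookup_single when_def)
    qed
    finally show ?case ..
  next
    case (add p q)
    then show ?case by (simp add: lookup_add distrib_left sum.distrib)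
  qed
next
  case (add p q')
  then show ?case by (simp add: lookup_add distrib_left distrib_right sum.distrib)
qed

text \<open>
  The type has a variable for every natural number; those from \<open>n\<close> on are sent to zero.
\<close>

definition poly_map ::
    "('c, 'd) ring_scheme \<Rightarrow> ('f::comm_ring_1 \<Rightarrow> 'c) \<Rightarrow> nat \<Rightarrow> 'f multipoly \<Rightarrow> nat multiset \<Rightarrow> 'c"
  where "poly_map R \<psi> n p m = (if set_mset m \<subseteq> {..<n} then \<psi> (mcoeff p m) else \<zero>\<^bsub>R\<^esub>)"

lemma mpoly_ring_simps:
  "carrier (mpoly_ring R n) = ring.indexed_pset R {..<n} (carrier R)"
  "p \<otimes>\<^bsub>mpoly_ring R n\<^esub> q = (\<lambda>m. \<Oplus>\<^bsub>R\<^esub>k\<in>{k. k \<subseteq># m}. p k \<otimes>\<^bsub>R\<^esub> q (m - k))"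
  "\<one>\<^bsub>mpoly_ring R n\<^esub> = ring.indexed_const R \<one>\<^bsub>R\<^esub>"
  "\<zero>\<^bsub>mpoly_ring R n\<^esub> = ring.indexed_const R \<zero>\<^bsub>R\<^esub>"
  "p \<oplus>\<^bsub>mpoly_ring R n\<^esub> q = ring.indexed_padd R p q"
  by (simp_all add: mpoly_ring_def)

context ring_map
begin

lemma poly_map_const: "poly_map R \<psi> n (const c) = indexed_const (\<psi> c)"
  by (auto simp: poly_map_def indexed_const_def fun_eq_iff lookup_single when_def map_zero)

lemma poly_map_add: "poly_map R \<psi> n (p + q) = poly_map R \<psi> n p \<oplus>\<^bsub>mpoly_ring R n\<^esub> poly_map R \<psi> n q"
  by (auto simp: poly_map_def mpoly_ring_simps indexed_padd_def fun_eq_iff lookup_add map_add)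

lemma poly_map_monomial_var:
  "i < n \<Longrightarrow> poly_map R \<psi> n (p * var i) = indexed_pmult (poly_map R \<psi> n p) i"
proof (rule ext)
  fix m assume i: "i < n"
  have "mcoeff (p * var i) m = (if i \<in># m then mcoeff p (m - {#i#}) else 0)"
    by (induction p rule: multipoly_induct)
      (auto simp: monomial_mult lookup_single when_def lookup_add distrib_right)
  then show "poly_map R \<psi> n (p * var i) m = indexed_pmult (poly_map R \<psi> n p) i m"
    using i by (auto simp: poly_map_def indexed_pmult_def map_zero dest: in_diffD
        multi_member_split)
qed

lemma poly_map_mult: "poly_map R \<psi> n (p * q) = poly_map R \<psi> n p \<otimes>\<^bsub>mpoly_ring R n\<^esub> poly_map R \<psi> n q"
proof (rule ext)
  fix m
  show "poly_map R \<psi> n (p * q) m = (poly_map R \<psi> n p \<otimes>\<^bsub>mpoly_ring R n\<^esub> poly_map R \<psi> n q) m"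
  proof (cases "set_mset m \<subseteq> {..<n}")
    case True
    have "poly_map R \<psi> n (p * q) m = (\<Oplus>k\<in>{k. k \<subseteq># m}. \<psi> (mcoeff p k) \<otimes> \<psi> (mcoeff q (m - k)))"
      using True by (simp add: poly_map_def lookup_mult_multiset map_sum[OF finite_submultisets] map_mult)
    also have "\<dots> = (\<Oplus>k\<in>{k. k \<subseteq># m}. poly_map R \<psi> n p k \<otimes> poly_map R \<psi> n q (m - k))"
    proof (rule finsum_cong')
      fix k assume k: "k \<in> {k. k \<subseteq># m}"
      then have "set_mset k \<subseteq> {..<n}" "set_mset (m - k) \<subseteq> {..<n}"
        using True by (auto dest: mset_subset_eqD in_diffD)
      then show "\<psi> (mcoeff p k) \<otimes> \<psi> (mcoeff q (m - k)) =
          poly_map R \<psi> n p k \<otimes> poly_map R \<psi> n q (m - k)"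
        by (simp add: poly_map_def)
    qed (auto simp: poly_map_def)
    finally show ?thesis by (simp add: mpoly_ring_simps)
  next
    case False
    have "(\<Oplus>k\<in>{k. k \<subseteq># m}. poly_map R \<psi> n p k \<otimes> poly_map R \<psi> n q (m - k)) =
        (\<Oplus>k\<in>{k. k \<subseteq># m}. \<zero>)"
    proof (rule finsum_cong')
      fix k assume k: "k \<in> {k. k \<subseteq># m}"
      then have "set_mset m = set_mset k \<union> set_mset (m - k)"
        by (metis mem_Collect_eq set_mset_union subset_mset.add_diff_inverse)
      then have "\<not> set_mset k \<subseteq> {..<n} \<or> \<not> set_mset (m - k) \<subseteq> {..<n}"
        using False by blast
      then show "poly_map R \<psi> n p k \<otimes> poly_map R \<psi> n q (m - k) = \<zero>"
        by (auto simp: poly_map_def)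
    qed auto
    then show ?thesis using False by (simp add: mpoly_ring_simps poly_map_def)
  qed
qed

lemma poly_map_closed: "poly_map R \<psi> n p \<in> carrier (mpoly_ring R n)"
proof (induction p rule: multipoly_induct)
  case (monomial m c)
  show ?case
  proof (cases "set_mset m \<subseteq> {..<n}")
    case True
    then show ?thesis
    proof (induction m)
      case empty
      show ?case unfolding poly_map_const mpoly_ring_simps by (rule indexed_pset.indexed_const) simp
    next
      case (add i m)
      have "monomial (add_mset i m) c = monomial m c * var i" by (simp add: monomial_mult)
      then show ?case
        using add by (simp add: poly_map_monomial_var mpoly_ring_simps indexed_pset.indexed_pmult)
    qed
  next
    case False
    then have "poly_map R \<psi> n (monomial m c) = indexed_const \<zero>"
      by (auto simp: poly_map_def indexed_const_def fun_eq_iff lookup_single when_def map_zero)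
    then show ?thesis
      unfolding mpoly_ring_simps by (simp add: indexed_pset.indexed_const)
  qed
next
  case (add p q)
  then show ?case unfolding poly_map_add mpoly_ring_simps by (rule indexed_pset.indexed_padd)
qed

lemma poly_map_one: "poly_map R \<psi> n 1 = \<one>\<^bsub>mpoly_ring R n\<^esub>"
  using poly_map_const[of n 1] by (simp add: mpoly_ring_simps map_one)

lemma poly_map_zero: "poly_map R \<psi> n 0 = \<zero>\<^bsub>mpoly_ring R n\<^esub>"
  using poly_map_const[of n 0] by (simp add: mpoly_ring_simps map_zero)

lemma poly_map_surj:
  assumes surj: "\<And>r. r \<in> carrier R \<Longrightarrow> \<exists>x. \<psi> x = r" and y: "y \<in> carrier (mpoly_ring R n)"
  shows "\<exists>p. y = poly_map R \<psi> n p"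
  using y unfolding mpoly_ring_simps(1)
proof (induction rule: indexed_pset.induct)
  case (indexed_const k)
  then obtain c where "k = \<psi> c" using surj by blast
  then show ?case by (intro exI[of _ "const c"]) (simp only: poly_map_const)
next
  case (indexed_padd P Q)
  then obtain p q where "P = poly_map R \<psi> n p" "Q = poly_map R \<psi> n q" by blast
  then show ?case by (intro exI[of _ "p + q"]) (simp only: poly_map_add mpoly_ring_simps)
next
  case (indexed_pmult P i)
  then obtain p where "P = poly_map R \<psi> n p" by blast
  then show ?case
    using indexed_pmult(2) by (intro exI[of _ "p * var i"]) (simp add: poly_map_monomial_var)
qed

end

lemma cring_mpoly_ring:
  assumes "cring R"
  shows "cring (mpoly_ring R n)"
proof -
  interpret ring_map R "ring_component R" by (rule ring_map_component[OF assms])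
  show ?thesis
    by (rule cring_of_surjective_map[of "poly_map R (ring_component R) n"])
      (simp_all add: poly_map_closed poly_map_surj ring_component_surj[OF assms]
        poly_map_add poly_map_mult poly_map_one poly_map_zero)
qed

lemma (in ring_map) ring_map_poly_map: "ring_map (mpoly_ring R n) (poly_map R \<psi> n)"
  by (intro ring_map.intro cring_mpoly_ring ring_map_axioms.intro)
    (simp_all add: poly_map_closed poly_map_add poly_map_mult poly_map_one cring_axioms)

lemma (in ring_map) poly_map_eq_zero_iff:
  "poly_map R \<psi> n p = \<zero>\<^bsub>mpoly_ring R n\<^esub> \<longleftrightarrow> (\<forall>m. set_mset m \<subseteq> {..<n} \<longrightarrow> \<psi> (mcoeff p m) = \<zero>)"
  unfolding poly_map_zero[symmetric] by (auto simp: poly_map_def fun_eq_iff map_zero)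

lemma (in ring_map) partial_derivative_kernel:
  assumes "poly_map R \<psi> n p = \<zero>\<^bsub>mpoly_ring R n\<^esub>" "j < n"
  shows "poly_map R \<psi> n (partial_derivative j p) = \<zero>\<^bsub>mpoly_ring R n\<^esub>"
  using assms unfolding poly_map_eq_zero_iff
  by (simp add: lookup_partial_derivative map_mult)

text \<open>
  The inductive definition of the carrier multiplies by a variable through a shift of monomials;
  this agrees with the convolution product.
\<close>

lemma mpoly_ring_pmult:
  assumes "cring R" "P \<in> carrier (mpoly_ring R n)" "i < n"
  shows "ring.indexed_pmult R P i = P \<otimes>\<^bsub>mpoly_ring R n\<^esub> ring.indexed_var R i"
    "ring.indexed_var R i \<in> carrier (mpoly_ring R n)"
proof -
  interpret ring_map R "ring_component R" by (rule ring_map_component[OF assms(1)])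
  obtain p where p: "P = poly_map R (ring_component R) n p"
    using poly_map_surj[OF ring_component_surj[OF assms(1)] assms(2)] by blast
  have v: "indexed_var i = poly_map R (ring_component R) n (var i)"
    using poly_map_monomial_var[OF assms(3), of 1] poly_map_const[of n 1]
    by (simp add: indexed_var_def map_one)
  show "indexed_pmult P i = P \<otimes>\<^bsub>mpoly_ring R n\<^esub> indexed_var i"
    unfolding v p poly_map_monomial_var[OF assms(3), symmetric] poly_map_mult ..
  show "indexed_var i \<in> carrier (mpoly_ring R n)"
    unfolding v by (rule poly_map_closed)
qed

section \<open>Localizations and quotients\<close>

text \<open>
  Numerators and denominators are written as images under a surjection \<open>\<psi>\<close>, so that identities
  between fractions reduce to identities in a type-class ring.
\<close>

locale ring_map_localization = ring_map R \<psi>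
  for R :: "('c, 'd) ring_scheme" (structure) and \<psi> :: "'f::comm_ring_1 \<Rightarrow> 'c" +
  fixes S :: "'c set"
  assumes surj: "r \<in> carrier R \<Longrightarrow> \<exists>x. \<psi> x = r"
    and S_closed: "S \<subseteq> carrier R" and S_one: "\<one> \<in> S"
    and S_mult: "s \<in> S \<Longrightarrow> t \<in> S \<Longrightarrow> s \<otimes> t \<in> S"
begin

definition fraction_of :: "'f \<Rightarrow> 'f \<Rightarrow> ('c \<times> 'c) set"
  where "fraction_of x y = fraction R S (\<psi> x) (\<psi> y)"

lemma one_denominator: "\<psi> 1 \<in> S"
  by (simp add: map_one S_one)

lemma mult_denominator: "\<psi> y \<in> S \<Longrightarrow> \<psi> y' \<in> S \<Longrightarrow> \<psi> (y * y') \<in> S"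
  by (simp add: map_mult S_mult)

lemma rel_iff: "((\<psi> x, \<psi> y), (\<psi> x', \<psi> y')) \<in> fraction_rel R S \<longleftrightarrow>
  \<psi> y \<in> S \<and> \<psi> y' \<in> S \<and> (\<exists>t. \<psi> t \<in> S \<and> \<psi> (t * (x * y' - x' * y)) = \<zero>)"
proof -
  have "(\<exists>t\<in>S. t \<otimes> (\<psi> x \<otimes> \<psi> y' \<ominus> \<psi> x' \<otimes> \<psi> y) = \<zero>) \<longleftrightarrow>
      (\<exists>t. \<psi> t \<in> S \<and> \<psi> t \<otimes> (\<psi> x \<otimes> \<psi> y' \<ominus> \<psi> x' \<otimes> \<psi> y) = \<zero>)"
    using surj S_closed by (metis subsetD)
  then show ?thesis by (simp add: fraction_rel_def map_mult map_diff)
qed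

lemma pair_cases:
  assumes "p \<in> carrier R \<times> S"
  obtains x y where "p = (\<psi> x, \<psi> y)" "\<psi> y \<in> S"
proof -
  obtain r s where rs: "p = (r, s)" "r \<in> carrier R" "s \<in> S" using assms by blast
  then obtain x y where "\<psi> x = r" "\<psi> y = s" using surj S_closed by blast
  then show thesis using rs that by blast
qed

lemma equiv_rel: "equiv (carrier R \<times> S) (fraction_rel R S)"
proof (rule equivI)
  show "fraction_rel R S \<subseteq> (carrier R \<times> S) \<times> (carrier R \<times> S)"
    by (auto simp: fraction_rel_def)
  then have dom: "p \<in> carrier R \<times> S" "q \<in> carrier R \<times> S" if "(p, q) \<in> fraction_rel R S" for p q
    using that by blast+
  show "refl_on (carrier R \<times> S) (fraction_rel R S)"
  proof (rule refl_onI)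
    fix p assume "p \<in> carrier R \<times> S"
    then obtain x y where p: "p = (\<psi> x, \<psi> y)" "\<psi> y \<in> S" by (rule pair_cases)
    then show "(p, p) \<in> fraction_rel R S"
      unfolding p(1) rel_iff using one_denominator by (auto simp: map_zero intro!: exI[of _ 1])
  qed
  show "sym (fraction_rel R S)"
  proof (rule symI)
    fix p q assume pq: "(p, q) \<in> fraction_rel R S"
    obtain x y where p: "p = (\<psi> x, \<psi> y)" "\<psi> y \<in> S" by (rule pair_cases[OF dom(1)[OF pq]])
    obtain x' y' where q: "q = (\<psi> x', \<psi> y')" "\<psi> y' \<in> S" by (rule pair_cases[OF dom(2)[OF pq]])
    from pq[unfolded p(1) q(1) rel_iff] obtain t where t: "\<psi> y \<in> S" "\<psi> y' \<in> S" "\<psi> t \<in> S"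
      "\<psi> (t * (x * y' - x' * y)) = \<zero>" by blast
    have "\<psi> (t * (x' * y - x * y')) = \<psi> (- (t * (x * y' - x' * y)))" by (simp add: algebra_simps)
    also have "\<dots> = \<zero>" using t by (simp only: map_uminus) simp
    finally show "(q, p) \<in> fraction_rel R S" unfolding p(1) q(1) rel_iff using t by blast
  qed
  show "trans (fraction_rel R S)"
  proof (rule transI)
    fix p q r assume pq: "(p, q) \<in> fraction_rel R S" and qr: "(q, r) \<in> fraction_rel R S"
    obtain x y where p: "p = (\<psi> x, \<psi> y)" "\<psi> y \<in> S" by (rule pair_cases[OF dom(1)[OF pq]])
    obtain x' y' where q: "q = (\<psi> x', \<psi> y')" "\<psi> y' \<in> S" by (rule pair_cases[OF dom(2)[OF pq]])
    obtain x'' y'' where r: "r = (\<psi> x'', \<psi> y'')" "\<psi> y'' \<in> S" by (rule pair_cases[OF dom(2)[OF qr]])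
    from pq[unfolded p(1) q(1) rel_iff] obtain t where t: "\<psi> y \<in> S" "\<psi> y' \<in> S" "\<psi> t \<in> S"
      "\<psi> (t * (x * y' - x' * y)) = \<zero>" by blast
    from qr[unfolded r(1) q(1) rel_iff] obtain u where u: "\<psi> y'' \<in> S" "\<psi> u \<in> S"
      "\<psi> (u * (x' * y'' - x'' * y')) = \<zero>" by blast
    have "\<psi> (t * u * y' * (x * y'' - x'' * y)) =
        \<psi> (u * y'' * (t * (x * y' - x' * y)) + t * y * (u * (x' * y'' - x'' * y')))"
      by (simp add: algebra_simps)
    also have "\<dots> = \<psi> (u * y'') \<otimes> \<psi> (t * (x * y' - x' * y)) \<oplus> \<psi> (t * y) \<otimes> \<psi> (u * (x' * y'' - x'' * y'))"
      by (simp only: map_add map_mult)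
    also have "\<dots> = \<zero>" unfolding t u by simp
    finally have "\<psi> (t * u * y' * (x * y'' - x'' * y)) = \<zero>" .
    moreover have "\<psi> (t * u * y') \<in> S" using t u by (intro mult_denominator)
    ultimately show "(p, r) \<in> fraction_rel R S" unfolding p(1) r(1) rel_iff using t u by blast
  qed
qed

lemma fraction_of_eq_iff:
  assumes "\<psi> y \<in> S" "\<psi> y' \<in> S"
  shows "fraction_of x y = fraction_of x' y' \<longleftrightarrow> (\<exists>t. \<psi> t \<in> S \<and> \<psi> (t * (x * y' - x' * y)) = \<zero>)"
  unfolding fraction_of_def fraction_def
  using eq_equiv_class_iff[OF equiv_rel, of "(\<psi> x, \<psi> y)" "(\<psi> x', \<psi> y')"] assms
  by (simp add: rel_iff)

lemma fraction_of_eqI: "x * y' = x' * y \<Longrightarrow> \<psi> y \<in> S \<Longrightarrow> \<psi> y' \<in> S \<Longrightarrow> fraction_of x y = fraction_of x' y'"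
  using fraction_of_eq_iff[of y y' x x'] one_denominator by (auto simp: map_zero)

lemma mem_fraction_of:
  assumes "p \<in> fraction_of x y"
  obtains x' y' where "p = (\<psi> x', \<psi> y')" "\<psi> y' \<in> S" "fraction_of x' y' = fraction_of x y"
proof -
  have p: "((\<psi> x, \<psi> y), p) \<in> fraction_rel R S"
    using assms by (simp add: fraction_of_def fraction_def)
  then have "p \<in> carrier R \<times> S" by (auto simp: fraction_rel_def)
  then obtain x' y' where xy: "p = (\<psi> x', \<psi> y')" "\<psi> y' \<in> S" by (rule pair_cases)
  have "fraction_of x y = fraction_of x' y'"
    using equiv_class_eq[OF equiv_rel p] xy by (simp add: fraction_of_def fraction_def)
  then show thesis using xy that by blast
qed

lemma fraction_of_self: "\<psi> y \<in> S \<Longrightarrow> (\<psi> x, \<psi> y) \<in> fraction_of x y"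
  unfolding fraction_of_def fraction_def using equiv_class_self[OF equiv_rel] by simp

lemma carrier_localization: "carrier (localization R S) = {fraction_of x y |x y. \<psi> y \<in> S}"
proof (intro equalityI subsetI)
  fix z assume "z \<in> carrier (localization R S)"
  then obtain p where p: "p \<in> carrier R \<times> S" "z = fraction_rel R S `` {p}"
    by (auto simp: localization_def quotient_def)
  from p(1) obtain x y where "p = (\<psi> x, \<psi> y)" "\<psi> y \<in> S" by (rule pair_cases)
  then show "z \<in> {fraction_of x y |x y. \<psi> y \<in> S}"
    using p by (auto simp: fraction_of_def fraction_def)
next
  fix z assume "z \<in> {fraction_of x y |x y. \<psi> y \<in> S}"
  then show "z \<in> carrier (localization R S)"
    by (auto simp: localization_def fraction_of_def fraction_def intro!: quotientI)
qed

lemma fraction_of_op: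
  assumes y: "\<psi> y \<in> S" "\<psi> y' \<in> S"
    and cong: "\<And>u v u' v'. \<psi> v \<in> S \<Longrightarrow> \<psi> v' \<in> S \<Longrightarrow> fraction_of u v = fraction_of x y \<Longrightarrow> fraction_of u' v' = fraction_of x' y' \<Longrightarrow>
      G (\<psi> u) (\<psi> v) (\<psi> u') (\<psi> v') = C"
  shows "(\<Union>(r, s)\<in>fraction_of x y. \<Union>(r', s')\<in>fraction_of x' y'. G r s r' s') = C"
proof (intro equalityI subsetI)
  fix z assume "z \<in> (\<Union>(r, s)\<in>fraction_of x y. \<Union>(r', s')\<in>fraction_of x' y'. G r s r' s')"
  then obtain p q where pq: "p \<in> fraction_of x y" "q \<in> fraction_of x' y'" "z \<in> G (fst p) (snd p) (fst q) (snd q)"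
    by fastforce
  obtain u v where 1: "p = (\<psi> u, \<psi> v)" "\<psi> v \<in> S" "fraction_of u v = fraction_of x y" using pq(1) by (rule mem_fraction_of)
  obtain u' v' where 2: "q = (\<psi> u', \<psi> v')" "\<psi> v' \<in> S" "fraction_of u' v' = fraction_of x' y'" using pq(2) by (rule mem_fraction_of)
  show "z \<in> C" using cong[OF 1(2) 2(2) 1(3) 2(3)] pq 1 2 by simp
next
  fix z assume "z \<in> C"
  then have "z \<in> G (\<psi> x) (\<psi> y) (\<psi> x') (\<psi> y')" using cong[OF y refl refl] by simp
  then show "z \<in> (\<Union>(r, s)\<in>fraction_of x y. \<Union>(r', s')\<in>fraction_of x' y'. G r s r' s')"
    using fraction_of_self[OF y(1), of x] fraction_of_self[OF y(2), of x'] by fastforce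
qed

lemma fraction_of_mult:
  assumes y: "\<psi> y \<in> S" "\<psi> y' \<in> S"
  shows "fraction_of x y \<otimes>\<^bsub>localization R S\<^esub> fraction_of x' y' = fraction_of (x * x') (y * y')"
proof -
  have "fraction_of x y \<otimes>\<^bsub>localization R S\<^esub> fraction_of x' y' =
    (\<Union>(r, s)\<in>fraction_of x y. \<Union>(r', s')\<in>fraction_of x' y'. fraction R S (r \<otimes> r') (s \<otimes> s'))"
    by (simp add: localization_def)
  also have "\<dots> = fraction_of (x * x') (y * y')"
  proof (rule fraction_of_op[OF y])
    fix u v u' v'
    assume v: "\<psi> v \<in> S" "\<psi> v' \<in> S" and eq: "fraction_of u v = fraction_of x y" "fraction_of u' v' = fraction_of x' y'"
    obtain t where t: "\<psi> t \<in> S" "\<psi> (t * (u * y - x * v)) = \<zero>"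
      using eq fraction_of_eq_iff v y by blast
    obtain t' where t': "\<psi> t' \<in> S" "\<psi> (t' * (u' * y' - x' * v')) = \<zero>"
      using eq fraction_of_eq_iff v y by blast
    have "\<psi> (t * t' * (u * u' * (y * y') - x * x' * (v * v'))) =
      \<psi> (t' * u' * y' * (t * (u * y - x * v)) + t * x * v * (t' * (u' * y' - x' * v')))"
      by (simp add: algebra_simps)
    also have "\<dots> = \<psi> (t' * u' * y') \<otimes> \<psi> (t * (u * y - x * v)) \<oplus> \<psi> (t * x * v) \<otimes> \<psi> (t' * (u' * y' - x' * v'))"
      by (simp only: map_add map_mult)
    also have "\<dots> = \<zero>" unfolding t t' by simp
    finally have "fraction_of (u * u') (v * v') = fraction_of (x * x') (y * y')"
      using fraction_of_eq_iff mult_denominator v y t t' by blast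
    then show "fraction R S (\<psi> u \<otimes> \<psi> u') (\<psi> v \<otimes> \<psi> v') = fraction_of (x * x') (y * y')"
      by (simp add: fraction_of_def map_mult)
  qed
  finally show ?thesis .
qed

lemma fraction_of_add:
  assumes y: "\<psi> y \<in> S" "\<psi> y' \<in> S"
  shows "fraction_of x y \<oplus>\<^bsub>localization R S\<^esub> fraction_of x' y' = fraction_of (x * y' + x' * y) (y * y')"
proof -
  have "fraction_of x y \<oplus>\<^bsub>localization R S\<^esub> fraction_of x' y' =
    (\<Union>(r, s)\<in>fraction_of x y. \<Union>(r', s')\<in>fraction_of x' y'. fraction R S (r \<otimes> s' \<oplus> r' \<otimes> s) (s \<otimes> s'))"
    by (simp add: localization_def)
  also have "\<dots> = fraction_of (x * y' + x' * y) (y * y')"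
  proof (rule fraction_of_op[OF y])
    fix u v u' v'
    assume v: "\<psi> v \<in> S" "\<psi> v' \<in> S" and eq: "fraction_of u v = fraction_of x y" "fraction_of u' v' = fraction_of x' y'"
    obtain t where t: "\<psi> t \<in> S" "\<psi> (t * (u * y - x * v)) = \<zero>"
      using eq fraction_of_eq_iff v y by blast
    obtain t' where t': "\<psi> t' \<in> S" "\<psi> (t' * (u' * y' - x' * v')) = \<zero>"
      using eq fraction_of_eq_iff v y by blast
    have "\<psi> (t * t' * ((u * v' + u' * v) * (y * y') - (x * y' + x' * y) * (v * v'))) =
      \<psi> (t' * v' * y' * (t * (u * y - x * v)) + t * v * y * (t' * (u' * y' - x' * v')))"
      by (simp add: algebra_simps)
    also have "\<dots> = \<psi> (t' * v' * y') \<otimes> \<psi> (t * (u * y - x * v)) \<oplus> \<psi> (t * v * y) \<otimes> \<psi> (t' * (u' * y' - x' * v'))"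
      by (simp only: map_add map_mult)
    also have "\<dots> = \<zero>" unfolding t t' by simp
    finally have "fraction_of (u * v' + u' * v) (v * v') = fraction_of (x * y' + x' * y) (y * y')"
      using fraction_of_eq_iff mult_denominator v y t t' by blast
    then show "fraction R S (\<psi> u \<otimes> \<psi> v' \<oplus> \<psi> u' \<otimes> \<psi> v) (\<psi> v \<otimes> \<psi> v') =
        fraction_of (x * y' + x' * y) (y * y')"
      by (simp add: fraction_of_def map_mult map_add)
  qed
  finally show ?thesis .
qed

lemma localization_one: "\<one>\<^bsub>localization R S\<^esub> = fraction_of 1 1"
  by (simp add: localization_def fraction_of_def map_one)

lemma localization_zero: "\<zero>\<^bsub>localization R S\<^esub> = fraction_of 0 1"
  by (simp add: localization_def fraction_of_def map_one map_zero)

lemma fraction_of_closed: "\<psi> y \<in> S \<Longrightarrow> fraction_of x y \<in> carrier (localization R S)"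
  by (auto simp: carrier_localization)

lemma cring_localization: "cring (localization R S)" (is "cring ?L")
proof (intro cringI abelian_groupI comm_monoidI)
  show "\<one>\<^bsub>?L\<^esub> \<in> carrier ?L" "\<zero>\<^bsub>?L\<^esub> \<in> carrier ?L"
    by (simp_all add: localization_one localization_zero fraction_of_closed one_denominator)
  fix a assume "a \<in> carrier ?L"
  then obtain x y where a: "a = fraction_of x y" "\<psi> y \<in> S" by (auto simp: carrier_localization)
  show "\<zero>\<^bsub>?L\<^esub> \<oplus>\<^bsub>?L\<^esub> a = a" "\<one>\<^bsub>?L\<^esub> \<otimes>\<^bsub>?L\<^esub> a = a"
    using a by (simp_all add: localization_zero localization_one fraction_of_add fraction_of_mult one_denominator)
  have "fraction_of (- x) y \<oplus>\<^bsub>?L\<^esub> a = \<zero>\<^bsub>?L\<^esub>"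
    using a by (simp add: localization_zero fraction_of_add) (intro fraction_of_eqI mult_denominator one_denominator; simp)
  then show "\<exists>b\<in>carrier ?L. b \<oplus>\<^bsub>?L\<^esub> a = \<zero>\<^bsub>?L\<^esub>" using fraction_of_closed[OF a(2)] by blast
  fix b assume "b \<in> carrier ?L"
  then obtain x' y' where b: "b = fraction_of x' y'" "\<psi> y' \<in> S" by (auto simp: carrier_localization)
  show "a \<oplus>\<^bsub>?L\<^esub> b \<in> carrier ?L" "a \<otimes>\<^bsub>?L\<^esub> b \<in> carrier ?L"
    using a b by (simp_all add: fraction_of_add fraction_of_mult fraction_of_closed mult_denominator)
  show "a \<oplus>\<^bsub>?L\<^esub> b = b \<oplus>\<^bsub>?L\<^esub> a" "a \<otimes>\<^bsub>?L\<^esub> b = b \<otimes>\<^bsub>?L\<^esub> a"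
    using a b by (simp_all add: fraction_of_add fraction_of_mult mult.commute add.commute)
  fix c assume "c \<in> carrier ?L"
  then obtain x'' y'' where c: "c = fraction_of x'' y''" "\<psi> y'' \<in> S" by (auto simp: carrier_localization)
  show "a \<oplus>\<^bsub>?L\<^esub> b \<oplus>\<^bsub>?L\<^esub> c = a \<oplus>\<^bsub>?L\<^esub> (b \<oplus>\<^bsub>?L\<^esub> c)"
    "a \<otimes>\<^bsub>?L\<^esub> b \<otimes>\<^bsub>?L\<^esub> c = a \<otimes>\<^bsub>?L\<^esub> (b \<otimes>\<^bsub>?L\<^esub> c)"
    using a b c by (simp_all add: fraction_of_add fraction_of_mult mult_denominator algebra_simps)
  show "(a \<oplus>\<^bsub>?L\<^esub> b) \<otimes>\<^bsub>?L\<^esub> c = a \<otimes>\<^bsub>?L\<^esub> c \<oplus>\<^bsub>?L\<^esub> b \<otimes>\<^bsub>?L\<^esub> c"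
    unfolding a b c using a b c
    by (simp add: fraction_of_add fraction_of_mult mult_denominator)
      (intro fraction_of_eqI mult_denominator; simp add: algebra_simps)
qed

lemma ring_map_fraction_of: "ring_map (localization R S) (\<lambda>x. fraction_of x 1)"
  by (intro ring_map.intro ring_map_axioms.intro cring_localization)
    (simp_all add: fraction_of_closed one_denominator fraction_of_add fraction_of_mult localization_one)

end

text \<open>The properties of \<open>R \<rightarrow> R\<^sub>a\<close> on which the proof rests: its kernel and the clearing of denominators.\<close>

lemma (in ring_map) ring_map_localization_powers:
  assumes surj: "\<And>r. r \<in> carrier R \<Longrightarrow> \<exists>x. \<psi> x = r" and a: "\<psi> \<alpha> = a"
  defines "L \<equiv> localization R (powers R a)" and "\<phi> \<equiv> \<lambda>x. fraction R (powers R a) (\<psi> x) \<one>"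
  shows "ring_map L \<phi>"
    and "\<phi> x = \<zero>\<^bsub>L\<^esub> \<longleftrightarrow> (\<exists>k. \<psi> (\<alpha> ^ k * x) = \<zero>)"
    and "z \<in> carrier L \<Longrightarrow> \<exists>k c. \<phi> (\<alpha> ^ k) \<otimes>\<^bsub>L\<^esub> z = \<phi> c"
proof -
  have pow: "\<psi> (\<alpha> ^ k) = a [^] k" for k :: nat
    by (induction k) (simp_all add: map_one map_mult a m_comm flip: a)
  have mem: "s \<in> powers R a \<longleftrightarrow> (\<exists>k. s = \<psi> (\<alpha> ^ k))" for s
    by (auto simp: powers_def pow)
  interpret L: ring_map_localization R \<psi> "powers R a"
  proof (unfold_locales)
    show "powers R a \<subseteq> carrier R" by (auto simp: mem)
    show "\<one> \<in> powers R a" unfolding mem by (rule exI[of _ 0]) (simp add: map_one)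
    show "s \<otimes> t \<in> powers R a" if "s \<in> powers R a" "t \<in> powers R a" for s t
      using that unfolding mem by (auto simp flip: map_mult power_add)
  qed (rule surj)
  have \<phi>: "\<phi> = (\<lambda>x. L.fraction_of x 1)"
    by (simp add: fun_eq_iff \<phi>_def L.fraction_of_def map_one)
  show "ring_map L \<phi>" unfolding L_def \<phi> by (rule L.ring_map_fraction_of)
  have "\<phi> x = \<zero>\<^bsub>L\<^esub> \<longleftrightarrow> (\<exists>t. \<psi> t \<in> powers R a \<and> \<psi> (t * x) = \<zero>)"
    unfolding \<phi> L_def L.localization_zero
    using L.fraction_of_eq_iff[OF L.one_denominator L.one_denominator] by simp
  also have "\<dots> \<longleftrightarrow> (\<exists>k. \<psi> (\<alpha> ^ k * x) = \<zero>)"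
    by (auto simp: mem map_mult)
  finally show "\<phi> x = \<zero>\<^bsub>L\<^esub> \<longleftrightarrow> (\<exists>k. \<psi> (\<alpha> ^ k * x) = \<zero>)" .
  show "\<exists>k c. \<phi> (\<alpha> ^ k) \<otimes>\<^bsub>L\<^esub> z = \<phi> c" if "z \<in> carrier L"
  proof -
    have "z \<in> {L.fraction_of x y |x y. \<psi> y \<in> powers R a}"
      using that unfolding L_def L.carrier_localization .
    then obtain x y where z: "z = L.fraction_of x y" "\<psi> y \<in> powers R a" by blast
    then obtain k where k: "\<psi> y = \<psi> (\<alpha> ^ k)" by (auto simp: mem)
    have "\<phi> (\<alpha> ^ k) \<otimes>\<^bsub>L\<^esub> z = L.fraction_of (\<alpha> ^ k * x) y"
      unfolding \<phi> L_def z by (simp add: L.fraction_of_mult L.one_denominator z)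
    also have "\<dots> = L.fraction_of x 1"
      unfolding L.fraction_of_eq_iff[OF z(2) L.one_denominator]
      by (rule exI[of _ 1]) (simp add: L.one_denominator map_diff map_mult k m_comm)
    finally show ?thesis unfolding \<phi> by blast
  qed
qed

lemma (in ring_map) ring_map_quotient:
  assumes surj: "\<And>r. r \<in> carrier R \<Longrightarrow> \<exists>x. \<psi> x = r" and a: "\<psi> \<alpha> = a"
  defines "Q \<equiv> R Quot (PIdl a)" and "\<phi> \<equiv> \<lambda>x. PIdl a +> \<psi> x"
  shows "ring_map Q \<phi>"
    and "\<phi> x = \<zero>\<^bsub>Q\<^esub> \<longleftrightarrow> (\<exists>d. \<psi> (x - \<alpha> * d) = \<zero>)"
    and "z \<in> carrier Q \<Longrightarrow> \<exists>c. \<phi> c = z"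
proof -
  have aR: "a \<in> carrier R" using a by auto
  interpret I: ideal "PIdl a" R by (rule cgenideal_ideal[OF aR])
  have hom: "(+>) (PIdl a) \<in> Ring.ring_hom R Q" unfolding Q_def by (rule I.rcos_ring_hom)
  show "ring_map Q \<phi>"
  proof (intro ring_map.intro ring_map_axioms.intro)
    show "cring Q" unfolding Q_def by (rule I.quotient_is_cring[OF cring_axioms])
    show "\<phi> x \<in> carrier Q" for x
      unfolding \<phi>_def using ring_hom_closed[OF hom] by simp
    show "\<phi> (x + y) = \<phi> x \<oplus>\<^bsub>Q\<^esub> \<phi> y" "\<phi> (x * y) = \<phi> x \<otimes>\<^bsub>Q\<^esub> \<phi> y" for x y
      unfolding \<phi>_def by (simp_all add: map_add map_mult ring_hom_add[OF hom] ring_hom_mult[OF hom])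
    show "\<phi> 1 = \<one>\<^bsub>Q\<^esub>"
      unfolding \<phi>_def by (simp add: map_one ring_hom_one[OF hom])
  qed
  have "\<phi> x = \<zero>\<^bsub>Q\<^esub> \<longleftrightarrow> \<psi> x \<in> PIdl a"
  proof -
    have "\<zero>\<^bsub>Q\<^esub> = PIdl a" by (simp add: Q_def FactRing_def)
    moreover have "PIdl a +> \<psi> x = PIdl a \<longleftrightarrow> \<psi> x \<in> PIdl a"
      using a_coset_join1[OF _ map_closed I.a_subgroup] a_coset_join2[OF map_closed I.a_subgroup]
      by (rule iffI)
    ultimately show ?thesis by (simp only: \<phi>_def)
  qed
  also have "\<dots> \<longleftrightarrow> (\<exists>d. \<psi> x = \<psi> (\<alpha> * d))"
  proof -
    have "\<psi> x \<in> PIdl a \<longleftrightarrow> (\<exists>r\<in>carrier R. \<psi> x = r \<otimes> a)"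
      unfolding cgenideal_def by blast
    also have "\<dots> \<longleftrightarrow> (\<exists>d. \<psi> x = \<psi> d \<otimes> a)"
    proof
      assume "\<exists>r\<in>carrier R. \<psi> x = r \<otimes> a"
      then obtain r where r: "r \<in> carrier R" "\<psi> x = r \<otimes> a" ..
      obtain d where "\<psi> d = r" using surj[OF r(1)] ..
      then show "\<exists>d. \<psi> x = \<psi> d \<otimes> a" using r(2) by (intro exI[of _ d]) simp
    next
      assume "\<exists>d. \<psi> x = \<psi> d \<otimes> a"
      then obtain d where "\<psi> x = \<psi> d \<otimes> a" ..
      then show "\<exists>r\<in>carrier R. \<psi> x = r \<otimes> a" by (rule bexI[OF _ map_closed])
    qed
    finally show ?thesis by (simp add: map_mult a m_comm[OF aR])
  qed
  finally show "\<phi> x = \<zero>\<^bsub>Q\<^esub> \<longleftrightarrow> (\<exists>d. \<psi> (x - \<alpha> * d) = \<zero>)"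
    unfolding map_diff_zero_iff .
  show "\<exists>c. \<phi> c = z" if z: "z \<in> carrier Q"
  proof -
    have "z \<in> (\<Union>r\<in>carrier R. {PIdl a +> r})"
      using z by (simp add: Q_def FactRing_def A_RCOSETS_def')
    then obtain r where r: "r \<in> carrier R" "z = PIdl a +> r" by blast
    obtain c where "\<psi> c = r" using surj[OF r(1)] ..
    then show ?thesis unfolding \<phi>_def using r(2) by (intro exI[of _ c]) simp
  qed
qed

lemma (in ring_map) invertible_of_rationals:
  assumes surj: "\<And>r. r \<in> carrier R \<Longrightarrow> \<exists>x. \<psi> x = r" and rat: "contains_rationals R"
    and k: "(k::nat) > 0"
  shows "\<exists>c. \<psi> (of_nat k * c) = \<one>"
proof -
  obtain h where h: "h \<in> Ring.ring_hom (ring_of_type_algebra :: rat ring) R"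
    using rat by (auto simp: contains_rationals_def)
  have h_add: "h (x + y) = h x \<oplus> h y" and h_mult: "h (x * y) = h x \<otimes> h y" for x y
    using ring_hom_add[OF h, of x y] ring_hom_mult[OF h, of x y]
    by (simp_all add: ring_of_type_algebra_def)
  have h_closed: "h x \<in> carrier R" for x
    using ring_hom_closed[OF h, of x] by (simp add: ring_of_type_algebra_def)
  have h_one: "h 1 = \<one>" using ring_hom_one[OF h] by (simp add: ring_of_type_algebra_def)
  interpret h: ring_map R h
    by (intro ring_map.intro ring_map_axioms.intro cring_axioms h_add h_mult h_closed h_one)
  have nat: "h (of_nat k) = \<psi> (of_nat k)" for k
    by (induction k) (simp_all add: h.map_zero map_zero h_add map_add h_one map_one)
  obtain c where c: "\<psi> c = h (1 / of_nat k)" using surj h_closed by blast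
  have "\<psi> (of_nat k * c) = h (of_nat k * (1 / of_nat k))"
    by (simp only: map_mult h_mult c nat)
  also have "\<dots> = \<one>" using k by (simp add: h_one)
  finally show ?thesis by blast
qed

section \<open>Generators of a coordinate system\<close>

lemma const_power: "const b ^ k = const (b ^ k)"
  by (induction k) (simp_all add: const_mult)

lemma mpoly_ring_const_mult:
  assumes "cring R" "r \<in> carrier R" "s \<in> carrier R"
  shows "ring.indexed_const R r \<otimes>\<^bsub>mpoly_ring R n\<^esub> ring.indexed_const R s =
    ring.indexed_const R (r \<otimes>\<^bsub>R\<^esub> s)"
proof -
  interpret ring_map R "ring_component R" by (rule ring_map_component[OF assms(1)])
  obtain x y where xy: "r = ring_component R x" "s = ring_component R y"
    using ring_component_surj assms by metis
  show ?thesis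
    unfolding xy map_mult[symmetric] poly_map_const[of n, symmetric] const_mult[symmetric] poly_map_mult ..
qed

text \<open>
  The generator is the image of the variable. An arbitrary subring \<open>Z\<close> takes the place of the ring
  of polynomials in \<open>g\<close>, so that \<open>Z\<close> can be chosen to allow denominators.
\<close>

lemma polynomial_algebra_generator:
  assumes "cring M" and alg: "polynomial_algebra_over M S 1"
  shows "\<exists>g\<in>carrier M. \<forall>Z. subring Z M \<longrightarrow> S \<subseteq> Z \<longrightarrow> g \<in> Z \<longrightarrow> Z = carrier M"
proof -
  interpret cring M by fact
  let ?T = "M\<lparr>carrier := S\<rparr>"
  obtain h where S: "subring S M" and h: "h \<in> ring_iso (mpoly_ring ?T 1) M"
    and h_const: "\<And>s. s \<in> S \<Longrightarrow> h (ring.indexed_const ?T s) = s"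
    using alg unfolding polynomial_algebra_over_def by blast
  have hom: "h \<in> Ring.ring_hom (mpoly_ring ?T 1) M"
    using h by (simp add: ring_iso_def)
  have surj: "h ` carrier (mpoly_ring ?T 1) = carrier M"
    using h by (simp add: ring_iso_def bij_betw_def)
  have T: "cring ?T"
    using subcring_iff[OF subringE(1)[OF S]] subcringI'[OF S] by simp
  interpret T: cring ?T by (rule T)
  let ?X = "T.indexed_var 0"
  have X: "?X \<in> carrier (mpoly_ring ?T 1)"
    by (rule mpoly_ring_pmult(2)[OF T cring.cring_simprules(6)[OF cring_mpoly_ring[OF T]]]) simp
  have in_Z: "h q \<in> Z" if Z: "subring Z M" "S \<subseteq> Z" "h ?X \<in> Z"
    and q: "q \<in> T.indexed_pset {..<1::nat} (carrier ?T)" for Z q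
    using q
  proof (induction rule: T.indexed_pset.induct)
    case (indexed_const s)
    then show ?case using h_const Z by auto
  next
    case (indexed_padd P Q)
    then have "h (P \<oplus>\<^bsub>mpoly_ring ?T 1\<^esub> Q) = h P \<oplus>\<^bsub>M\<^esub> h Q"
      by (intro ring_hom_add[OF hom]) (simp_all add: mpoly_ring_simps)
    then show ?case
      using indexed_padd subringE(7)[OF Z(1)] by (simp add: mpoly_ring_simps)
  next
    case (indexed_pmult P i)
    then have i: "i = 0" and P: "P \<in> carrier (mpoly_ring ?T 1)" by (simp_all add: mpoly_ring_simps)
    have "h (P \<otimes>\<^bsub>mpoly_ring ?T 1\<^esub> ?X) = h P \<otimes>\<^bsub>M\<^esub> h ?X"
      by (rule ring_hom_mult[OF hom P X])
    moreover have "T.indexed_pmult P i = P \<otimes>\<^bsub>mpoly_ring ?T 1\<^esub> ?X"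
      unfolding i by (rule mpoly_ring_pmult(1)[OF T P]) simp
    moreover have "h P \<otimes>\<^bsub>M\<^esub> h ?X \<in> Z"
      by (rule subringE(6)[OF Z(1) indexed_pmult.IH Z(3)])
    ultimately show ?case by simp
  qed
  have gen: "Z = carrier M" if Z: "subring Z M" "S \<subseteq> Z" "h ?X \<in> Z" for Z
  proof (rule equalityI[OF subringE(1)[OF Z(1)] subsetI])
    fix y assume "y \<in> carrier M"
    then obtain q where q: "q \<in> carrier (mpoly_ring ?T 1)" "y = h q"
      unfolding surj[symmetric] by (rule imageE)
    show "y \<in> Z" unfolding q(2) by (rule in_Z[OF Z q(1)[unfolded mpoly_ring_simps(1)]])
  qed
  have "h ?X \<in> carrier M" unfolding surj[symmetric] using X by (rule imageI)
  then show ?thesis by (rule bexI[rotated]) (intro allI impI gen)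
qed

text \<open>
  A partial coordinate system of colength 1 over \<open>R\<close>, lifted along \<open>\<psi>\<close>. If \<open>\<psi>\<close> is surjective only
  up to powers of \<open>\<psi> b\<close>, as for a localization, the elements of \<open>S[g]\<close> are reached after
  multiplication by such powers: \<open>Z\<close> below collects the elements for which this is so, and it is a
  subring that contains all generators.
\<close>

lemma coordinate_system_generator:
  fixes \<psi> :: "'f::comm_ring_1 \<Rightarrow> 'c" and R :: "('c, 'd) ring_scheme" (structure)
    and F :: "nat \<Rightarrow> 'f multipoly"
  assumes "ring_map R \<psi>"
    and denom: "\<And>r. r \<in> carrier R \<Longrightarrow> \<exists>k c. \<psi> (b ^ k) \<otimes>\<^bsub>R\<^esub> r = \<psi> c"
    and n: "1 \<le> n" and sys: "partial_coordinate_system R n (n - 1) f"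
    and F: "\<And>i. i < n - 1 \<Longrightarrow> f i = poly_map R \<psi> n (F i)"
  shows "\<exists>g. \<forall>x. \<exists>k. \<exists>p\<in>polys_over (subalgebra (n - 1) F).
    poly_map R \<psi> n (const b ^ k * x) = poly_map R \<psi> n (poly p g)"
proof -
  interpret ring_map R \<psi> by fact
  let ?M = "mpoly_ring R n" and ?\<Phi> = "poly_map R \<psi> n"
  let ?S = "subalgebra (n - 1) F"
  interpret \<Phi>: ring_map ?M ?\<Phi> by (rule ring_map_poly_map)
  interpret S: derivation_with_constants "jacobian n F" ?S by (rule derivation_jacobian[OF n])
  have denom_M: "\<exists>k x. ?\<Phi> (const b ^ k) \<otimes>\<^bsub>?M\<^esub> z = ?\<Phi> x" if "z \<in> carrier ?M" for z
    using that unfolding mpoly_ring_simps(1)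
  proof (induction rule: indexed_pset.induct)
    case (indexed_const r)
    then obtain k c where kc: "\<psi> (b ^ k) \<otimes> r = \<psi> c" using denom by blast
    have "?\<Phi> (const b ^ k) \<otimes>\<^bsub>?M\<^esub> indexed_const r = ?\<Phi> (const c)"
      using mpoly_ring_const_mult[OF cring_axioms map_closed[of "b ^ k"] indexed_const, of n]
      by (simp add: const_power poly_map_const kc)
    then show ?case by blast
  next
    case (indexed_padd P Q)
    then obtain k x l y where x: "?\<Phi> (const b ^ k) \<otimes>\<^bsub>?M\<^esub> P = ?\<Phi> x"
      and y: "?\<Phi> (const b ^ l) \<otimes>\<^bsub>?M\<^esub> Q = ?\<Phi> y" by blast
    have PQ: "P \<in> carrier ?M" "Q \<in> carrier ?M" using indexed_padd by (simp_all add: mpoly_ring_simps)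
    have "?\<Phi> (const b ^ (k + l)) \<otimes>\<^bsub>?M\<^esub> (P \<oplus>\<^bsub>?M\<^esub> Q) =
      ?\<Phi> (const b ^ l) \<otimes>\<^bsub>?M\<^esub> (?\<Phi> (const b ^ k) \<otimes>\<^bsub>?M\<^esub> P) \<oplus>\<^bsub>?M\<^esub>
      ?\<Phi> (const b ^ k) \<otimes>\<^bsub>?M\<^esub> (?\<Phi> (const b ^ l) \<otimes>\<^bsub>?M\<^esub> Q)"
      using PQ by (simp add: power_add \<Phi>.map_mult \<Phi>.r_distr \<Phi>.l_distr \<Phi>.m_ac)
    also have "\<dots> = ?\<Phi> (const b ^ l * x + const b ^ k * y)"
      by (simp only: x y \<Phi>.map_mult \<Phi>.map_add)
    finally show ?case unfolding mpoly_ring_simps by blast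
  next
    case (indexed_pmult P i)
    then obtain k x where x: "?\<Phi> (const b ^ k) \<otimes>\<^bsub>?M\<^esub> P = ?\<Phi> x" by blast
    have P: "P \<in> carrier ?M" "i < n" using indexed_pmult by (simp_all add: mpoly_ring_simps)
    have X: "indexed_var i \<in> carrier ?M" by (rule mpoly_ring_pmult(2)[OF cring_axioms P])
    have v: "indexed_var i = ?\<Phi> (var i)"
      using poly_map_monomial_var[OF P(2), of 1] poly_map_const[of n 1]
      by (simp add: indexed_var_def map_one)
    have "?\<Phi> (const b ^ k) \<otimes>\<^bsub>?M\<^esub> indexed_pmult P i = ?\<Phi> (x * var i)"
      unfolding mpoly_ring_pmult(1)[OF cring_axioms P] \<Phi>.map_mult x[symmetric] v[symmetric]
      using P X by (simp add: \<Phi>.m_assoc)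
    then show ?case by blast
  qed
  have "polynomial_algebra_over ?M (subalgebra_generated R n (f ` {..<n - 1})) 1"
    using sys n by (simp add: partial_coordinate_system_def)
  from polynomial_algebra_generator[OF \<Phi>.cring_axioms this] obtain z where z: "z \<in> carrier ?M"
    and gen: "\<And>Z. subring Z ?M \<Longrightarrow> subalgebra_generated R n (f ` {..<n - 1}) \<subseteq> Z \<Longrightarrow> z \<in> Z \<Longrightarrow>
      Z = carrier ?M" by blast
  obtain k0 g where g: "?\<Phi> (const b ^ k0) \<otimes>\<^bsub>?M\<^esub> z = ?\<Phi> g" using denom_M[OF z] by blast
  define Z where "Z = {y \<in> carrier ?M. \<exists>k. \<exists>p\<in>polys_over ?S. ?\<Phi> (const b ^ k) \<otimes>\<^bsub>?M\<^esub> y = ?\<Phi> (poly p g)}"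
  have Z_image: "?\<Phi> x \<in> Z" if "x \<in> ?S" for x
    unfolding Z_def using that S.polys_over_const[OF that]
    by (auto intro!: exI[of _ 0] bexI[of _ "[:x:]"] simp: \<Phi>.map_one)
  have "subring Z ?M"
  proof (rule \<Phi>.subringI)
    show "Z \<subseteq> carrier ?M" by (auto simp: Z_def)
    show "\<one>\<^bsub>?M\<^esub> \<in> Z" using Z_image[OF S.one_S] by (simp add: \<Phi>.map_one)
  next
    fix y assume "y \<in> Z"
    then obtain k p where y: "y \<in> carrier ?M" "p \<in> polys_over ?S"
      "?\<Phi> (const b ^ k) \<otimes>\<^bsub>?M\<^esub> y = ?\<Phi> (poly p g)" by (auto simp: Z_def)
    have "?\<Phi> (const b ^ k) \<otimes>\<^bsub>?M\<^esub> (\<ominus>\<^bsub>?M\<^esub> y) = ?\<Phi> (poly (- p) g)"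
      using y by (simp add: \<Phi>.r_minus \<Phi>.map_uminus)
    then show "\<ominus>\<^bsub>?M\<^esub> y \<in> Z" unfolding Z_def using y S.polys_over_uminus by blast
  next
    fix y y' assume "y \<in> Z" "y' \<in> Z"
    then obtain k p l q where y: "y \<in> carrier ?M" "p \<in> polys_over ?S"
      "?\<Phi> (const b ^ k) \<otimes>\<^bsub>?M\<^esub> y = ?\<Phi> (poly p g)"
      and y': "y' \<in> carrier ?M" "q \<in> polys_over ?S"
      "?\<Phi> (const b ^ l) \<otimes>\<^bsub>?M\<^esub> y' = ?\<Phi> (poly q g)" by (auto simp: Z_def)
    have "?\<Phi> (const b ^ (k + l)) \<otimes>\<^bsub>?M\<^esub> (y \<otimes>\<^bsub>?M\<^esub> y') =
      (?\<Phi> (const b ^ k) \<otimes>\<^bsub>?M\<^esub> y) \<otimes>\<^bsub>?M\<^esub> (?\<Phi> (const b ^ l) \<otimes>\<^bsub>?M\<^esub> y')"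
      using y(1) y'(1) by (simp add: power_add \<Phi>.map_mult \<Phi>.m_ac)
    also have "\<dots> = ?\<Phi> (poly (p * q) g)"
      by (simp only: y y' poly_mult \<Phi>.map_mult)
    finally show "y \<otimes>\<^bsub>?M\<^esub> y' \<in> Z"
      unfolding Z_def using y y' S.polys_over_mult \<Phi>.m_closed by blast
    have "?\<Phi> (const b ^ (k + l)) \<otimes>\<^bsub>?M\<^esub> (y \<oplus>\<^bsub>?M\<^esub> y') =
      ?\<Phi> (const b ^ l) \<otimes>\<^bsub>?M\<^esub> (?\<Phi> (const b ^ k) \<otimes>\<^bsub>?M\<^esub> y) \<oplus>\<^bsub>?M\<^esub>
      ?\<Phi> (const b ^ k) \<otimes>\<^bsub>?M\<^esub> (?\<Phi> (const b ^ l) \<otimes>\<^bsub>?M\<^esub> y')"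
      using y(1) y'(1) by (simp add: power_add \<Phi>.map_mult \<Phi>.r_distr \<Phi>.l_distr \<Phi>.m_ac)
    also have "\<dots> = ?\<Phi> (poly (smult (const b ^ l) p + smult (const b ^ k) q) g)"
      by (simp only: y y' \<Phi>.map_mult \<Phi>.map_add poly_add poly_smult)
    finally show "y \<oplus>\<^bsub>?M\<^esub> y' \<in> Z"
      unfolding Z_def
      using y y' S.polys_over_add S.polys_over_smult[OF S.S_power[OF const_subalgebra]] \<Phi>.a_closed
      by blast
  qed
  moreover have "z \<in> Z"
    unfolding Z_def using z g S.polys_over_var by (auto intro!: exI[of _ k0] bexI[of _ "[:0, 1:]"])
  moreover have "subalgebra_generated R n (f ` {..<n - 1}) \<subseteq> Z"
    unfolding subalgebra_generated_def
  proof (rule \<Phi>.generate_ring_min_subring1[OF _ \<open>subring Z ?M\<close>])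
    show sub: "indexed_const ` carrier R \<union> f ` {..<n - 1} \<subseteq> Z"
    proof
      fix y assume "y \<in> indexed_const ` carrier R \<union> f ` {..<n - 1}"
      then consider (const) r where "r \<in> carrier R" "y = indexed_const r"
        | (gen) i where "i < n - 1" "y = f i" by blast
      then show "y \<in> Z"
      proof cases
        case const
        then obtain k c where kc: "\<psi> (b ^ k) \<otimes> r = \<psi> c" using denom by blast
        have "?\<Phi> (const b ^ k) \<otimes>\<^bsub>?M\<^esub> indexed_const r = ?\<Phi> (poly [:const c:] g)"
          using mpoly_ring_const_mult[OF cring_axioms map_closed[of "b ^ k"] const(1), of n]
          by (simp add: const_power poly_map_const kc)
        moreover have "[:const c:] \<in> polys_over ?S" by (intro S.polys_over_const const_subalgebra)
        moreover have "y \<in> carrier ?M" unfolding const mpoly_ring_simps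
          by (rule indexed_pset.indexed_const[OF const(1)])
        ultimately show ?thesis unfolding Z_def using const by blast
      next
        case gen
        then show ?thesis using Z_image[OF generator_subalgebra[OF gen(1)]] F by simp
      qed
    qed
    then show "indexed_const ` carrier R \<union> f ` {..<n - 1} \<subseteq> carrier ?M"
      by (auto simp: Z_def)
  qed
  ultimately have "Z = carrier ?M" using gen by blast
  then have "\<exists>k. \<exists>p\<in>polys_over ?S. ?\<Phi> (const b ^ k) \<otimes>\<^bsub>?M\<^esub> ?\<Phi> x = ?\<Phi> (poly p g)" for x
    using \<Phi>.map_closed[of x] unfolding Z_def by blast
  then show ?thesis unfolding \<Phi>.map_mult by blast
qed

section \<open>Kernels of coefficient maps\<close>

context ring_map
begin

definition poly_kernel :: "nat \<Rightarrow> 'f multipoly set"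
  where "poly_kernel n = {x. poly_map R \<psi> n x = \<zero>\<^bsub>mpoly_ring R n\<^esub>}"

lemma mem_poly_kernel_iff: "x \<in> poly_kernel n \<longleftrightarrow> (\<forall>m. set_mset m \<subseteq> {..<n} \<longrightarrow> \<psi> (mcoeff x m) = \<zero>)"
  unfolding poly_kernel_def mem_Collect_eq poly_map_eq_zero_iff ..

lemma diff_mem_poly_kernel_iff: "x - y \<in> poly_kernel n \<longleftrightarrow> poly_map R \<psi> n x = poly_map R \<psi> n y"
proof -
  interpret \<Phi>: ring_map "mpoly_ring R n" "poly_map R \<psi> n" by (rule ring_map_poly_map)
  show ?thesis by (simp add: poly_kernel_def \<Phi>.map_diff_zero_iff)
qed

lemma const_mem_poly_kernel_iff: "const c \<in> poly_kernel n \<longleftrightarrow> \<psi> c = \<zero>"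
proof
  assume "const c \<in> poly_kernel n"
  from this[unfolded mem_poly_kernel_iff, rule_format, of "{#}"] show "\<psi> c = \<zero>" by simp
qed (auto simp: mem_poly_kernel_iff lookup_single when_def map_zero)

lemma ring_ideal_kernel: "ring_ideal (poly_kernel n)"
proof -
  interpret \<Phi>: ring_map "mpoly_ring R n" "poly_map R \<psi> n" by (rule ring_map_poly_map)
  show ?thesis unfolding poly_kernel_def by (rule \<Phi>.ideal_kernel)
qed

lemma partial_derivative_mem_kernel:
  "j < n \<Longrightarrow> x \<in> poly_kernel n \<Longrightarrow> partial_derivative j x \<in> poly_kernel n"
  unfolding poly_kernel_def using partial_derivative_kernel by blast

context
  fixes n :: nat and F :: "nat \<Rightarrow> 'f multipoly"
  assumes n: "1 \<le> n" and inverse: "\<And>k. k > 0 \<Longrightarrow> \<exists>c. \<psi> (of_nat k * c) = \<one>"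
begin

lemma differential_ideal_kernel:
  "differential_ideal (jacobian n F) (subalgebra (n - 1) F) (poly_kernel n)"
proof (intro differential_ideal.intro differential_ideal_axioms.intro)
  show "derivation_with_constants (jacobian n F) (subalgebra (n - 1) F)"
    by (rule derivation_jacobian[OF n])
  show "ring_ideal (poly_kernel n)" by (rule ring_ideal_kernel)
  show "jacobian n F x \<in> poly_kernel n" if "x \<in> poly_kernel n" for x
    using jacobian_mem[OF n ring_ideal_kernel] partial_derivative_mem_kernel that by blast
  show "\<exists>c\<in>subalgebra (n - 1) F. of_nat k * c - 1 \<in> poly_kernel n" if k: "0 < k" for k :: nat
  proof -
    obtain c where c: "\<psi> (of_nat k * c) = \<one>" using inverse[OF k] by blast
    have "of_nat k * const c - 1 = const (of_nat k * c - 1)"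
      by (simp add: const_of_nat_mult' single_diff)
    also have "\<dots> \<in> poly_kernel n"
      unfolding const_mem_poly_kernel_iff by (simp add: map_diff c map_one)
    finally show ?thesis using const_subalgebra by blast
  qed
qed

lemma local_ideal_kernel:
  assumes saturated: "\<And>x. \<psi> (b * x) = \<zero> \<Longrightarrow> \<psi> x = \<zero>"
  shows "local_ideal (jacobian n F) (subalgebra (n - 1) F) (poly_kernel n) (const b)"
proof (intro local_ideal.intro local_ideal_axioms.intro differential_ideal_kernel const_subalgebra)
  show "x \<in> poly_kernel n" if "const b * x \<in> poly_kernel n" for x
    using that saturated by (simp add: mem_poly_kernel_iff lookup_const_mult)
qed

lemma local_generator_kernel:
  assumes saturated: "\<And>x. \<psi> (b * x) = \<zero> \<Longrightarrow> \<psi> x = \<zero>"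
    and gen: "\<And>x. \<exists>k. \<exists>p\<in>polys_over (subalgebra (n - 1) F).
      poly_map R \<psi> n (const b ^ k * x) = poly_map R \<psi> n (poly p g)"
  shows "\<exists>u k. local_generator (jacobian n F) (subalgebra (n - 1) F) (poly_kernel n) (const b) g u k"
proof -
  have gen': "\<exists>k. \<exists>p\<in>polys_over (subalgebra (n - 1) F). const b ^ k * x - poly p g \<in> poly_kernel n" for x
    using gen unfolding diff_mem_poly_kernel_iff .
  obtain u k where "u * jacobian n F g - const b ^ k \<in> poly_kernel n"
    using jacobian_unit[OF n ring_ideal_kernel partial_derivative_mem_kernel
        partial_derivative_const gen'] by blast
  then have "local_generator (jacobian n F) (subalgebra (n - 1) F) (poly_kernel n) (const b) g u k"
    by (intro local_generator.intro local_generator_axioms.intro local_ideal_kernel[OF saturated] gen')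
  then show ?thesis by blast
qed

text \<open>Algebraic independence of the \<open>F i\<close> over the image of \<open>\<psi>\<close>.\<close>

lemma coefficient_mem_kernel:
  assumes u: "u * jacobian n F g - 1 \<in> poly_kernel n"
    and p: "p \<in> vars_below (n - 1)" "substitute F p \<in> poly_kernel n"
  shows "\<psi> (mcoeff p m) = \<zero>"
proof -
  interpret K: differential_ideal "jacobian n F" "subalgebra (n - 1) F" "poly_kernel n"
    by (rule differential_ideal_kernel)
  define P where "P i E \<longleftrightarrow> (\<forall>x y. E (x + y) = E x + E y) \<and>
    (\<forall>x y. E (x * y) = E x * y + x * E y) \<and> (\<forall>c. E (const c) = 0) \<and> (\<forall>x\<in>poly_kernel n. E x \<in> poly_kernel n) \<and>
    (\<forall>k<n - 1. E (F k) - (if k = i then 1 else 0) \<in> poly_kernel n)" for i E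
  have "\<exists>E. P i E" if "i < n - 1" for i
    unfolding P_def
    by (rule dual_derivations[OF n ring_ideal_kernel partial_derivative_mem_kernel u that])
  then have "\<forall>i. \<exists>E. i < n - 1 \<longrightarrow> P i E" by blast
  from choice[OF this] obtain E where E: "\<And>i. i < n - 1 \<Longrightarrow> P i (E i)" by blast
  have "const (mcoeff p m) \<in> poly_kernel n"
  proof (rule algebraic_independence_mod[OF ring_ideal_kernel _ _ _ _ _ _ p])
    fix i assume "i < n - 1"
    then have Ei: "P i (E i)" by (rule E)
    show "E i (x + y) = E i x + E i y" "E i (x * y) = E i x * y + x * E i y" "E i (const c) = 0"
      for x y c
      using Ei unfolding P_def by blast+
    show "E i x \<in> poly_kernel n" if "x \<in> poly_kernel n" for x
      using Ei that unfolding P_def by blast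
    show "E i (F k) - (if k = i then 1 else 0) \<in> poly_kernel n" if "k < n - 1" for k
      using Ei that unfolding P_def by blast
  qed (rule K.cancel_nat)
  then show ?thesis by (simp add: const_mem_poly_kernel_iff)
qed

end

text \<open>
  A polynomial killed by \<open>a\<close> has coefficients killed by \<open>a\<close>. Monomials that involve a variable
  from \<open>n\<close> on lie in the kernel and are dropped.
\<close>

lemma torsion_kernel:
  assumes y: "const a * y \<in> poly_kernel n"
  shows "\<exists>N z w. (\<forall>i<N::nat. z i \<in> subalgebra k F \<and> const a * z i \<in> poly_kernel n) \<and>
    y - (\<Sum>i<N. z i * w i) \<in> poly_kernel n"
proof -
  obtain e where e: "bij_betw e {..<card (support y)} (support y)"
    using ex_bij_betw_nat_finite[OF finite_keys[of y]] by (auto simp: atLeast0LessThan)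
  define c where "c m = (if set_mset m \<subseteq> {..<n} then mcoeff y m else 0)" for m
  have ac: "\<psi> (a * c m) = \<zero>" for m
    using y by (auto simp: c_def mem_poly_kernel_iff lookup_const_mult map_zero)
  have "(\<Sum>i<card (support y). const (c (e i)) * monomial (e i) 1) =
      (\<Sum>m\<in>support y. const (c m) * monomial m 1)"
    by (rule sum.reindex_bij_betw[OF e])
  also have "\<dots> = (\<Sum>m\<in>support y. monomial m (c m))"
    by (simp add: monomial_mult)
  finally have eq: "(\<Sum>i<card (support y). const (c (e i)) * monomial (e i) 1) =
    (\<Sum>m\<in>support y. monomial m (c m))" .
  have "mcoeff (\<Sum>m\<in>support y. monomial m (c m)) m = (if m \<in> support y then c m else 0)" for m
    by (simp add: lookup_sum lookup_single when_def)
  then have "y - (\<Sum>i<card (support y). const (c (e i)) * monomial (e i) 1) \<in> poly_kernel n"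
    unfolding eq by (auto simp: mem_poly_kernel_iff lookup_minus c_def map_zero in_keys_iff)
  moreover have "const a * const (c m) \<in> poly_kernel n" for m
    unfolding const_mult const_mem_poly_kernel_iff by (rule ac)
  ultimately show ?thesis
    by (intro exI[of _ "card (support y)"] exI[of _ "\<lambda>i. const (c (e i))"]
        exI[of _ "\<lambda>i. monomial (e i) 1"]) (auto intro: const_subalgebra)
qed

text \<open>
  If the coefficients of \<open>p\<close> are divisible by \<open>a\<close> then \<open>p(F)\<close> is \<open>a\<close> times an element of the
  subalgebra generated by \<open>F\<close>.
\<close>

lemma lift_constants:
  assumes p: "\<And>m. \<exists>d. \<psi> (mcoeff p m - a * d) = \<zero>" and pv: "p \<in> vars_below N"
  shows "\<exists>t\<in>subalgebra N F. substitute F p - const a * t \<in> poly_kernel n"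
proof -
  interpret K: ring_ideal "poly_kernel n" by (rule ring_ideal_kernel)
  from p have "\<forall>m. \<exists>d. \<psi> (mcoeff p m - a * d) = \<zero>" ..
  from choice[OF this] obtain d where d: "\<And>m. \<psi> (mcoeff p m - a * d m) = \<zero>" by blast
  define q where "q = (\<Sum>m\<in>support p. monomial m (d m))"
  have cq: "mcoeff q m = (if m \<in> support p then d m else 0)" for m
    by (simp add: q_def lookup_sum lookup_single when_def)
  then have sq: "support q \<subseteq> support p" by (auto simp: in_keys_iff split: if_splits)
  have "substitute F p - const a * substitute F q =
      (\<Sum>m\<in>support p. const (mcoeff p m - a * d m) * (\<Prod>i\<in>#m. F i))"
    unfolding substitute_expand[OF finite_keys sq] substitute_expand[OF finite_keys order.refl[of "support p"]]
    by (simp add: cq sum_distrib_left sum_subtractf single_diff left_diff_distrib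
        flip: const_mult mult.assoc)
  also have "\<dots> \<in> poly_kernel n"
    using d by (intro K.sum K.mult') (simp add: const_mem_poly_kernel_iff)
  finally have "substitute F p - const a * substitute F q \<in> poly_kernel n" .
  moreover have "q \<in> vars_below N" using pv sq by (auto simp: vars_below_def)
  ultimately show ?thesis unfolding subalgebra_def by blast
qed

end

text \<open>The kernel of \<open>A \<rightarrow> (R/aR)[X]\<close> is \<open>I + aA\<close>.\<close>

lemma (in ring_map) coefficients_divisible_iff:
  "(\<forall>m. set_mset m \<subseteq> {..<n} \<longrightarrow> (\<exists>d. \<psi> (mcoeff x m - a * d) = \<zero>)) \<longleftrightarrow>
    (\<exists>y. x - const a * y \<in> poly_kernel n)"
proof
  assume "\<forall>m. set_mset m \<subseteq> {..<n} \<longrightarrow> (\<exists>d. \<psi> (mcoeff x m - a * d) = \<zero>)"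
  then have "\<forall>m. \<exists>d. set_mset m \<subseteq> {..<n} \<longrightarrow> \<psi> (mcoeff x m - a * d) = \<zero>" by blast
  from choice[OF this] obtain d where
    d: "\<And>m. set_mset m \<subseteq> {..<n} \<Longrightarrow> \<psi> (mcoeff x m - a * d m) = \<zero>" by blast
  define y where "y = (\<Sum>m\<in>support x. monomial m (d m))"
  have "mcoeff y m = (if m \<in> support x then d m else 0)" for m
    by (simp add: y_def lookup_sum lookup_single when_def)
  then have "x - const a * y \<in> poly_kernel n"
    unfolding mem_poly_kernel_iff using d by (auto simp: lookup_minus lookup_const_mult in_keys_iff map_zero)
  then show "\<exists>y. x - const a * y \<in> poly_kernel n" ..
next
  assume "\<exists>y. x - const a * y \<in> poly_kernel n"
  then obtain y where y: "x - const a * y \<in> poly_kernel n" ..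
  show "\<forall>m. set_mset m \<subseteq> {..<n} \<longrightarrow> (\<exists>d. \<psi> (mcoeff x m - a * d) = \<zero>)"
  proof (intro allI impI)
    fix m :: "nat multiset" assume "set_mset m \<subseteq> {..<n}"
    then have "\<psi> (mcoeff (x - const a * y) m) = \<zero>" using y unfolding mem_poly_kernel_iff by simp
    then show "\<exists>d. \<psi> (mcoeff x m - a * d) = \<zero>"
      by (intro exI[of _ "mcoeff y m"]) (simp add: lookup_minus lookup_const_mult)
  qed
qed

text \<open>The kernel of \<open>A \<rightarrow> R\<^sub>a[X]\<close>: finitely many coefficients are killed by one power of \<open>a\<close>.\<close>

lemma (in ring_map) coefficients_torsion_iff:
  "(\<forall>m. set_mset m \<subseteq> {..<n} \<longrightarrow> (\<exists>k. \<psi> (a ^ k * mcoeff x m) = \<zero>)) \<longleftrightarrow>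
    (\<exists>k. const a ^ k * x \<in> poly_kernel n)"
proof
  assume "\<forall>m. set_mset m \<subseteq> {..<n} \<longrightarrow> (\<exists>k. \<psi> (a ^ k * mcoeff x m) = \<zero>)"
  then have "\<forall>m. \<exists>k. set_mset m \<subseteq> {..<n} \<longrightarrow> \<psi> (a ^ k * mcoeff x m) = \<zero>" by blast
  from choice[OF this] obtain k where
    k: "\<And>m. set_mset m \<subseteq> {..<n} \<Longrightarrow> \<psi> (a ^ k m * mcoeff x m) = \<zero>" by blast
  define K where "K = sum k (support x)"
  have "\<psi> (a ^ K * mcoeff x m) = \<zero>" if m: "set_mset m \<subseteq> {..<n}" for m
  proof (cases "m \<in> support x")
    case True
    then have "k m \<le> K" unfolding K_def by (intro member_le_sum) auto
    then have "a ^ K = a ^ (K - k m) * a ^ k m" by (simp flip: power_add)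
    then have "a ^ K * mcoeff x m = a ^ (K - k m) * (a ^ k m * mcoeff x m)"
      by (simp add: mult.assoc)
    then have "\<psi> (a ^ K * mcoeff x m) = \<psi> (a ^ (K - k m)) \<otimes> \<psi> (a ^ k m * mcoeff x m)"
      by (simp only: map_mult)
    then show ?thesis using k[OF m] by simp
  next
    case False
    then show ?thesis by (simp add: in_keys_iff map_zero)
  qed
  then have "const a ^ K * x \<in> poly_kernel n"
    unfolding mem_poly_kernel_iff const_power lookup_const_mult by blast
  then show "\<exists>k. const a ^ k * x \<in> poly_kernel n" ..
next
  assume "\<exists>k. const a ^ k * x \<in> poly_kernel n"
  then show "\<forall>m. set_mset m \<subseteq> {..<n} \<longrightarrow> (\<exists>k. \<psi> (a ^ k * mcoeff x m) = \<zero>)"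
    unfolding mem_poly_kernel_iff const_power lookup_const_mult by blast
qed

section \<open>Recognizing polynomial algebras\<close>

text \<open>
  A generator that is transcendental over a subring presents the ring as a polynomial algebra. Both
  \<open>mpoly_ring\<close> over \<open>\<psi> ` S\<close> in one variable (through \<open>\<Theta>\<close>, on coefficients) and \<open>R\<close> (through evaluation
  at \<open>h\<close>) are images of the polynomials over \<open>S\<close>, with equal kernels; the isomorphism \<open>H\<close> matches them.
\<close>

lemma (in ring_map) polynomial_algebra_over_image:
  assumes "subring_set S"
    and gen: "\<And>x. \<exists>p\<in>polys_over S. \<psi> x = \<psi> (poly p h)"
    and transcendental: "\<And>p i. p \<in> polys_over S \<Longrightarrow> \<psi> (poly p h) = \<zero> \<Longrightarrow> \<psi> (poly.coeff p i) = \<zero>"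
    and surj: "\<And>r. r \<in> carrier R \<Longrightarrow> \<exists>x. \<psi> x = r"
  shows "polynomial_algebra_over R (\<psi> ` S) 1"
proof -
  interpret S: subring_set S by fact
  interpret K: ring_ideal "{x. \<psi> x = \<zero>}" by (rule ideal_kernel)
  let ?T = "R\<lparr>carrier := \<psi> ` S\<rparr>"
  have sub: "subring (\<psi> ` S) R"
    by (rule subringI)
      (auto simp: map_one[symmetric] S.one_S S.S_add S.S_mult S.S_uminus
        simp flip: map_add map_mult map_uminus)
  have T: "cring ?T"
    using subcring_iff[OF subringE(1)[OF sub]] subcringI'[OF sub] by simp
  interpret T: cring ?T by (rule T)
  have T_sum: "finite A \<Longrightarrow> (\<And>k. k \<in> A \<Longrightarrow> f k \<in> S) \<Longrightarrow> (\<Oplus>\<^bsub>?T\<^esub>k\<in>A. \<psi> (f k)) = \<psi> (sum f A)"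
    for A and f :: "nat multiset \<Rightarrow> 'f"
  proof (induction A rule: finite_induct)
    case empty
    show ?case using T.finsum_empty by (simp add: map_zero)
  next
    case (insert k A)
    then have "(\<Oplus>\<^bsub>?T\<^esub>k\<in>insert k A. \<psi> (f k)) = \<psi> (f k) \<oplus> (\<Oplus>\<^bsub>?T\<^esub>k\<in>A. \<psi> (f k))"
      by (subst T.finsum_insert) auto
    then show ?case using insert by (simp add: map_add)
  qed
  define \<Theta> where "\<Theta> p m = (if set_mset m \<subseteq> {..<1::nat} then \<psi> (poly.coeff p (size m)) else \<zero>)"
    for p and m :: "nat multiset"
  have \<Theta>_add: "\<Theta> (p + q) = \<Theta> p \<oplus>\<^bsub>mpoly_ring ?T 1\<^esub> \<Theta> q" for p q
    by (auto simp: \<Theta>_def mpoly_ring_simps T.indexed_padd_def fun_eq_iff map_add)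
  have \<Theta>_const: "\<Theta> [:s:] = T.indexed_const (\<psi> s)" for s
    by (auto simp: \<Theta>_def T.indexed_const_def fun_eq_iff coeff_pCons map_zero split: nat.split)
  have \<Theta>_shift: "\<Theta> (pCons 0 p) = T.indexed_pmult (\<Theta> p) 0" for p
  proof
    fix m
    show "\<Theta> (pCons 0 p) m = T.indexed_pmult (\<Theta> p) 0 m"
    proof (cases "0 \<in># m")
      case True
      then obtain m' where "m = add_mset 0 m'" by (meson multi_member_split)
      then show ?thesis by (simp add: \<Theta>_def T.indexed_pmult_def)
    next
      case False
      then have "set_mset m \<subseteq> {..<1} \<Longrightarrow> m = {#}" by (cases m) auto
      then show ?thesis using False by (auto simp: \<Theta>_def T.indexed_pmult_def map_zero)
    qed
  qed
  have \<Theta>_pCons: "\<Theta> (pCons s p) = T.indexed_padd (T.indexed_const (\<psi> s)) (T.indexed_pmult (\<Theta> p) 0)" for s p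
    using \<Theta>_add[of "[:s:]" "pCons 0 p"] by (simp add: \<Theta>_const \<Theta>_shift mpoly_ring_simps)
  have \<Theta>_closed: "\<Theta> p \<in> carrier (mpoly_ring ?T 1)" if "p \<in> polys_over S" for p
    using that
  proof (induction p)
    case 0
    have "\<Theta> 0 = T.indexed_const \<zero>" using \<Theta>_const[of 0] by (simp add: map_zero)
    then show ?case
      using T.zero_closed unfolding mpoly_ring_simps by (auto intro: T.indexed_pset.indexed_const)
  next
    case (pCons s p)
    have c: "poly.coeff (pCons s p) i \<in> S" for i using pCons.prems by (rule S.polys_overD)
    have "p \<in> polys_over S" using c[of "Suc _"] by (intro S.polys_overI) simp
    then have "\<Theta> p \<in> T.indexed_pset {..<1} (carrier ?T)"
      using pCons.IH by (simp add: mpoly_ring_simps)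
    moreover have "\<psi> s \<in> carrier ?T" using c[of 0] by simp
    ultimately show ?case
      unfolding \<Theta>_pCons mpoly_ring_simps
      by (intro T.indexed_pset.indexed_padd T.indexed_pset.indexed_const T.indexed_pset.indexed_pmult)
        auto
  qed
  have \<Theta>_surj: "\<exists>p\<in>polys_over S. \<Theta> p = y" if "y \<in> carrier (mpoly_ring ?T 1)" for y
    using that unfolding mpoly_ring_simps(1)
  proof (induction rule: T.indexed_pset.induct)
    case (indexed_const k)
    then obtain s where "s \<in> S" "k = \<psi> s" by auto
    then show ?case by (intro bexI[of _ "[:s:]"]) (simp_all add: \<Theta>_const S.polys_over_const)
  next
    case (indexed_padd P Q)
    then obtain p q where "p \<in> polys_over S" "q \<in> polys_over S" "P = \<Theta> p" "Q = \<Theta> q" by blast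
    then show ?case
      by (intro bexI[of _ "p + q"]) (simp_all add: \<Theta>_add S.polys_over_add mpoly_ring_simps)
  next
    case (indexed_pmult P i)
    then obtain p where p: "p \<in> polys_over S" "P = \<Theta> p" by blast
    have "[:0, 1:] * p \<in> polys_over S" by (intro S.polys_over_mult S.polys_over_var p)
    then show ?case
      using p indexed_pmult(2) by (intro bexI[of _ "pCons 0 p"]) (simp_all add: \<Theta>_shift)
  qed
  have \<Theta>_mult: "\<Theta> (p * q) = \<Theta> p \<otimes>\<^bsub>mpoly_ring ?T 1\<^esub> \<Theta> q"
    if p: "p \<in> polys_over S" and q: "q \<in> polys_over S" for p q
  proof
    fix m
    have coeff_S: "poly.coeff p i * poly.coeff q j \<in> S" for i j
      by (intro S.S_mult S.polys_overD p q)
    show "\<Theta> (p * q) m = (\<Theta> p \<otimes>\<^bsub>mpoly_ring ?T 1\<^esub> \<Theta> q) m"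
    proof (cases "set_mset m \<subseteq> {..<1}")
      case True
      then have m: "m = replicate_mset (size m) 0"
        by (auto simp: set_mset_subset_singletonD lessThan_Suc)
      have k: "k = replicate_mset (size k) 0" if "k \<subseteq># m" for k
        using set_mset_mono[OF that] True by (auto simp: set_mset_subset_singletonD lessThan_Suc)
      \<comment> \<open>A monomial in one variable is determined by its degree, so both convolution sums agree.\<close>
      have bij: "bij_betw size {k. k \<subseteq># m} {..size m}"
      proof (rule bij_betw_byWitness[where f' = "\<lambda>i. replicate_mset i 0"])
        show "\<forall>a\<in>{k. k \<subseteq># m}. replicate_mset (size a) 0 = a" using k by auto
        show "size ` {k. k \<subseteq># m} \<subseteq> {..size m}" by (auto simp: size_mset_mono)
        show "(\<lambda>i. replicate_mset i 0) ` {..size m} \<subseteq> {k. k \<subseteq># m}"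
          by (subst m) (auto simp: subseteq_mset_def)
      qed auto
      have "poly.coeff (p * q) (size m) = (\<Sum>k | k \<subseteq># m. poly.coeff p (size k) * poly.coeff q (size m - size k))"
        unfolding coeff_mult by (rule sum.reindex_bij_betw[OF bij, symmetric])
      then have "\<Theta> (p * q) m = (\<Oplus>\<^bsub>?T\<^esub>k\<in>{k. k \<subseteq># m}. \<psi> (poly.coeff p (size k) * poly.coeff q (size m - size k)))"
        using True by (simp add: \<Theta>_def T_sum[OF finite_submultisets coeff_S])
      also have "\<dots> = (\<Oplus>\<^bsub>?T\<^esub>k\<in>{k. k \<subseteq># m}. \<Theta> p k \<otimes> \<Theta> q (m - k))"
      proof (rule T.finsum_cong')
        fix k' assume k': "k' \<in> {k. k \<subseteq># m}"
        then have "set_mset k' \<subseteq> {..<1}" "set_mset (m - k') \<subseteq> {..<1}"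
          using True by (auto dest: mset_subset_eqD in_diffD)
        then have *: "\<Theta> p k' \<otimes> \<Theta> q (m - k') = \<psi> (poly.coeff p (size k') * poly.coeff q (size m - size k'))"
          using k' by (simp add: \<Theta>_def map_mult size_Diff_submset)
        show "\<psi> (poly.coeff p (size k') * poly.coeff q (size m - size k')) = \<Theta> p k' \<otimes> \<Theta> q (m - k')"
          unfolding * ..
      next
        show "(\<lambda>k. \<Theta> p k \<otimes> \<Theta> q (m - k)) \<in> {k. k \<subseteq># m} \<rightarrow> carrier ?T"
        proof
          fix k' assume k': "k' \<in> {k. k \<subseteq># m}"
          then have "set_mset k' \<subseteq> {..<1}" "set_mset (m - k') \<subseteq> {..<1}"
            using True by (auto dest: mset_subset_eqD in_diffD)
          then show "\<Theta> p k' \<otimes> \<Theta> q (m - k') \<in> carrier ?T"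
            using coeff_S by (simp add: \<Theta>_def flip: map_mult)
        qed
      qed simp
      finally show ?thesis by (simp add: mpoly_ring_simps)
    next
      case False
      have "(\<Oplus>\<^bsub>?T\<^esub>k\<in>{k. k \<subseteq># m}. \<Theta> p k \<otimes> \<Theta> q (m - k)) = (\<Oplus>\<^bsub>?T\<^esub>k\<in>{k. k \<subseteq># m}. \<zero>\<^bsub>?T\<^esub>)"
      proof (rule T.finsum_cong')
        fix k assume k: "k \<in> {k. k \<subseteq># m}"
        then have "set_mset m = set_mset k \<union> set_mset (m - k)"
          by (metis mem_Collect_eq set_mset_union subset_mset.add_diff_inverse)
        then have "\<not> set_mset k \<subseteq> {..<1} \<or> \<not> set_mset (m - k) \<subseteq> {..<1}"
          using False by blast
        then show "\<Theta> p k \<otimes> \<Theta> q (m - k) = \<zero>\<^bsub>?T\<^esub>"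
          by (auto simp: \<Theta>_def)
      qed (use T.zero_closed in auto)
      also have "\<dots> = \<zero>" using T.finsum_zero by simp
      finally show ?thesis using False by (simp add: mpoly_ring_simps \<Theta>_def)
    qed
  qed
  have coeffs_iff: "\<Theta> p = \<Theta> q \<longleftrightarrow> (\<forall>i. \<psi> (poly.coeff p i) = \<psi> (poly.coeff q i))" for p q
  proof
    assume eq: "\<Theta> p = \<Theta> q"
    show "\<forall>i. \<psi> (poly.coeff p i) = \<psi> (poly.coeff q i)"
    proof
      fix i
      show "\<psi> (poly.coeff p i) = \<psi> (poly.coeff q i)"
        using fun_cong[OF eq, of "replicate_mset i 0"] by (simp add: \<Theta>_def split: if_splits)
    qed
  qed (auto simp: \<Theta>_def fun_eq_iff)
  have \<Theta>_eq_iff: "\<Theta> p = \<Theta> q \<longleftrightarrow> \<psi> (poly p h) = \<psi> (poly q h)"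
    if pq: "p \<in> polys_over S" "q \<in> polys_over S" for p q
  proof -
    have "\<Theta> p = \<Theta> q \<longleftrightarrow> (\<forall>i. \<psi> (poly.coeff (p - q) i) = \<zero>)"
      by (simp add: coeffs_iff map_diff)
    also have "\<dots> \<longleftrightarrow> \<psi> (poly (p - q) h) = \<zero>"
      using K.poly_mem[of "p - q" h] transcendental[OF S.polys_over_diff[OF pq]] by blast
    finally show ?thesis by (simp add: map_diff)
  qed
  define H where "H y = \<psi> (poly (SOME p. p \<in> polys_over S \<and> \<Theta> p = y) h)" for y
  have H: "H (\<Theta> p) = \<psi> (poly p h)" if p: "p \<in> polys_over S" for p
  proof -
    have "(SOME q. q \<in> polys_over S \<and> \<Theta> q = \<Theta> p) \<in> polys_over S \<and>
        \<Theta> (SOME q. q \<in> polys_over S \<and> \<Theta> q = \<Theta> p) = \<Theta> p"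
      by (rule someI[of _ p]) (simp add: p)
    then show ?thesis unfolding H_def using \<Theta>_eq_iff p by blast
  qed
  have "H \<in> ring_iso (mpoly_ring ?T 1) R"
    unfolding ring_iso_def mem_Collect_eq
  proof (intro conjI bij_betw_imageI inj_onI equalityI subsetI)
    show "H \<in> Ring.ring_hom (mpoly_ring ?T 1) R"
    proof (rule ring_hom_memI)
      fix x y assume "x \<in> carrier (mpoly_ring ?T 1)" "y \<in> carrier (mpoly_ring ?T 1)"
      then obtain p q where pq: "p \<in> polys_over S" "x = \<Theta> p" "q \<in> polys_over S" "y = \<Theta> q"
        using \<Theta>_surj by metis
      show "H (x \<otimes>\<^bsub>mpoly_ring ?T 1\<^esub> y) = H x \<otimes> H y"
        unfolding pq \<Theta>_mult[OF pq(1,3), symmetric]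
        by (simp add: H pq S.polys_over_mult map_mult)
      show "H (x \<oplus>\<^bsub>mpoly_ring ?T 1\<^esub> y) = H x \<oplus> H y"
        unfolding pq \<Theta>_add[symmetric] by (simp add: H pq S.polys_over_add map_add)
    next
      show "H x \<in> carrier R" for x by (simp add: H_def)
      have "\<one>\<^bsub>mpoly_ring ?T 1\<^esub> = \<Theta> [:1:]" by (simp add: mpoly_ring_simps \<Theta>_const map_one)
      then show "H \<one>\<^bsub>mpoly_ring ?T 1\<^esub> = \<one>"
        by (simp only: H[OF S.polys_over_const[OF S.one_S]]) (simp add: map_one)
    qed
  next
    fix x y assume xy: "x \<in> carrier (mpoly_ring ?T 1)" "y \<in> carrier (mpoly_ring ?T 1)" "H x = H y"
    then obtain p q where pq: "p \<in> polys_over S" "x = \<Theta> p" "q \<in> polys_over S" "y = \<Theta> q"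
      using \<Theta>_surj by metis
    then show "x = y" using xy(3) H \<Theta>_eq_iff by simp
  next
    fix y assume "y \<in> H ` carrier (mpoly_ring ?T 1)"
    then show "y \<in> carrier R" by (auto simp: H_def)
  next
    fix y assume "y \<in> carrier R"
    then obtain x where x: "\<psi> x = y" using surj by blast
    obtain p where p: "p \<in> polys_over S" "\<psi> x = \<psi> (poly p h)" using gen by blast
    then have "y = H (\<Theta> p)" using x H by simp
    then show "y \<in> H ` carrier (mpoly_ring ?T 1)" using \<Theta>_closed[OF p(1)] by blast
  qed
  moreover have "H (T.indexed_const s) = s" if s: "s \<in> \<psi> ` S" for s
  proof -
    obtain t where t: "t \<in> S" "s = \<psi> t" using s by blast
    show ?thesis
      unfolding t(2) \<Theta>_const[symmetric] by (simp add: H S.polys_over_const t)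
  qed
  ultimately show ?thesis
    unfolding polynomial_algebra_over_def using sub by blast
qed

lemma (in ring_map) subalgebra_generated_image:
  assumes surj: "\<And>r. r \<in> carrier R \<Longrightarrow> \<exists>x. \<psi> x = r"
    and F: "\<And>i. i < N \<Longrightarrow> f i = poly_map R \<psi> n (F i)"
  shows "subalgebra_generated R n (f ` {..<N}) = poly_map R \<psi> n ` subalgebra N F"
proof
  let ?M = "mpoly_ring R n" and ?\<Phi> = "poly_map R \<psi> n"
  interpret \<Phi>: ring_map ?M ?\<Phi> by (rule ring_map_poly_map)
  have sub: "subring (?\<Phi> ` subalgebra N F) ?M"
  proof (rule \<Phi>.subringI)
    show "\<one>\<^bsub>?M\<^esub> \<in> ?\<Phi> ` subalgebra N F"
      using const_subalgebra[of 1 N F] by (force simp: \<Phi>.map_one[symmetric])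
  qed (auto intro: subalgebra_add subalgebra_mult subalgebra_uminus
      simp flip: \<Phi>.map_add \<Phi>.map_mult \<Phi>.map_uminus)
  have incl: "indexed_const ` carrier R \<union> f ` {..<N} \<subseteq> ?\<Phi> ` subalgebra N F"
  proof
    fix y assume "y \<in> indexed_const ` carrier R \<union> f ` {..<N}"
    then consider (const) r where "r \<in> carrier R" "y = indexed_const r"
      | (gen) i where "i < N" "y = f i" by blast
    then show "y \<in> ?\<Phi> ` subalgebra N F"
    proof cases
      case const
      then obtain c where "\<psi> c = r" using surj by blast
      then show ?thesis using const poly_map_const[of n c] const_subalgebra[of c N F] by force
    next
      case gen
      then show ?thesis using F generator_subalgebra[of i N F] by force
    qed
  qed
  then have carr: "indexed_const ` carrier R \<union> f ` {..<N} \<subseteq> carrier ?M" by auto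
  show "subalgebra_generated R n (f ` {..<N}) \<subseteq> ?\<Phi> ` subalgebra N F"
    unfolding subalgebra_generated_def by (rule \<Phi>.generate_ring_min_subring1[OF carr sub incl])
  show "?\<Phi> ` subalgebra N F \<subseteq> subalgebra_generated R n (f ` {..<N})"
  proof
    fix y assume "y \<in> ?\<Phi> ` subalgebra N F"
    then obtain x where x: "x \<in> subalgebra N F" "y = ?\<Phi> x" by blast
    from x(1) have "?\<Phi> x \<in> subalgebra_generated R n (f ` {..<N})"
      unfolding subalgebra_generated_def
    proof (induction rule: subalgebra_induct)
      case (const c)
      then show ?case by (auto simp: poly_map_const intro: generate_ring.incl)
    next
      case (generator i)
      then show ?case using F by (auto intro!: generate_ring.incl)
    qed (simp_all add: \<Phi>.map_add \<Phi>.map_mult generate_ring.eng_add generate_ring.eng_mult)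
    then show "y \<in> subalgebra_generated R n (f ` {..<N})" using x by simp
  qed
qed

section \<open>The theorem\<close>

theorem theorem2p1:
  fixes R :: "('a, 'b) ring_scheme"
    and a :: 'a
    and n :: nat
    and f :: "nat \<Rightarrow> nat multiset \<Rightarrow> 'a"
  assumes "cring R"
    and "contains_rationals R"
    and "a \<in> carrier R"
    and "1 \<le> n"
    and "strongly_partial_residual_coordinate_system R n (n - 1) a f"
  shows "partial_coordinate_system R n (n - 1) f"
proof -
  let ?\<psi> = "ring_component R"
  interpret \<psi>: ring_map R ?\<psi> by (rule ring_map_component[OF assms(1)])
  have surj: "\<exists>x. ?\<psi> x = r" if "r \<in> carrier R" for r
    by (rule ring_component_surj[OF assms(1) that])
  obtain \<alpha> where \<alpha>: "?\<psi> \<alpha> = a" using surj[OF assms(3)] by blast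
  let ?\<Phi> = "poly_map R ?\<psi> n"
  interpret \<Phi>: ring_map "mpoly_ring R n" ?\<Phi> by (rule \<psi>.ring_map_poly_map)
  have \<Phi>_surj: "\<exists>x. ?\<Phi> x = y" if y: "y \<in> carrier (mpoly_ring R n)" for y
  proof -
    have "\<exists>x. y = ?\<Phi> x" by (rule \<psi>.poly_map_surj[OF surj y])
    then show ?thesis by (rule ex_forward) (rule sym)
  qed

  have f: "f ` {..<n - 1} \<subseteq> carrier (mpoly_ring R n)"
    and sys_Q: "partial_coordinate_system (R Quot (PIdl\<^bsub>R\<^esub> a)) n (n - 1)
      (\<lambda>i. (\<lambda>r. PIdl\<^bsub>R\<^esub> a +>\<^bsub>R\<^esub> r) \<circ> f i)"
    and sys_L: "partial_coordinate_system (localization R (powers R a)) n (n - 1)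
      (\<lambda>i. (\<lambda>r. fraction R (powers R a) r \<one>\<^bsub>R\<^esub>) \<circ> f i)"
    using assms(5) unfolding strongly_partial_residual_coordinate_system_def by simp_all
  have "\<forall>i. \<exists>x. i < n - 1 \<longrightarrow> ?\<Phi> x = f i"
  proof
    fix i
    show "\<exists>x. i < n - 1 \<longrightarrow> ?\<Phi> x = f i"
    proof (cases "i < n - 1")
      case True
      then have "f i \<in> carrier (mpoly_ring R n)" using f by (simp add: image_subset_iff)
      then obtain x where "?\<Phi> x = f i" by (rule \<Phi>_surj[THEN exE])
      then show ?thesis by (intro exI[of _ x] impI)
    qed simp
  qed
  from choice[OF this] obtain F where F': "\<forall>i. i < n - 1 \<longrightarrow> ?\<Phi> (F i) = f i" ..
  then have F: "f i = ?\<Phi> (F i)" if "i < n - 1" for i using that by simp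

  \<comment> \<open>\<open>F i\<close> lifts \<open>f i\<close> to the type; modulo \<open>I\<close> the type is \<open>mpoly_ring R n\<close>.\<close>
  define D where "D = jacobian n F"
  define S where "S = subalgebra (n - 1) F"
  define I where "I = \<psi>.poly_kernel n"
  have inverse: "\<exists>c. ?\<psi> (of_nat k * c) = \<one>\<^bsub>R\<^esub>" if "k > 0" for k :: nat
    by (rule \<psi>.invertible_of_rationals[OF surj assms(2) that])
  interpret I: differential_ideal D S I
    unfolding D_def S_def I_def by (rule \<psi>.differential_ideal_kernel[OF assms(4) inverse])

  \<comment> \<open>The residue ring: no denominators, hence \<open>b = 1\<close>.\<close>
  define Q where "Q = R Quot (PIdl\<^bsub>R\<^esub> a)"
  define \<pi> where "\<pi> x = PIdl\<^bsub>R\<^esub> a +>\<^bsub>R\<^esub> ?\<psi> x" for x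
  have Q1: "ring_map Q \<pi>"
    unfolding Q_def \<pi>_def by (rule \<psi>.ring_map_quotient(1)[OF surj \<alpha>])
  have Q2: "\<pi> x = \<zero>\<^bsub>Q\<^esub> \<longleftrightarrow> (\<exists>d. ?\<psi> (x - \<alpha> * d) = \<zero>\<^bsub>R\<^esub>)" for x
    unfolding Q_def \<pi>_def by (rule \<psi>.ring_map_quotient(2)[OF surj \<alpha>])
  have Q3: "\<exists>c. \<pi> c = z" if "z \<in> carrier Q" for z
    using that unfolding Q_def \<pi>_def by (rule \<psi>.ring_map_quotient(3)[OF surj \<alpha>, rotated])
  interpret \<pi>: ring_map Q \<pi> by (rule Q1)
  have "x \<in> \<pi>.poly_kernel n \<longleftrightarrow> (\<exists>y. x - const \<alpha> * y \<in> I)" for x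
    unfolding \<pi>.mem_poly_kernel_iff I_def Q2 \<psi>.coefficients_divisible_iff ..
  then have \<pi>_kernel: "\<pi>.poly_kernel n = {x. \<exists>y. x - const \<alpha> * y \<in> I}"
    by (simp add: Set.set_eq_iff)
  have \<pi>_inverse: "\<exists>c. \<pi> (of_nat k * c) = \<one>\<^bsub>Q\<^esub>" if k: "k > 0" for k :: nat
  proof -
    obtain c where "?\<psi> (of_nat k * c) = \<one>\<^bsub>R\<^esub>" using inverse[OF k] by blast
    then have "\<pi> (of_nat k * c) = \<pi> 1" by (simp add: \<pi>_def \<psi>.map_one)
    then show ?thesis unfolding \<pi>.map_one by (rule exI)
  qed
  have \<pi>_F: "((\<lambda>r. PIdl\<^bsub>R\<^esub> a +>\<^bsub>R\<^esub> r) \<circ> f i) = poly_map Q \<pi> n (F i)" if "i < n - 1" for i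
  proof
    fix m
    have "PIdl\<^bsub>R\<^esub> a +>\<^bsub>R\<^esub> \<zero>\<^bsub>R\<^esub> = \<zero>\<^bsub>Q\<^esub>"
      using \<pi>.map_zero by (simp add: \<pi>_def \<psi>.map_zero)
    then show "((\<lambda>r. PIdl\<^bsub>R\<^esub> a +>\<^bsub>R\<^esub> r) \<circ> f i) m = poly_map Q \<pi> n (F i) m"
      using F[OF that] by (simp add: poly_map_def \<pi>_def)
  qed
  have denominators: "\<exists>k c. \<pi> (1 ^ k) \<otimes>\<^bsub>Q\<^esub> r = \<pi> c" if "r \<in> carrier Q" for r
    using Q3[OF that] that by (auto simp: \<pi>.map_one)
  have "\<exists>g. \<forall>x. \<exists>k. \<exists>p\<in>polys_over (subalgebra (n - 1) F).
    poly_map Q \<pi> n (const 1 ^ k * x) = poly_map Q \<pi> n (poly p g)"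
    by (rule coordinate_system_generator[OF Q1 denominators assms(4) sys_Q[folded Q_def] \<pi>_F])
  then obtain g0 where g0: "\<And>x. \<exists>k. \<exists>p\<in>polys_over (subalgebra (n - 1) F).
    poly_map Q \<pi> n (const 1 ^ k * x) = poly_map Q \<pi> n (poly p g0)" by blast
  have "\<exists>u k. local_generator (jacobian n F) (subalgebra (n - 1) F) (\<pi>.poly_kernel n) (const 1) g0 u k"
    by (rule \<pi>.local_generator_kernel[OF assms(4) \<pi>_inverse _ g0]) simp_all
  then obtain u0 k0 where residue: "local_generator D S {x. \<exists>y. x - const \<alpha> * y \<in> I} 1 g0 u0 k0"
    unfolding \<pi>_kernel D_def[symmetric] S_def[symmetric] single_one by blast

  \<comment> \<open>The localization: denominators are powers of a preimage \<open>\<alpha>\<close> of \<open>a\<close>.\<close>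
  define L where "L = localization R (powers R a)"
  define \<tau> where "\<tau> x = fraction R (powers R a) (?\<psi> x) \<one>\<^bsub>R\<^esub>" for x
  have L1: "ring_map L \<tau>"
    unfolding L_def \<tau>_def by (rule \<psi>.ring_map_localization_powers(1)[OF surj \<alpha>])
  have L2: "\<tau> x = \<zero>\<^bsub>L\<^esub> \<longleftrightarrow> (\<exists>k. ?\<psi> (\<alpha> ^ k * x) = \<zero>\<^bsub>R\<^esub>)" for x
    unfolding L_def \<tau>_def by (rule \<psi>.ring_map_localization_powers(2)[OF surj \<alpha>])
  have L3: "\<exists>k c. \<tau> (\<alpha> ^ k) \<otimes>\<^bsub>L\<^esub> z = \<tau> c" if "z \<in> carrier L" for z
    using that unfolding L_def \<tau>_def
    by (rule \<psi>.ring_map_localization_powers(3)[OF surj \<alpha>, rotated])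
  interpret \<tau>: ring_map L \<tau> by (rule L1)
  have "x \<in> \<tau>.poly_kernel n \<longleftrightarrow> (\<exists>k. const \<alpha> ^ k * x \<in> I)" for x
    unfolding \<tau>.mem_poly_kernel_iff I_def L2 \<psi>.coefficients_torsion_iff ..
  then have \<tau>_kernel: "\<tau>.poly_kernel n = {x. \<exists>k. const \<alpha> ^ k * x \<in> I}"
    by (simp add: Set.set_eq_iff)
  have \<tau>_inverse: "\<exists>c. \<tau> (of_nat k * c) = \<one>\<^bsub>L\<^esub>" if k: "k > 0" for k :: nat
  proof -
    obtain c where "?\<psi> (of_nat k * c) = \<one>\<^bsub>R\<^esub>" using inverse[OF k] by blast
    then have "\<tau> (of_nat k * c) = \<tau> 1" by (simp add: \<tau>_def \<psi>.map_one)
    then show ?thesis unfolding \<tau>.map_one by (rule exI)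
  qed
  have \<tau>_F: "((\<lambda>r. fraction R (powers R a) r \<one>\<^bsub>R\<^esub>) \<circ> f i) = poly_map L \<tau> n (F i)"
    if "i < n - 1" for i
  proof
    fix m
    have "fraction R (powers R a) \<zero>\<^bsub>R\<^esub> \<one>\<^bsub>R\<^esub> = \<zero>\<^bsub>L\<^esub>"
      using \<tau>.map_zero by (simp add: \<tau>_def \<psi>.map_zero)
    then show "((\<lambda>r. fraction R (powers R a) r \<one>\<^bsub>R\<^esub>) \<circ> f i) m = poly_map L \<tau> n (F i) m"
      using F[OF that] by (simp add: poly_map_def \<tau>_def)
  qed
  have "\<exists>g. \<forall>x. \<exists>k. \<exists>p\<in>polys_over (subalgebra (n - 1) F).
    poly_map L \<tau> n (const \<alpha> ^ k * x) = poly_map L \<tau> n (poly p g)"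
    by (rule coordinate_system_generator[OF L1 L3 assms(4) sys_L[folded L_def] \<tau>_F])
  then obtain g1 where g1: "\<And>x. \<exists>k. \<exists>p\<in>polys_over (subalgebra (n - 1) F).
    poly_map L \<tau> n (const \<alpha> ^ k * x) = poly_map L \<tau> n (poly p g1)" by blast
  have sat: "\<tau> x = \<zero>\<^bsub>L\<^esub>" if "\<tau> (\<alpha> * x) = \<zero>\<^bsub>L\<^esub>" for x
  proof -
    obtain k where "?\<psi> (\<alpha> ^ k * (\<alpha> * x)) = \<zero>\<^bsub>R\<^esub>" using \<open>\<tau> (\<alpha> * x) = \<zero>\<^bsub>L\<^esub>\<close> L2 by blast
    then have "?\<psi> (\<alpha> ^ Suc k * x) = \<zero>\<^bsub>R\<^esub>" by (simp add: mult_ac)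
    then show ?thesis using L2 by blast
  qed
  have "\<exists>u k. local_generator (jacobian n F) (subalgebra (n - 1) F) (\<tau>.poly_kernel n) (const \<alpha>) g1 u k"
    by (rule \<tau>.local_generator_kernel[OF assms(4) \<tau>_inverse sat g1])
  then obtain u1 k1 where localized:
    "local_generator D S {x. \<exists>k. const \<alpha> ^ k * x \<in> I} (const \<alpha>) g1 u1 k1"
    unfolding \<tau>_kernel D_def[symmetric] S_def[symmetric] by blast

  interpret res: local_generator D S "{x. \<exists>y. x - const \<alpha> * y \<in> I}" 1 g0 u0 k0 by (rule residue)
  have constants: "\<exists>t\<in>S. s - const \<alpha> * t \<in> I" if s: "s \<in> S" "s - const \<alpha> * y \<in> I" for s y
  proof -
    obtain p where p: "p \<in> vars_below (n - 1)" "s = substitute F p"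
      using s(1) by (auto simp: S_def subalgebra_def)
    have "substitute F p \<in> \<pi>.poly_kernel n"
      unfolding \<pi>_kernel p(2)[symmetric] mem_Collect_eq using s(2) by (rule exI)
    moreover have "u0 * jacobian n F g0 - 1 \<in> \<pi>.poly_kernel n"
      unfolding \<pi>_kernel D_def[symmetric] using res.unit by simp
    ultimately have "\<pi> (mcoeff p m) = \<zero>\<^bsub>Q\<^esub>" for m
      by (intro \<pi>.coefficient_mem_kernel[OF assms(4) \<pi>_inverse _ p(1)])
    then have "\<exists>d. ?\<psi> (mcoeff p m - \<alpha> * d) = \<zero>\<^bsub>R\<^esub>" for m unfolding Q2 .
    from \<psi>.lift_constants[OF this p(1)] show ?thesis unfolding S_def I_def p(2) .
  qed
  have "residual_generators D S I (const \<alpha>) g0 u0 k0 g1 u1 k1"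
  proof (intro residual_generators.intro residual_generators_axioms.intro)
    show "derivation_with_constants D S" by unfold_locales
    show "differential_ideal D S I" by unfold_locales
    show "const \<alpha> \<in> S" unfolding S_def by (rule const_subalgebra)
    show "\<exists>N z w. (\<forall>i<N::nat. z i \<in> S \<and> const \<alpha> * z i \<in> I) \<and> y - (\<Sum>i<N. z i * w i) \<in> I"
      if "const \<alpha> * y \<in> I" for y
      using that unfolding S_def I_def by (rule \<psi>.torsion_kernel)
  qed (rule residue localized constants; assumption)+
  then interpret residual_generators D S I "const \<alpha>" g0 u0 k0 g1 u1 k1 .
  obtain h where h: "D h - 1 \<in> I" "\<And>x. \<exists>p\<in>polys_over S. x - poly p h \<in> I"
    using exists_generating_slice by blast

  \<comment> \<open>Transcendence of \<open>h\<close> over \<open>S\<close> modulo \<open>I\<close> itself, again from \<open>D h = 1\<close>.\<close>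
  have one: "local_ideal D S I 1"
    by (intro local_ideal.intro local_ideal_axioms.intro I.differential_ideal_axioms I.one_S) simp
  have "polynomial_algebra_over (mpoly_ring R n) (?\<Phi> ` S) 1"
  proof (rule \<Phi>.polynomial_algebra_over_image)
    show "subring_set S" by unfold_locales
    show "\<exists>p\<in>polys_over S. ?\<Phi> x = ?\<Phi> (poly p h)" for x
      using h(2)[of x] unfolding I_def \<psi>.diff_mem_poly_kernel_iff .
    show "?\<Phi> (poly.coeff p i) = \<zero>\<^bsub>mpoly_ring R n\<^esub>"
      if p: "p \<in> polys_over S" "?\<Phi> (poly p h) = \<zero>\<^bsub>mpoly_ring R n\<^esub>" for p i
    proof -
      have "poly p h \<in> I" unfolding I_def \<psi>.poly_kernel_def using p(2) by simp
      moreover have "1 * D h - 1 ^ 0 \<in> I" using h(1) by simp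
      ultimately have "poly.coeff p i \<in> I" using local_ideal.transcendental[OF one _ p(1)] by blast
      then show ?thesis unfolding I_def \<psi>.poly_kernel_def by simp
    qed
  qed (rule \<Phi>_surj)
  moreover have "subalgebra_generated R n (f ` {..<n - 1}) = ?\<Phi> ` S"
    unfolding S_def by (rule \<psi>.subalgebra_generated_image[OF surj F])
  ultimately show ?thesis
    using f assms(4) by (simp add: partial_coordinate_system_def)
qed

end
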